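(* Let $(p:M\to B,\Phi_V)$ be a $2$-plectic fibration, and fix a $2$-plectic connection with curvature $C$. Then $\partial_C\Phi_V\in\Omega^2(B,\Omega^2(\mathcal V))$ defines a class $[\partial_C\Phi_V]_2\in H^2(B,H^2(\mathcal V))$, which is an obstruction to the existence of a closed extension of $\Phi_V$: if there exists a closed $3$-form $\Phi\in\Omega^3(M)$ with $\Phi|_{\wedge^3\mathcal V}=\Phi_V$, then $[\partial_C\Phi_V]_2=0$.
   Context: All objects are smooth. A fibration $p:M\to B$ is a surjective submersion admitting a complete Ehresmann connection. $\mathcal V=\ker dp$, $\Omega^q(\mathcal V)=\Gamma(\wedge^q\mathcal V^* )$, $d_V$ is the vertical de Rham differential. For an Ehresmann connection $TM=\mathcal V\oplus\mathrm{Hor}$, $h$ is the horizontal lift and $C(u,v)=[h(u),h(v)]-h([u,v])$ the curvature. $\Omega^p(B,\Omega^q(\mathcal V))$ is the space of $C^\infty(B)$-multilinear alternating $p$-forms on $\mathfrak X(B)$ with values in $\Omega^q(\mathcal V)$. On $\Theta\in\Omega^p(B,\Omega^q(\mathcal V))$: $\partial_V\Theta=(-1)^pd_V\circ\Theta$; $$(\partial_H\Theta)(v_0,\dots,v_p)=\sum_i(-1)^i\mathcal L_{h(v_i)}\Theta(\dots\widehat{v_i}\dots)+\sum_{i<j}(-1)^{i+j}\Theta([v_i,v_j],\dots\widehat{v_i}\dots\widehat{v_j}\dots);$$ $$(\partial_C\Theta)(v_0,\dots,v_{p+1})=(-1)^p\sum_{i<j}(-1)^{i+j}i_{C(v_i,v_j)}\Theta(\dots\widehat{v_i}\dots\widehat{v_j}\dots).$$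 Under the identification $\Omega^k(M)\simeq\bigoplus_{p+q=k}\Omega^p(B,\Omega^q(\mathcal V))$, $\Theta^{(p,q)}(v_1,\dots,v_p)(w_1,\dots,w_q)=\Theta(h(v_1),\dots,h(v_p),w_1,\dots,w_q)$, one has $d=\partial_V+\partial_H+\partial_C$. $\Omega^p(B,H^q(\mathcal V))$ denotes the cohomology of $\partial_V$ at $\Omega^p(B,\Omega^q(\mathcal V))$ (the $E_1^{p,q}$ term of the Leray–Serre spectral sequence); $[\,\cdot\,]_1$ denotes classes there. $\partial_H$ induces a differential on it, whose cohomology is denoted $H^p(B,H^q(\mathcal V))$ ($=E_2^{p,q}$); $[\,\cdot\,]_2$ denotes classes there. A $2$-plectic fibration is a fibration with $\Phi_V\in\Omega^3(\mathcal V)$ such that $d_V\Phi_V=0$ and $i_X\Phi_V=0\Rightarrow X=0$ for $X\in\mathcal V$, which admits a $2$-plectic connection, i.e. one with $\partial_H\Phi_V=0$. *)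

theory Defs
  imports
    "HOL-Analysis.Analysis"
    "HOL-Algebra.Coset"
    "HOL-Library.Function_Algebras"
begin

section \<open>Smooth manifolds\<close>

text \<open>A manifold is a Hausdorff second countable type together with an atlas. The model space is a
  type of class \<open>real_inner\<close> that is required to be finite-dimensional; unlike \<open>euclidean_space\<close>,
  this admits manifolds of dimension 0.\<close>

primrec Ck_on :: "nat \<Rightarrow> 'a set \<Rightarrow> ('a::real_normed_vector \<Rightarrow> 'b::real_normed_vector) \<Rightarrow> bool" where
  "Ck_on 0 S f \<longleftrightarrow> continuous_on S f"
| "Ck_on (Suc k) S f \<longleftrightarrow> (\<forall>x\<in>S. f differentiable (at x)) \<and>
     (\<forall>v. Ck_on k S (\<lambda>x. frechet_derivative f (at x) v))"

text \<open>Only used for open sets in finite-dimensional spaces.\<close>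

definition Cinf_on :: "'a set \<Rightarrow> ('a::real_normed_vector \<Rightarrow> 'b::real_normed_vector) \<Rightarrow> bool" where
  "Cinf_on S f \<longleftrightarrow> (\<forall>k. Ck_on k S f)"

type_synonym ('m, 'e) atlas = "('m set \<times> ('m \<Rightarrow> 'e)) set"

definition smooth_atlas ::
  "('m::{t2_space, second_countable_topology}, 'e::real_inner) atlas \<Rightarrow> bool" where
  "smooth_atlas A \<longleftrightarrow>
     (\<exists>S::'e set. finite S \<and> span S = UNIV) \<and>
     (\<Union>(U, \<phi>)\<in>A. U) = UNIV \<and>
     (\<forall>(U, \<phi>)\<in>A. open U \<and> open (\<phi> ` U) \<and> (\<exists>\<psi>. homeomorphism U (\<phi> ` U) \<phi> \<psi>)) \<and>
     (\<forall>(U, \<phi>)\<in>A. \<forall>(V, \<psi>)\<in>A. Cinf_on (\<phi> ` (U \<inter> V)) (\<psi> \<circ> inv_into U \<phi>))"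

definition smooth_map ::
  "('m::topological_space, 'e::real_normed_vector) atlas \<Rightarrow>
   ('b::topological_space, 'f::real_normed_vector) atlas \<Rightarrow> ('m \<Rightarrow> 'b) \<Rightarrow> bool" where
  "smooth_map A B p \<longleftrightarrow> continuous_on UNIV p \<and>
     (\<forall>(U, \<phi>)\<in>A. \<forall>(V, \<psi>)\<in>B. Cinf_on (\<phi> ` (U \<inter> p -` V)) (\<psi> \<circ> p \<circ> inv_into U \<phi>))"

definition smooth_fun_on ::
  "('m::topological_space, 'e::real_normed_vector) atlas \<Rightarrow> 'm set \<Rightarrow> ('m \<Rightarrow> real) \<Rightarrow> bool" where
  "smooth_fun_on A W f \<longleftrightarrow> (\<forall>(U, \<phi>)\<in>A. Cinf_on (\<phi> ` (U \<inter> W)) (f \<circ> inv_into U \<phi>))"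

definition smooth_fun_at ::
  "('m::topological_space, 'e::real_normed_vector) atlas \<Rightarrow> 'm \<Rightarrow> ('m \<Rightarrow> real) \<Rightarrow> bool" where
  "smooth_fun_at A x f \<longleftrightarrow> (\<exists>W. open W \<and> x \<in> W \<and> smooth_fun_on A W f)"

definition smooth_funs ::
  "('m::topological_space, 'e::real_normed_vector) atlas \<Rightarrow> ('m \<Rightarrow> real) set" where
  "smooth_funs A = {f. smooth_fun_on A UNIV f}"


section \<open>Tangent vectors and vector fields\<close>

text \<open>Tangent vectors at \<open>x\<close> are the derivations of germs at \<open>x\<close> of smooth functions. They are
  extended by 0 to functions that are not smooth near \<open>x\<close>, so that equality of tangent vectors is
  equality of functionals.\<close>

type_synonym 'm tvec = "('m \<Rightarrow> real) \<Rightarrow> real"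
type_synonym 'm vfield = "'m \<Rightarrow> 'm tvec"

definition tangent_space ::
  "('m::topological_space, 'e::real_normed_vector) atlas \<Rightarrow> 'm \<Rightarrow> 'm tvec set" where
  "tangent_space A x = {u.
     (\<forall>f. \<not> smooth_fun_at A x f \<longrightarrow> u f = 0) \<and>
     (\<forall>f g. smooth_fun_at A x f \<longrightarrow> smooth_fun_at A x g \<longrightarrow>
        (\<forall>\<^sub>F y in nhds x. f y = g y) \<longrightarrow> u f = u g) \<and>
     (\<forall>f g. smooth_fun_at A x f \<longrightarrow> smooth_fun_at A x g \<longrightarrow>
        u (\<lambda>y. f y + g y) = u f + u g \<and>
        u (\<lambda>y. f y * g y) = f x * u g + g x * u f) \<and>
     (\<forall>f c. smooth_fun_at A x f \<longrightarrow> u (\<lambda>y. c * f y) = c * u f)}"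

definition tsubspace :: "'m tvec set \<Rightarrow> bool" where
  "tsubspace S \<longleftrightarrow> 0 \<in> S \<and> (\<forall>u\<in>S. \<forall>v\<in>S. u + v \<in> S) \<and> (\<forall>c. \<forall>u\<in>S. (\<lambda>f. c * u f) \<in> S)"

definition smooth_vfield_on ::
  "('m::topological_space, 'e::real_normed_vector) atlas \<Rightarrow> 'm set \<Rightarrow> 'm vfield \<Rightarrow> bool" where
  "smooth_vfield_on A W X \<longleftrightarrow> (\<forall>x\<in>W. X x \<in> tangent_space A x) \<and>
     (\<forall>W' f. open W' \<longrightarrow> W' \<subseteq> W \<longrightarrow> smooth_fun_on A W' f \<longrightarrow> smooth_fun_on A W' (\<lambda>x. X x f))"

definition vfields ::
  "('m::topological_space, 'e::real_normed_vector) atlas \<Rightarrow> 'm vfield set" where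
  "vfields A = {X. smooth_vfield_on A UNIV X}"

definition vf_smult :: "('m \<Rightarrow> real) \<Rightarrow> 'm vfield \<Rightarrow> 'm vfield" where
  "vf_smult f X = (\<lambda>x g. f x * X x g)"

definition bracket ::
  "('m::topological_space, 'e::real_normed_vector) atlas \<Rightarrow>
   'm vfield \<Rightarrow> 'm vfield \<Rightarrow> 'm vfield" where
  "bracket A X Y = (\<lambda>x f. if smooth_fun_at A x f
     then X x (\<lambda>y. Y y f) - Y x (\<lambda>y. X y f) else 0)"

definition tangent_map ::
  "('m::topological_space, 'e::real_normed_vector) atlas \<Rightarrow>
   ('b::topological_space, 'f::real_normed_vector) atlas \<Rightarrow>
   ('m \<Rightarrow> 'b) \<Rightarrow> 'm \<Rightarrow> 'm tvec \<Rightarrow> 'b tvec" where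
  "tangent_map A B p x u = (\<lambda>g. if smooth_fun_at B (p x) g then u (g \<circ> p) else 0)"

definition velocity ::
  "('m::topological_space, 'e::real_normed_vector) atlas \<Rightarrow> (real \<Rightarrow> 'm) \<Rightarrow> real \<Rightarrow> 'm tvec" where
  "velocity A \<gamma> t = (\<lambda>f. if smooth_fun_at A (\<gamma> t) f then deriv (f \<circ> \<gamma>) t else 0)"

definition smooth_curve ::
  "('m::topological_space, 'e::real_normed_vector) atlas \<Rightarrow> (real \<Rightarrow> 'm) \<Rightarrow> bool" where
  "smooth_curve A \<gamma> \<longleftrightarrow> smooth_map {(UNIV, id :: real \<Rightarrow> real)} A \<gamma>"


section \<open>Multilinear forms and the de Rham differential\<close>

text \<open>Alternating \<open>k\<close>-linear maps from the module \<open>V\<close> to the module \<open>W\<close> over the ring \<open>R\<close>. An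
  argument tuple is a list; the value is 0 on lists that are not tuples of \<open>k\<close> elements of \<open>V\<close>.\<close>

definition alt_forms ::
  "'r set \<Rightarrow> ('r \<Rightarrow> 'v \<Rightarrow> 'v) \<Rightarrow> 'v set \<Rightarrow> ('r \<Rightarrow> 'w \<Rightarrow> 'w) \<Rightarrow> 'w set \<Rightarrow> nat \<Rightarrow>
   ('v::ab_group_add list \<Rightarrow> 'w::ab_group_add) set" where
  "alt_forms R smV V smW W k = {\<omega>.
     (\<forall>vs. length vs = k \<and> set vs \<subseteq> V \<longrightarrow> \<omega> vs \<in> W) \<and>
     (\<forall>vs. \<not> (length vs = k \<and> set vs \<subseteq> V) \<longrightarrow> \<omega> vs = 0) \<and>
     (\<forall>vs i v v'. length vs = k \<and> set vs \<subseteq> V \<and> i < k \<and> v \<in> V \<and> v' \<in> V \<longrightarrow>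
        \<omega> (vs[i := v + v']) = \<omega> (vs[i := v]) + \<omega> (vs[i := v'])) \<and>
     (\<forall>vs i v r. length vs = k \<and> set vs \<subseteq> V \<and> i < k \<and> v \<in> V \<and> r \<in> R \<longrightarrow>
        \<omega> (vs[i := smV r v]) = smW r (\<omega> (vs[i := v]))) \<and>
     (\<forall>vs i j. length vs = k \<and> set vs \<subseteq> V \<and> i < j \<and> j < k \<and> vs ! i = vs ! j \<longrightarrow> \<omega> vs = 0)}"

type_synonym 'm form = "'m vfield list \<Rightarrow> 'm \<Rightarrow> real"

text \<open>For a module \<open>S\<close> of vector fields, closed under brackets, that consists of the sections of a
  subbundle of the tangent bundle, the sections of the \<open>k\<close>-th exterior power of the dual bundle are
  the \<open>C\<^sup>\<infinity>(M)\<close>-multilinear alternating maps on \<open>S\<close>, and Koszul's formula is the (leafwise)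
  exterior derivative. The set \<open>-{i}\<close> in \<open>nths\<close> selects all positions but \<open>i\<close>.\<close>

definition module_forms ::
  "('m::topological_space, 'e::real_normed_vector) atlas \<Rightarrow> 'm vfield set \<Rightarrow> nat \<Rightarrow> 'm form set" where
  "module_forms A S k = alt_forms (smooth_funs A) vf_smult S (*) (smooth_funs A) k"

definition koszul_d ::
  "('m::topological_space, 'e::real_normed_vector) atlas \<Rightarrow> 'm vfield set \<Rightarrow> 'm form \<Rightarrow> 'm form" where
  "koszul_d A S \<omega> = (\<lambda>ws x. if set ws \<subseteq> S then
      (\<Sum>i<length ws. (-1)^i * (ws ! i) x (\<omega> (nths ws (-{i})))) +
      (\<Sum>j<length ws. \<Sum>i<j. (-1)^(i+j) * \<omega> (bracket A (ws ! i) (ws ! j) # nths ws (-{i, j})) x)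
    else 0)"

definition forms ::
  "('m::topological_space, 'e::real_normed_vector) atlas \<Rightarrow> nat \<Rightarrow> 'm form set" where
  "forms A k = module_forms A (vfields A) k"

definition ext_d ::
  "('m::topological_space, 'e::real_normed_vector) atlas \<Rightarrow> 'm form \<Rightarrow> 'm form" where
  "ext_d A = koszul_d A (vfields A)"


section \<open>Fibrations and Ehresmann connections\<close>

definition surjective_submersion ::
  "('m::topological_space, 'e::real_normed_vector) atlas \<Rightarrow>
   ('b::topological_space, 'f::real_normed_vector) atlas \<Rightarrow> ('m \<Rightarrow> 'b) \<Rightarrow> bool" where
  "surjective_submersion A B p \<longleftrightarrow> smooth_map A B p \<and> surj p \<and>
     (\<forall>x. tangent_map A B p x ` tangent_space A x = tangent_space B (p x))"

definition vert_space ::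
  "('m::topological_space, 'e::real_normed_vector) atlas \<Rightarrow>
   ('b::topological_space, 'f::real_normed_vector) atlas \<Rightarrow> ('m \<Rightarrow> 'b) \<Rightarrow> 'm \<Rightarrow> 'm tvec set" where
  "vert_space A B p x = {u \<in> tangent_space A x. tangent_map A B p x u = 0}"

definition vert_fields ::
  "('m::topological_space, 'e::real_normed_vector) atlas \<Rightarrow>
   ('b::topological_space, 'f::real_normed_vector) atlas \<Rightarrow> ('m \<Rightarrow> 'b) \<Rightarrow> 'm vfield set" where
  "vert_fields A B p = {X \<in> vfields A. \<forall>x. X x \<in> vert_space A B p x}"

text \<open>The last condition says that \<open>Hor\<close> is a smooth subbundle: it has smooth local frames.\<close>

definition ehresmann_connection ::
  "('m::topological_space, 'e::real_normed_vector) atlas \<Rightarrow>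
   ('b::topological_space, 'f::real_normed_vector) atlas \<Rightarrow> ('m \<Rightarrow> 'b) \<Rightarrow>
   ('m \<Rightarrow> 'm tvec set) \<Rightarrow> bool" where
  "ehresmann_connection A B p Hor \<longleftrightarrow>
     (\<forall>x. tsubspace (Hor x) \<and> Hor x \<subseteq> tangent_space A x \<and>
          vert_space A B p x \<inter> Hor x = {0} \<and>
          (\<forall>u\<in>tangent_space A x. \<exists>a\<in>vert_space A B p x. \<exists>b\<in>Hor x. u = a + b)) \<and>
     (\<forall>x. \<exists>W (k::nat) X. open W \<and> x \<in> W \<and> (\<forall>i<k. smooth_vfield_on A W (X i)) \<and>
        (\<forall>y\<in>W. (\<forall>i<k. X i y \<in> Hor y) \<and>
          (\<forall>u\<in>Hor y. \<exists>!c::nat \<Rightarrow> real. (\<forall>i\<ge>k. c i = 0) \<and> u = (\<lambda>f. \<Sum>i<k. c i * X i y f))))"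

text \<open>Completeness: every smooth curve in the base has a horizontal lift, defined for all times,
  through every point over its starting point.\<close>

definition complete_connection ::
  "('m::topological_space, 'e::real_normed_vector) atlas \<Rightarrow>
   ('b::topological_space, 'f::real_normed_vector) atlas \<Rightarrow> ('m \<Rightarrow> 'b) \<Rightarrow>
   ('m \<Rightarrow> 'm tvec set) \<Rightarrow> bool" where
  "complete_connection A B p Hor \<longleftrightarrow>
     (\<forall>\<gamma> x. smooth_curve B \<gamma> \<and> p x = \<gamma> 0 \<longrightarrow>
        (\<exists>\<delta>. smooth_curve A \<delta> \<and> \<delta> 0 = x \<and> p \<circ> \<delta> = \<gamma> \<and> (\<forall>t. velocity A \<delta> t \<in> Hor (\<delta> t))))"

definition fibration ::
  "('m::{t2_space, second_countable_topology}, 'e::real_inner) atlas \<Rightarrow>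
   ('b::{t2_space, second_countable_topology}, 'f::real_inner) atlas \<Rightarrow> ('m \<Rightarrow> 'b) \<Rightarrow> bool" where
  "fibration A B p \<longleftrightarrow> smooth_atlas A \<and> smooth_atlas B \<and> surjective_submersion A B p \<and>
     (\<exists>Hor. ehresmann_connection A B p Hor \<and> complete_connection A B p Hor)"

definition hlift ::
  "('m::topological_space, 'e::real_normed_vector) atlas \<Rightarrow>
   ('b::topological_space, 'f::real_normed_vector) atlas \<Rightarrow> ('m \<Rightarrow> 'b) \<Rightarrow>
   ('m \<Rightarrow> 'm tvec set) \<Rightarrow> 'b vfield \<Rightarrow> 'm vfield" where
  "hlift A B p Hor v = (\<lambda>x. THE u. u \<in> Hor x \<and> tangent_map A B p x u = v (p x))"

definition curvature ::
  "('m::topological_space, 'e::real_normed_vector) atlas \<Rightarrow>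
   ('b::topological_space, 'f::real_normed_vector) atlas \<Rightarrow> ('m \<Rightarrow> 'b) \<Rightarrow>
   ('m \<Rightarrow> 'm tvec set) \<Rightarrow> 'b vfield \<Rightarrow> 'b vfield \<Rightarrow> 'm vfield" where
  "curvature A B p Hor u v =
     bracket A (hlift A B p Hor u) (hlift A B p Hor v) - hlift A B p Hor (bracket B u v)"


section \<open>Bigraded forms\<close>

definition vert_forms ::
  "('m::topological_space, 'e::real_normed_vector) atlas \<Rightarrow>
   ('b::topological_space, 'f::real_normed_vector) atlas \<Rightarrow> ('m \<Rightarrow> 'b) \<Rightarrow> nat \<Rightarrow> 'm form set" where
  "vert_forms A B p q = module_forms A (vert_fields A B p) q"

definition vert_d ::
  "('m::topological_space, 'e::real_normed_vector) atlas \<Rightarrow>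
   ('b::topological_space, 'f::real_normed_vector) atlas \<Rightarrow> ('m \<Rightarrow> 'b) \<Rightarrow> 'm form \<Rightarrow> 'm form" where
  "vert_d A B p = koszul_d A (vert_fields A B p)"

definition lie_vert ::
  "('m::topological_space, 'e::real_normed_vector) atlas \<Rightarrow>
   ('b::topological_space, 'f::real_normed_vector) atlas \<Rightarrow> ('m \<Rightarrow> 'b) \<Rightarrow>
   'm vfield \<Rightarrow> 'm form \<Rightarrow> 'm form" where
  "lie_vert A B p X \<omega> = (\<lambda>ws x. if set ws \<subseteq> vert_fields A B p then
      X x (\<omega> ws) - (\<Sum>j<length ws. \<omega> (ws[j := bracket A X (ws ! j)]) x) else 0)"

definition contraction :: "'m vfield \<Rightarrow> 'm form \<Rightarrow> 'm form" where
  "contraction X \<omega> = (\<lambda>ws. \<omega> (X # ws))"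

type_synonym ('b, 'm) biform = "'b vfield list \<Rightarrow> 'm form"

definition biforms ::
  "('m::topological_space, 'e::real_normed_vector) atlas \<Rightarrow>
   ('b::topological_space, 'f::real_normed_vector) atlas \<Rightarrow> ('m \<Rightarrow> 'b) \<Rightarrow>
   nat \<Rightarrow> nat \<Rightarrow> ('b, 'm) biform set" where
  "biforms A B p k q = alt_forms (smooth_funs B) vf_smult (vfields B)
     (\<lambda>f \<omega> ws. (f \<circ> p) * \<omega> ws) (vert_forms A B p q) k"

text \<open>Vertical forms as biforms of base degree 0.\<close>

definition biform0 :: "'m form \<Rightarrow> ('b, 'm) biform" where
  "biform0 \<omega> = (\<lambda>vs. if vs = [] then \<omega> else 0)"

definition dV ::
  "('m::topological_space, 'e::real_normed_vector) atlas \<Rightarrow>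
   ('b::topological_space, 'f::real_normed_vector) atlas \<Rightarrow> ('m \<Rightarrow> 'b) \<Rightarrow>
   ('b, 'm) biform \<Rightarrow> ('b, 'm) biform" where
  "dV A B p \<Theta> = (\<lambda>vs ws x. (-1)^(length vs) * vert_d A B p (\<Theta> vs) ws x)"

definition dH ::
  "('m::topological_space, 'e::real_normed_vector) atlas \<Rightarrow>
   ('b::topological_space, 'f::real_normed_vector) atlas \<Rightarrow> ('m \<Rightarrow> 'b) \<Rightarrow>
   ('m \<Rightarrow> 'm tvec set) \<Rightarrow> ('b, 'm) biform \<Rightarrow> ('b, 'm) biform" where
  "dH A B p Hor \<Theta> = (\<lambda>vs ws x. if set vs \<subseteq> vfields B then
      (\<Sum>i<length vs. (-1)^i * lie_vert A B p (hlift A B p Hor (vs ! i)) (\<Theta> (nths vs (-{i}))) ws x) +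
      (\<Sum>j<length vs. \<Sum>i<j. (-1)^(i+j) * \<Theta> (bracket B (vs ! i) (vs ! j) # nths vs (-{i, j})) ws x)
    else 0)"

text \<open>On a form of base degree \<open>k\<close> the argument list has length \<open>k + 2\<close>.\<close>

definition dC ::
  "('m::topological_space, 'e::real_normed_vector) atlas \<Rightarrow>
   ('b::topological_space, 'f::real_normed_vector) atlas \<Rightarrow> ('m \<Rightarrow> 'b) \<Rightarrow>
   ('m \<Rightarrow> 'm tvec set) \<Rightarrow> ('b, 'm) biform \<Rightarrow> ('b, 'm) biform" where
  "dC A B p Hor \<Theta> = (\<lambda>vs ws x. if set vs \<subseteq> vfields B then
      (-1)^(length vs - 2) * (\<Sum>j<length vs. \<Sum>i<j. (-1)^(i+j) *
         contraction (curvature A B p Hor (vs ! i) (vs ! j)) (\<Theta> (nths vs (-{i, j}))) ws x)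
    else 0)"


section \<open>The terms \<open>E\<^sub>1\<close> and \<open>E\<^sub>2\<close>\<close>

definition additive_group :: "'a::ab_group_add set \<Rightarrow> 'a monoid" where
  "additive_group S = \<lparr>carrier = S, monoid.mult = (+), one = 0\<rparr>"

definition Z1 ::
  "('m::topological_space, 'e::real_normed_vector) atlas \<Rightarrow>
   ('b::topological_space, 'f::real_normed_vector) atlas \<Rightarrow> ('m \<Rightarrow> 'b) \<Rightarrow>
   nat \<Rightarrow> nat \<Rightarrow> ('b, 'm) biform monoid" where
  "Z1 A B p k q = additive_group {\<Theta> \<in> biforms A B p k q. dV A B p \<Theta> = 0}"

definition B1 ::
  "('m::topological_space, 'e::real_normed_vector) atlas \<Rightarrow>
   ('b::topological_space, 'f::real_normed_vector) atlas \<Rightarrow> ('m \<Rightarrow> 'b) \<Rightarrow>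
   nat \<Rightarrow> nat \<Rightarrow> ('b, 'm) biform set" where
  "B1 A B p k q = (case q of 0 \<Rightarrow> {0} | Suc q' \<Rightarrow> dV A B p ` biforms A B p k q')"

definition E1 ::
  "('m::topological_space, 'e::real_normed_vector) atlas \<Rightarrow>
   ('b::topological_space, 'f::real_normed_vector) atlas \<Rightarrow> ('m \<Rightarrow> 'b) \<Rightarrow>
   nat \<Rightarrow> nat \<Rightarrow> ('b, 'm) biform set monoid" where
  "E1 A B p k q = Z1 A B p k q Mod B1 A B p k q"

definition class1 ::
  "('m::topological_space, 'e::real_normed_vector) atlas \<Rightarrow>
   ('b::topological_space, 'f::real_normed_vector) atlas \<Rightarrow> ('m \<Rightarrow> 'b) \<Rightarrow>
   nat \<Rightarrow> nat \<Rightarrow> ('b, 'm) biform \<Rightarrow> ('b, 'm) biform set" where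
  "class1 A B p k q \<Theta> = B1 A B p k q #>\<^bsub>Z1 A B p k q\<^esub> \<Theta>"

text \<open>The map on classes induced by \<open>dH\<close>: the common value of \<open>[dH \<Theta>]\<close> for all representatives
  \<open>\<Theta>\<close> of the class \<open>a\<close>.\<close>

definition dH_induced ::
  "('m::topological_space, 'e::real_normed_vector) atlas \<Rightarrow>
   ('b::topological_space, 'f::real_normed_vector) atlas \<Rightarrow> ('m \<Rightarrow> 'b) \<Rightarrow>
   ('m \<Rightarrow> 'm tvec set) \<Rightarrow> nat \<Rightarrow> nat \<Rightarrow> ('b, 'm) biform set \<Rightarrow> ('b, 'm) biform set" where
  "dH_induced A B p Hor k q a = the_elem ((\<lambda>\<Theta>. class1 A B p (Suc k) q (dH A B p Hor \<Theta>)) ` a)"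

definition Z2 ::
  "('m::topological_space, 'e::real_normed_vector) atlas \<Rightarrow>
   ('b::topological_space, 'f::real_normed_vector) atlas \<Rightarrow> ('m \<Rightarrow> 'b) \<Rightarrow>
   ('m \<Rightarrow> 'm tvec set) \<Rightarrow> nat \<Rightarrow> nat \<Rightarrow> ('b, 'm) biform set monoid" where
  "Z2 A B p Hor k q = (E1 A B p k q)
     \<lparr>carrier := kernel (E1 A B p k q) (E1 A B p (Suc k) q) (dH_induced A B p Hor k q)\<rparr>"

definition B2 ::
  "('m::topological_space, 'e::real_normed_vector) atlas \<Rightarrow>
   ('b::topological_space, 'f::real_normed_vector) atlas \<Rightarrow> ('m \<Rightarrow> 'b) \<Rightarrow>
   ('m \<Rightarrow> 'm tvec set) \<Rightarrow> nat \<Rightarrow> nat \<Rightarrow> ('b, 'm) biform set set" where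
  "B2 A B p Hor k q = (case k of 0 \<Rightarrow> {\<one>\<^bsub>E1 A B p k q\<^esub>}
     | Suc k' \<Rightarrow> dH_induced A B p Hor k' q ` carrier (E1 A B p k' q))"

definition E2 ::
  "('m::topological_space, 'e::real_normed_vector) atlas \<Rightarrow>
   ('b::topological_space, 'f::real_normed_vector) atlas \<Rightarrow> ('m \<Rightarrow> 'b) \<Rightarrow>
   ('m \<Rightarrow> 'm tvec set) \<Rightarrow> nat \<Rightarrow> nat \<Rightarrow> ('b, 'm) biform set set monoid" where
  "E2 A B p Hor k q = Z2 A B p Hor k q Mod B2 A B p Hor k q"

definition class2 ::
  "('m::topological_space, 'e::real_normed_vector) atlas \<Rightarrow>
   ('b::topological_space, 'f::real_normed_vector) atlas \<Rightarrow> ('m \<Rightarrow> 'b) \<Rightarrow>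
   ('m \<Rightarrow> 'm tvec set) \<Rightarrow> nat \<Rightarrow> nat \<Rightarrow> ('b, 'm) biform \<Rightarrow> ('b, 'm) biform set set" where
  "class2 A B p Hor k q \<Theta> = B2 A B p Hor k q #>\<^bsub>Z2 A B p Hor k q\<^esub> class1 A B p k q \<Theta>"


section \<open>2-plectic fibrations\<close>

definition two_plectic_connection ::
  "('m::topological_space, 'e::real_normed_vector) atlas \<Rightarrow>
   ('b::topological_space, 'f::real_normed_vector) atlas \<Rightarrow> ('m \<Rightarrow> 'b) \<Rightarrow> 'm form \<Rightarrow>
   ('m \<Rightarrow> 'm tvec set) \<Rightarrow> bool" where
  "two_plectic_connection A B p \<Phi>V Hor \<longleftrightarrow> ehresmann_connection A B p Hor \<and>
     dH A B p Hor (biform0 \<Phi>V) = 0"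

text \<open>Nondegeneracy is a pointwise condition on vertical tangent vectors; every such vector at \<open>x\<close>
  is the value \<open>X x\<close> of a vertical vector field.\<close>

definition two_plectic_fibration ::
  "('m::{t2_space, second_countable_topology}, 'e::real_inner) atlas \<Rightarrow>
   ('b::{t2_space, second_countable_topology}, 'f::real_inner) atlas \<Rightarrow> ('m \<Rightarrow> 'b) \<Rightarrow>
   'm form \<Rightarrow> bool" where
  "two_plectic_fibration A B p \<Phi>V \<longleftrightarrow> fibration A B p \<and>
     \<Phi>V \<in> vert_forms A B p 3 \<and> vert_d A B p \<Phi>V = 0 \<and>
     (\<forall>x. \<forall>X\<in>vert_fields A B p.
        (\<forall>Y\<in>vert_fields A B p. \<forall>Z\<in>vert_fields A B p. \<Phi>V [X, Y, Z] x = 0) \<longrightarrow> X x = 0) \<and>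
     (\<exists>Hor. two_plectic_connection A B p \<Phi>V Hor)"

end

theory Submission
  imports Defs
begin

text \<open>
  Everything is algebra of vector fields once the horizontal lift of a smooth field is known to be
  smooth. That is a local statement: in a local frame of the connection the coefficients of the lift
  solve a linear system whose matrix is the identity at the given point, if the system is written
  down with functions on the base that are dual to the projected frame. No coordinates on the base
  and no bump functions are needed.

  Lifts preserve vertical fields, and the curvature \<open>C\<close> is vertical. Since \<open>\<Phi>V\<close> is invariant under
  horizontal lifts, it is invariant under \<open>C(u, v)\<close>, so Cartan's formula shows that
  \<open>- i\<^bsub>C(u,v)\<^esub> \<Phi>V\<close> is vertically closed, and the Bianchi identity shows that it is annihilated by the
  horizontal differential. For a closed extension \<open>\<Phi>\<close>, the components of bidegree \<open>(1, 3)\<close> and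
  \<open>(2, 2)\<close> of \<open>d\<Phi> = 0\<close> say that \<open>\<Phi>\<^sup>1\<^sup>2\<close> is vertically closed and that the curvature form is
  \<open>- \<partial>\<^sub>H \<Phi>\<^sup>1\<^sup>2 - \<partial>\<^sub>V \<Phi>\<^sup>2\<^sup>1\<close>.
\<close>

subsection \<open>Functions of class \<open>C\<^sup>k\<close>\<close>

text \<open>Tangent vectors act on germs, so a field can be applied to a function that is smooth
  only near a point; the dual functions on the base need no global extension. Differentials are
  expanded on explicit short tuples, which suffices because few bidegrees matter: boundaries of
  vertical degree 2 are \<open>dV\<close> of biforms of vertical degree 1, so \<open>dH\<close>
  descends to classes once it anticommutes with \<open>dV\<close> in bidegrees (1, 1) and (2, 1),
  and this reduces to \<open>vert_d\<close> commuting with Lie derivatives of vertical 1-forms. The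
  decomposition of \<open>d\<close> is likewise read off from Koszul's formula only in the two
  bidegrees used. A recurring obstacle is linearity over functions on the base: a Lie derivative is
  not function-linear in its field, but pulled back functions are constant along vertical fields, so
  that the extra terms vanish or cancel against those of the brackets. Another is the totality of
  the encoding: forms are functions on all lists, and an identity between forms also has to be
  checked on lists of the wrong length or with foreign entries, where both sides are 0.\<close>

lemma differentiable_cong_open:
  assumes "open S" "x \<in> S" "\<And>y. y \<in> S \<Longrightarrow> f y = g y" "f differentiable (at x)"
  shows "g differentiable (at x)"
  using assms unfolding differentiable_def by (meson has_derivative_transform_within_open)

lemma Ck_on_cong:
  assumes "open S" "\<And>x. x \<in> S \<Longrightarrow> f x = g x" "Ck_on k S f"
  shows "Ck_on k S g"
  using assms
proof (induction k arbitrary: f g)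
  case 0
  then show ?case by (simp cong: continuous_on_cong)
next
  case (Suc k)
  have "g differentiable (at x)" if "x \<in> S" for x
    using differentiable_cong_open[of S x f g] Suc.prems that by simp
  moreover have "Ck_on k S (\<lambda>x. frechet_derivative g (at x) v)" for v
  proof (rule Suc.IH)
    show "frechet_derivative f (at x) v = frechet_derivative g (at x) v" if "x \<in> S" for x
      using frechet_derivative_transform_within_open[of f x S g] Suc.prems that by simp
  qed (use Suc.prems in auto)
  ultimately show ?case by simp
qed

lemma Ck_on_SucD: "Ck_on (Suc k) S f \<Longrightarrow> Ck_on k S f"
proof (induction k arbitrary: f)
  case 0
  then show ?case
    by (auto intro!: continuous_at_imp_continuous_on differentiable_imp_continuous_within)
next
  case (Suc k)
  then show ?case by (metis Ck_on.simps(2))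
qed

lemma Ck_on_subset: "Ck_on k S f \<Longrightarrow> T \<subseteq> S \<Longrightarrow> Ck_on k T f"
  by (induction k arbitrary: f) (auto intro: continuous_on_subset)

text \<open>Differentiability is demanded with respect to the full filter \<open>at x\<close> and
  not relative to the set, so the conditions can be verified on a neighbourhood of each point
  separately.\<close>

lemma Ck_on_local:
  assumes "\<And>x. x \<in> S \<Longrightarrow> \<exists>T. open T \<and> x \<in> T \<and> Ck_on k T f"
  shows "Ck_on k S f"
  using assms
proof (induction k arbitrary: f)
  case 0
  then show ?case
    by (metis Ck_on.simps(1) continuous_at_imp_continuous_on continuous_on_eq_continuous_at)
next
  case (Suc k)
  show ?case
    unfolding Ck_on.simps
  proof (intro conjI ballI allI)
    show "f differentiable (at x)" if "x \<in> S" for x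
      using Suc.prems[OF that] by auto
    show "Ck_on k S (\<lambda>x. frechet_derivative f (at x) v)" for v
      by (rule Suc.IH) (use Suc.prems in \<open>auto, metis\<close>)
  qed
qed

lemma Ck_on_const: "Ck_on k S (\<lambda>x. c)"
proof (induction k arbitrary: c)
  case (Suc k)
  have "frechet_derivative (\<lambda>x. c) (at x) = (\<lambda>v. 0)" for x
    by (rule frechet_derivative_at[symmetric]) (rule has_derivative_const)
  then show ?case using Suc by simp
qed simp

text \<open>Replaces \<open>frechet_derivative\<close>, which is defined by choice, by an explicit
  derivative, so that sum, product and chain rule can be taken over from the rules for
  \<open>has_derivative\<close>.\<close>

lemma Ck_on_SucI:
  assumes "open S" "\<And>x. x \<in> S \<Longrightarrow> (f has_derivative f' x) (at x)"
    and "\<And>v. Ck_on k S (\<lambda>x. f' x v)"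
  shows "Ck_on (Suc k) S f"
  unfolding Ck_on.simps
proof (intro conjI ballI allI)
  show "f differentiable (at x)" if "x \<in> S" for x
    using assms(2)[OF that] by (rule differentiableI)
  show "Ck_on k S (\<lambda>x. frechet_derivative f (at x) v)" for v
    by (rule Ck_on_cong[OF assms(1) _ assms(3)[of v]])
      (simp add: frechet_derivative_at[OF assms(2), symmetric])
qed

lemma Ck_on_has_derivative:
  assumes "Ck_on (Suc k) S f" "x \<in> S"
  shows "(f has_derivative frechet_derivative f (at x)) (at x)"
  using assms frechet_derivative_works by auto

lemma Ck_on_add:
  assumes "open S" "Ck_on k S f" "Ck_on k S g"
  shows "Ck_on k S (\<lambda>x. f x + g x)"
  using assms(2,3)
proof (induction k arbitrary: f g)
  case 0
  then show ?case by (simp add: continuous_on_add)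
next
  case (Suc k)
  show ?case
    by (rule Ck_on_SucI[OF assms(1) has_derivative_add[OF Ck_on_has_derivative[OF Suc.prems(1)]
            Ck_on_has_derivative[OF Suc.prems(2)]]])
      (use Suc in auto)
qed

lemma Ck_on_sum:
  assumes "open S" "\<And>i. i \<in> I \<Longrightarrow> Ck_on k S (f i)"
  shows "Ck_on k S (\<lambda>x. \<Sum>i\<in>I. f i x)"
  using assms(2)
  by (induction I rule: infinite_finite_induct) (auto intro: Ck_on_const Ck_on_add[OF assms(1)])

lemma Ck_on_mult:
  fixes f g :: "_ \<Rightarrow> 'a::real_normed_algebra"
  assumes "open S" "Ck_on k S f" "Ck_on k S g"
  shows "Ck_on k S (\<lambda>x. f x * g x)"
  using assms(2,3)
proof (induction k arbitrary: f g)
  case 0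
  then show ?case by (simp add: continuous_on_mult)
next
  case (Suc k)
  show ?case
    by (rule Ck_on_SucI[OF assms(1) has_derivative_mult[OF Ck_on_has_derivative[OF Suc.prems(1)]
            Ck_on_has_derivative[OF Suc.prems(2)]]])
      (use Suc.prems Suc.prems[THEN Ck_on_SucD] in
        \<open>auto intro!: Ck_on_add[OF assms(1)] Suc.IH\<close>)
qed

lemma Ck_on_inverse:
  fixes f :: "_ \<Rightarrow> 'a::real_normed_field"
  assumes "open S" "Ck_on k S f" "\<And>x. x \<in> S \<Longrightarrow> f x \<noteq> 0"
  shows "Ck_on k S (\<lambda>x. inverse (f x))"
  using assms(2)
proof (induction k)
  case 0
  then show ?case using assms(3) by (simp add: continuous_on_inverse)
next
  case (Suc k)
  have "Ck_on k S (\<lambda>x. (-1) * (inverse (f x) * frechet_derivative f (at x) v * inverse (f x)))" for v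
    using Suc.prems Suc.IH[OF Ck_on_SucD[OF Suc.prems]]
    by (intro Ck_on_mult[OF assms(1)] Ck_on_const) auto
  then have "Ck_on k S (\<lambda>x. - (inverse (f x) * frechet_derivative f (at x) v * inverse (f x)))" for v
    by simp
  then show ?case
    by (intro Ck_on_SucI[OF assms(1) Deriv.has_derivative_inverse[OF assms(3)
            Ck_on_has_derivative[OF Suc.prems]]]) auto
qed

lemma Ck_on_bounded_linear:
  assumes "bounded_linear L" "open S" "Ck_on k S f"
  shows "Ck_on k S (\<lambda>x. L (f x))"
  using assms(3)
proof (induction k arbitrary: f)
  case 0
  then show ?case using bounded_linear.continuous_on[OF assms(1)] by simp
next
  case (Suc k)
  show ?case
    by (rule Ck_on_SucI[OF assms(2) bounded_linear.has_derivative[OF assms(1)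
            Ck_on_has_derivative[OF Suc.prems]]])
      (use Suc in auto)
qed

text \<open>A type of class \<open>real_inner\<close> carries no distinguished basis, so an
  orthogonal spanning set is normalised. The vector 0 is discarded first because
  \<open>sgn 0\<close> is not a unit vector; in dimension 0 the set \<open>E\<close> is
  empty.\<close>

lemma orthonormal_basis_exists:
  assumes "finite S" "span S = (UNIV :: 'a::real_inner set)"
  obtains E where "finite E" "\<And>x::'a. (\<Sum>e\<in>E. (x \<bullet> e) *\<^sub>R e) = x"
proof -
  obtain C where C: "finite C" "span C = span S" "pairwise orthogonal C"
    using basis_orthogonal[OF assms(1)] by blast
  define E where "E = sgn ` (C - {0})"
  have orth: "pairwise orthogonal E"
    using C(3) unfolding E_def pairwise_def orthogonal_def sgn_div_norm by auto
  have norm: "norm e = 1" if "e \<in> E" for e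
    using that by (auto simp: E_def norm_sgn split: if_splits)
  have span: "span E = UNIV"
  proof -
    have "C \<subseteq> span E"
    proof
      fix c assume "c \<in> C"
      show "c \<in> span E"
      proof (cases "c = 0")
        case False
        then have "sgn c \<in> E" using \<open>c \<in> C\<close> by (auto simp: E_def)
        then have "norm c *\<^sub>R sgn c \<in> span E"
          by (intro span_mul span_base)
        then show ?thesis using False by (simp add: sgn_div_norm)
      qed (simp add: span_zero)
    qed
    then have "span C \<subseteq> span E" by (simp add: span_minimal)
    then show ?thesis using C(2) assms(2) by auto
  qed
  have fin: "finite E" using C(1) by (simp add: E_def)
  have "(\<Sum>e\<in>E. (x \<bullet> e) *\<^sub>R e) = x" for x
    by (rule orthonormal_basis_expand[OF orth norm _ fin]) (simp_all add: span)
  then show thesis by (rule that[OF fin])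
qed

text \<open>\<open>Ck_on\<close> controls derivatives in fixed directions only, whereas the chain
  rule evaluates the derivative of \<open>G\<close> in a direction that moves with the point.
  Expanding this direction in the orthonormal basis leaves a sum of products to which the induction
  hypothesis applies.\<close>

lemma Ck_on_compose:
  fixes G :: "'f::real_inner \<Rightarrow> real" and P :: "'e::real_normed_vector \<Rightarrow> 'f"
  assumes fin: "finite E" and exp: "\<And>x::'f. (\<Sum>e\<in>E. (x \<bullet> e) *\<^sub>R e) = x"
    and "open S" "open T" "P ` S \<subseteq> T" "Ck_on k S P" "Ck_on k T G"
  shows "Ck_on k S (G \<circ> P)"
  using assms(6,7)
proof (induction k arbitrary: G)
  case 0
  then show ?case
    using assms(5) by (metis Ck_on.simps(1) continuous_on_compose continuous_on_subset)
next
  case (Suc k)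
  let ?G' = "\<lambda>y. frechet_derivative G (at y)" and ?P' = "\<lambda>x. frechet_derivative P (at x)"
  have expand: "?G' (P x) (?P' x v) = (\<Sum>e\<in>E. (?P' x v \<bullet> e) * ((\<lambda>y. ?G' y e) \<circ> P) x)"
    if "x \<in> S" for x v
  proof -
    have "linear (?G' (P x))"
      using Ck_on_has_derivative[OF Suc.prems(2), of "P x"] that assms(5)
      by (auto dest: has_derivative_linear)
    then have "?G' (P x) (\<Sum>e\<in>E. (?P' x v \<bullet> e) *\<^sub>R e) = (\<Sum>e\<in>E. (?P' x v \<bullet> e) * ?G' (P x) e)"
      by (simp add: linear_sum linear_scale)
    then show ?thesis unfolding exp by simp
  qed
  show ?case
  proof (rule Ck_on_SucI[OF assms(3)])
    show "((G \<circ> P) has_derivative ?G' (P x) \<circ> ?P' x) (at x)" if "x \<in> S" for x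
      using that assms(5)
      by (intro diff_chain_at Ck_on_has_derivative[OF Suc.prems(1)]
          Ck_on_has_derivative[OF Suc.prems(2)]) auto
    have "Ck_on k S (\<lambda>x. \<Sum>e\<in>E. (?P' x v \<bullet> e) * ((\<lambda>y. ?G' y e) \<circ> P) x)" for v
      using Suc.prems Ck_on_SucD[OF Suc.prems(1)]
      by (intro Ck_on_sum Ck_on_mult assms(3) Suc.IH
          Ck_on_bounded_linear[OF bounded_linear_inner_left]) auto
    then show "Ck_on k S (\<lambda>x. (?G' (P x) \<circ> ?P' x) v)" for v
      by (rule Ck_on_cong[OF assms(3), rotated]) (simp add: expand)
  qed
qed

subsection \<open>Smooth functions, tangent vectors and vector fields\<close>

locale smooth_mfd =
  fixes A :: "('m::{t2_space, second_countable_topology}, 'e::real_inner) atlas"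
  assumes atlas: "smooth_atlas A"
begin

abbreviation sm :: "'m \<Rightarrow> ('m \<Rightarrow> real) \<Rightarrow> bool" where
  "sm \<equiv> smooth_fun_at A"

section \<open>Charts, and smoothness as a property of germs\<close>

lemma chart_homeomorphism: "(U, \<phi>) \<in> A \<Longrightarrow> \<exists>\<psi>. homeomorphism U (\<phi> ` U) \<phi> \<psi>"
  and chart_dom_open: "(U, \<phi>) \<in> A \<Longrightarrow> open U"
  and chart_ran_open: "(U, \<phi>) \<in> A \<Longrightarrow> open (\<phi> ` U)"
  using atlas unfolding smooth_atlas_def by blast+

lemma chart_exists: obtains U \<phi> where "(U, \<phi>) \<in> A" "x \<in> U"
proof -
  have "x \<in> (\<Union>(U, \<phi>)\<in>A. U)" using atlas unfolding smooth_atlas_def by simp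
  then show thesis using that by auto
qed

text \<open>A chart is an open map onto its image, and that image is itself open in the model
  space.\<close>

lemma chart_image_open:
  assumes "(U, \<phi>) \<in> A" "open W"
  shows "open (\<phi> ` (U \<inter> W))"
proof -
  obtain \<psi> where "homeomorphism U (\<phi> ` U) \<phi> \<psi>" using chart_homeomorphism[OF assms(1)] by blast
  moreover have "openin (top_of_set U) (U \<inter> W)" using assms(2) by (simp add: openin_open_Int)
  ultimately have "openin (top_of_set (\<phi> ` U)) (\<phi> ` (U \<inter> W))"
    by (rule homeomorphism_imp_open_map)
  then show ?thesis using chart_ran_open[OF assms(1)] openin_open_trans by blast
qed

lemma chart_inv:
  assumes "(U, \<phi>) \<in> A" "y \<in> U"
  shows "inv_into U \<phi> (\<phi> y) = y"
proof -
  have "inj_on \<phi> U" using chart_homeomorphism[OF assms(1)] unfolding homeomorphism_def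
    by (metis inj_on_inverseI)
  then show ?thesis using assms(2) by simp
qed

lemma chart_continuous: "(U, \<phi>) \<in> A \<Longrightarrow> continuous_on U \<phi>"
  using chart_homeomorphism homeomorphism_cont1 by blast

lemma smooth_fun_onD:
  "smooth_fun_on A W f \<Longrightarrow> (U, \<phi>) \<in> A \<Longrightarrow> Ck_on k (\<phi> ` (U \<inter> W)) (\<lambda>y. f (inv_into U \<phi> y))"
  unfolding smooth_fun_on_def Cinf_on_def o_def by blast

lemma smooth_fun_onI:
  assumes "\<And>U \<phi> k. (U, \<phi>) \<in> A \<Longrightarrow> Ck_on k (\<phi> ` (U \<inter> W)) (\<lambda>y. f (inv_into U \<phi> y))"
  shows "smooth_fun_on A W f"
  unfolding smooth_fun_on_def Cinf_on_def o_def using assms by blast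

lemma smooth_fun_on_subset:
  assumes "smooth_fun_on A W f" "W' \<subseteq> W"
  shows "smooth_fun_on A W' f"
proof (rule smooth_fun_onI)
  fix U \<phi> k assume "(U, \<phi>) \<in> A"
  then show "Ck_on k (\<phi> ` (U \<inter> W')) (\<lambda>y. f (inv_into U \<phi> y))"
    by (rule Ck_on_subset[OF smooth_fun_onD[OF assms(1)]]) (use assms(2) in auto)
qed

lemma smooth_fun_on_cong:
  assumes "open W" "\<And>y. y \<in> W \<Longrightarrow> f y = g y" "smooth_fun_on A W f"
  shows "smooth_fun_on A W g"
proof (rule smooth_fun_onI)
  fix U \<phi> k assume ch: "(U, \<phi>) \<in> A"
  show "Ck_on k (\<phi> ` (U \<inter> W)) (\<lambda>y. g (inv_into U \<phi> y))"
    by (rule Ck_on_cong[OF chart_image_open[OF ch assms(1)] _ smooth_fun_onD[OF assms(3) ch]])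
      (auto simp: chart_inv[OF ch] assms(2))
qed

text \<open>Locality of \<open>Ck_on\<close> reduces smoothness on an open set to smoothness at its
  points, which allows later arguments to work with germs only.\<close>

lemma smooth_fun_on_iff:
  assumes "open W"
  shows "smooth_fun_on A W f \<longleftrightarrow> (\<forall>x\<in>W. sm x f)"
proof
  assume "\<forall>x\<in>W. sm x f"
  then have "\<forall>x\<in>W. \<exists>W'. open W' \<and> x \<in> W' \<and> smooth_fun_on A W' f"
    by (auto simp: smooth_fun_at_def)
  then obtain N where N: "\<And>x. x \<in> W \<Longrightarrow> open (N x) \<and> x \<in> N x \<and> smooth_fun_on A (N x) f"
    by metis
  show "smooth_fun_on A W f"
  proof (rule smooth_fun_onI, rule Ck_on_local)
    fix U \<phi> k y assume ch: "(U, \<phi>) \<in> A" and "y \<in> \<phi> ` (U \<inter> W)"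
    then obtain x where x: "x \<in> U" "x \<in> W" "y = \<phi> x" by auto
    have "Ck_on k (\<phi> ` (U \<inter> N x)) (\<lambda>y. f (inv_into U \<phi> y))"
      using N[OF x(2)] ch by (intro smooth_fun_onD) auto
    moreover have "open (\<phi> ` (U \<inter> N x))"
      using N[OF x(2)] ch by (intro chart_image_open) auto
    moreover have "y \<in> \<phi> ` (U \<inter> N x)" using N[OF x(2)] x by auto
    ultimately show "\<exists>T. open T \<and> y \<in> T \<and> Ck_on k T (\<lambda>y. f (inv_into U \<phi> y))" by blast
  qed
qed (use assms in \<open>auto simp: smooth_fun_at_def\<close>)

lemma smooth_funs_iff: "f \<in> smooth_funs A \<longleftrightarrow> (\<forall>x. sm x f)"
  by (simp add: smooth_funs_def smooth_fun_on_iff)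

lemma smooth_funsD: "f \<in> smooth_funs A \<Longrightarrow> sm x f"
  by (simp add: smooth_funs_iff)

lemma sm_open: "sm x f \<Longrightarrow> \<exists>W. open W \<and> x \<in> W \<and> (\<forall>y\<in>W. sm y f)"
  by (auto simp: smooth_fun_at_def)

lemma sm_eventually: "sm x f \<Longrightarrow> \<forall>\<^sub>F y in nhds x. sm y f"
  using sm_open eventually_nhds by blast

lemma sm_cong:
  assumes "\<forall>\<^sub>F y in nhds x. f y = g y" "sm x f"
  shows "sm x g"
proof -
  obtain W where W: "open W" "x \<in> W" "\<And>y. y \<in> W \<Longrightarrow> f y = g y"
    using assms(1) unfolding eventually_nhds by blast
  obtain W' where W': "open W'" "x \<in> W'" "smooth_fun_on A W' f"
    using assms(2) by (auto simp: smooth_fun_at_def)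
  have "smooth_fun_on A (W \<inter> W') f" using W'(3) by (rule smooth_fun_on_subset) simp
  then have "smooth_fun_on A (W \<inter> W') g"
    using W W' by (intro smooth_fun_on_cong[of "W \<inter> W'" f g]) auto
  then show ?thesis using W W' unfolding smooth_fun_at_def by blast
qed

text \<open>The two germs come with different domains; both are restricted to the intersection
  before the operation is carried out in a chart.\<close>

lemma sm_binary:
  assumes H: "\<And>k S (a::'e \<Rightarrow> real) b. open S \<Longrightarrow> Ck_on k S a \<Longrightarrow> Ck_on k S b \<Longrightarrow>
      Ck_on k S (\<lambda>y. H (a y) (b y))"
    and "sm x f" "sm x g"
  shows "sm x (\<lambda>y. H (f y) (g y))"
proof -
  obtain W W' where W: "open W" "x \<in> W" "smooth_fun_on A W f"
      "open W'" "x \<in> W'" "smooth_fun_on A W' g"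
    using assms(2,3) by (auto simp: smooth_fun_at_def)
  let ?W = "W \<inter> W'"
  have "smooth_fun_on A ?W f" "smooth_fun_on A ?W g"
    using W by (auto intro: smooth_fun_on_subset)
  then have "smooth_fun_on A ?W (\<lambda>y. H (f y) (g y))"
    using W(1,4) by (intro smooth_fun_onI H chart_image_open) (auto intro: smooth_fun_onD)
  then show ?thesis using W unfolding smooth_fun_at_def by blast
qed

lemma sm_add: "sm x f \<Longrightarrow> sm x g \<Longrightarrow> sm x (\<lambda>y. f y + g y)"
  by (rule sm_binary[where H = "(+)"]) (rule Ck_on_add)

lemma sm_mult: "sm x f \<Longrightarrow> sm x g \<Longrightarrow> sm x (\<lambda>y. f y * g y)"
  by (rule sm_binary[where H = "(*)"]) (rule Ck_on_mult)

lemma sm_const: "sm x (\<lambda>y. c)"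
  unfolding smooth_fun_at_def by (intro exI[of _ UNIV]) (auto intro: smooth_fun_onI Ck_on_const)

lemma sm_cmult: "sm x f \<Longrightarrow> sm x (\<lambda>y. c * f y)"
  by (rule sm_mult[OF sm_const])

lemma sm_uminus: "sm x f \<Longrightarrow> sm x (\<lambda>y. - f y)"
  using sm_cmult[of x f "-1"] by simp

lemma sm_diff: "sm x f \<Longrightarrow> sm x g \<Longrightarrow> sm x (\<lambda>y. f y - g y)"
  using sm_add[OF _ sm_uminus, of x f g] by simp

lemma sm_sum: "(\<And>i. i \<in> I \<Longrightarrow> sm x (f i)) \<Longrightarrow> sm x (\<lambda>y. \<Sum>i\<in>I. f i y)"
  by (induction I rule: infinite_finite_induct) (auto intro: sm_const sm_add)

lemma sm_continuous:
  assumes "sm x f"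
  shows "isCont f x"
proof -
  obtain W where W: "open W" "x \<in> W" "smooth_fun_on A W f"
    using assms by (auto simp: smooth_fun_at_def)
  obtain U \<phi> where ch: "(U, \<phi>) \<in> A" "x \<in> U" by (rule chart_exists)
  have "continuous_on (\<phi> ` (U \<inter> W)) (\<lambda>y. f (inv_into U \<phi> y))"
    using smooth_fun_onD[OF W(3) ch(1), of 0] by simp
  with continuous_on_subset[OF chart_continuous[OF ch(1)], of "U \<inter> W"]
  have "continuous_on (U \<inter> W) ((\<lambda>y. f (inv_into U \<phi> y)) \<circ> \<phi>)"
    by (intro continuous_on_compose) auto
  then have "continuous_on (U \<inter> W) f"
    by (rule continuous_on_eq) (simp add: chart_inv[OF ch(1)])
  then show ?thesis
    using W ch chart_dom_open[OF ch(1)] continuous_on_eq_continuous_at[of "U \<inter> W" f] by auto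
qed

lemma sm_eventually_nonzero:
  assumes "sm x f" "f x \<noteq> 0"
  shows "\<forall>\<^sub>F y in nhds x. f y \<noteq> 0"
  using sm_continuous[OF assms(1)] assms(2)
  unfolding continuous_within tendsto_at_iff_tendsto_nhds by (rule tendsto_imp_eventually_ne)

lemma sm_inverse:
  assumes "sm x f" "f x \<noteq> 0"
  shows "sm x (\<lambda>y. inverse (f y))"
proof -
  obtain W where W: "open W" "x \<in> W" "smooth_fun_on A W f" "\<And>y. y \<in> W \<Longrightarrow> f y \<noteq> 0"
  proof -
    obtain W where W: "open W" "x \<in> W" "smooth_fun_on A W f"
      using assms by (auto simp: smooth_fun_at_def)
    obtain W' where W': "open W'" "x \<in> W'" "\<And>y. y \<in> W' \<Longrightarrow> f y \<noteq> 0"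
      using sm_eventually_nonzero[OF assms] unfolding eventually_nhds by blast
    show thesis
      using that[of "W \<inter> W'"] W W' by (auto intro: smooth_fun_on_subset)
  qed
  have "smooth_fun_on A W (\<lambda>y. inverse (f y))"
  proof (rule smooth_fun_onI)
    fix U \<phi> k assume ch: "(U, \<phi>) \<in> A"
    show "Ck_on k (\<phi> ` (U \<inter> W)) (\<lambda>y. inverse (f (inv_into U \<phi> y)))"
      by (rule Ck_on_inverse[OF chart_image_open[OF ch W(1)] smooth_fun_onD[OF W(3) ch]])
        (use W(4) chart_inv[OF ch] in auto)
  qed
  then show ?thesis using W unfolding smooth_fun_at_def by blast
qed

section \<open>Tangent vectors as derivations of germs\<close>

context
  fixes u x
  assumes u: "u \<in> tangent_space A x"
begin

lemma tv_nonsmooth: "\<not> sm x f \<Longrightarrow> u f = 0"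
  using u[unfolded tangent_space_def, THEN CollectD, THEN conjunct1] by simp

lemma tv_cong:
  assumes "sm x f" "\<forall>\<^sub>F y in nhds x. f y = g y"
  shows "u g = u f"
  using u[unfolded tangent_space_def, THEN CollectD, THEN conjunct2, THEN conjunct1, rule_format,
      OF assms(1) sm_cong[OF assms(2,1)] assms(2)] by (rule sym)

lemmas tv_algebra =
  u[unfolded tangent_space_def, THEN CollectD, THEN conjunct2, THEN conjunct2]

lemma tv_add: "sm x f \<Longrightarrow> sm x g \<Longrightarrow> u (\<lambda>y. f y + g y) = u f + u g"
  and tv_mult: "sm x f \<Longrightarrow> sm x g \<Longrightarrow> u (\<lambda>y. f y * g y) = f x * u g + g x * u f"
  using tv_algebra[THEN conjunct1] by simp_all

lemma tv_cmult: "sm x f \<Longrightarrow> u (\<lambda>y. c * f y) = c * u f"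
  using tv_algebra[THEN conjunct2] by simp

end

lemma tv_zero: "u \<in> tangent_space A x \<Longrightarrow> u (\<lambda>y. 0) = 0"
  using tv_cmult[of u x "\<lambda>y. 0" 0] sm_const by simp

lemma tv_uminus: "u \<in> tangent_space A x \<Longrightarrow> sm x f \<Longrightarrow> u (\<lambda>y. - f y) = - u f"
  using tv_cmult[of u x f "-1"] by simp

lemma tv_diff:
  "u \<in> tangent_space A x \<Longrightarrow> sm x f \<Longrightarrow> sm x g \<Longrightarrow> u (\<lambda>y. f y - g y) = u f - u g"
  using tv_add[OF _ _ sm_uminus, of u x f g] tv_uminus[of u x g] by simp

lemma tv_sum:
  assumes "u \<in> tangent_space A x" "\<And>i. i \<in> I \<Longrightarrow> sm x (f i)"
  shows "u (\<lambda>y. \<Sum>i\<in>I. f i y) = (\<Sum>i\<in>I. u (f i))"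
  using assms(2)
proof (induction I rule: infinite_finite_induct)
  case (insert i I)
  then have "u (\<lambda>y. f i y + (\<Sum>j\<in>I. f j y)) = u (f i) + u (\<lambda>y. \<Sum>j\<in>I. f j y)"
    by (intro tv_add[OF assms(1)] sm_sum) auto
  then show ?case using insert by simp
qed (auto simp: tv_zero[OF assms(1)])

lemma tangentI:
  assumes "\<And>f. \<not> sm x f \<Longrightarrow> u f = 0"
    and "\<And>f g. sm x f \<Longrightarrow> sm x g \<Longrightarrow> \<forall>\<^sub>F y in nhds x. f y = g y \<Longrightarrow> u f = u g"
    and "\<And>f g. sm x f \<Longrightarrow> sm x g \<Longrightarrow> u (\<lambda>y. f y + g y) = u f + u g"
    and "\<And>f g. sm x f \<Longrightarrow> sm x g \<Longrightarrow> u (\<lambda>y. f y * g y) = f x * u g + g x * u f"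
    and "\<And>f c. sm x f \<Longrightarrow> u (\<lambda>y. c * f y) = c * u f"
  shows "u \<in> tangent_space A x"
  unfolding tangent_space_def by (intro CollectI conjI allI impI assms)

lemma tangent_zero: "0 \<in> tangent_space A x"
  by (rule tangentI) simp_all

lemma tangent_add:
  assumes "u \<in> tangent_space A x" "v \<in> tangent_space A x"
  shows "u + v \<in> tangent_space A x"
proof (rule tangentI)
  fix f g assume "sm x f" "sm x g" "\<forall>\<^sub>F y in nhds x. f y = g y"
  then have "u g = u f" "v g = v f" using tv_cong assms by blast+
  then show "(u + v) f = (u + v) g" by simp
qed (simp_all add: tv_nonsmooth[OF assms(1)] tv_nonsmooth[OF assms(2)] tv_add[OF assms(1)]
      tv_add[OF assms(2)] tv_mult[OF assms(1)] tv_mult[OF assms(2)] tv_cmult[OF assms(1)]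
      tv_cmult[OF assms(2)] algebra_simps)

lemma tangent_scale:
  assumes "u \<in> tangent_space A x"
  shows "(\<lambda>f. c * u f) \<in> tangent_space A x"
proof (rule tangentI)
  fix f g assume "sm x f" "sm x g" "\<forall>\<^sub>F y in nhds x. f y = g y"
  then have "u g = u f" using tv_cong assms by blast
  then show "c * u f = c * u g" by simp
qed (simp_all add: tv_nonsmooth[OF assms] tv_add[OF assms] tv_mult[OF assms] tv_cmult[OF assms]
      algebra_simps)

section \<open>Vector fields and their brackets\<close>

lemma vfieldsI:
  assumes "\<And>x. X x \<in> tangent_space A x" "\<And>x f. sm x f \<Longrightarrow> sm x (\<lambda>y. X y f)"
  shows "X \<in> vfields A"
  unfolding vfields_def smooth_vfield_on_def using assms by (auto simp: smooth_fun_on_iff)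

lemma vfield_on_sm:
  assumes "smooth_vfield_on A W X" "open W" "x \<in> W" "sm x f"
  shows "sm x (\<lambda>y. X y f)"
proof -
  obtain W' where W': "open W'" "x \<in> W'" "\<forall>y\<in>W'. sm y f" using sm_open[OF assms(4)] by blast
  then have "smooth_fun_on A (W \<inter> W') f" using assms(2) by (subst smooth_fun_on_iff) auto
  then have "smooth_fun_on A (W \<inter> W') (\<lambda>y. X y f)"
    using assms(1,2) W'(1) unfolding smooth_vfield_on_def by auto
  then show ?thesis using assms W' smooth_fun_on_iff[of "W \<inter> W'"] by auto
qed

lemma vf_tangent: "X \<in> vfields A \<Longrightarrow> X x \<in> tangent_space A x"
  by (simp add: vfields_def smooth_vfield_on_def)

lemma vf_sm: "X \<in> vfields A \<Longrightarrow> sm x f \<Longrightarrow> sm x (\<lambda>y. X y f)"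
  unfolding vfields_def using vfield_on_sm[of UNIV X x f] by simp

lemma vf_smooth: "X \<in> vfields A \<Longrightarrow> f \<in> smooth_funs A \<Longrightarrow> (\<lambda>y. X y f) \<in> smooth_funs A"
  by (simp add: smooth_funs_iff vf_sm)

lemma vfields_zero: "0 \<in> vfields A"
  by (rule vfieldsI) (simp_all add: tangent_zero sm_const)

lemma vfields_add:
  assumes "X \<in> vfields A" "Y \<in> vfields A"
  shows "X + Y \<in> vfields A"
  by (rule vfieldsI)
    (simp_all add: tangent_add vf_tangent[OF assms(1)] vf_tangent[OF assms(2)] sm_add
      vf_sm[OF assms(1)] vf_sm[OF assms(2)])

lemma vfields_smult:
  assumes "g \<in> smooth_funs A" "X \<in> vfields A"
  shows "vf_smult g X \<in> vfields A"
  unfolding vf_smult_def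
  by (rule vfieldsI)
    (simp_all add: tangent_scale vf_tangent[OF assms(2)] sm_mult vf_sm[OF assms(2)]
      smooth_funsD[OF assms(1)])

lemma const_smooth: "(\<lambda>x. c) \<in> smooth_funs A"
  by (simp add: smooth_funs_iff sm_const)

lemma vfields_uminus: "X \<in> vfields A \<Longrightarrow> - X \<in> vfields A"
  using vfields_smult[OF const_smooth[of "-1"], of X] by (simp add: vf_smult_def fun_Compl_def)

lemma vfields_diff: "X \<in> vfields A \<Longrightarrow> Y \<in> vfields A \<Longrightarrow> X - Y \<in> vfields A"
  using vfields_add[OF _ vfields_uminus, of X Y] by simp

text \<open>The conditional in \<open>bracket\<close> is decided at each point separately. As
  smoothness spreads to a neighbourhood, the conditional disappears from the germ at
  \<open>x\<close>, and the bracket may be differentiated as a plain commutator.\<close>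

lemma bracket_sm:
  assumes "X \<in> vfields A" "Y \<in> vfields A" "sm x f"
  shows "\<forall>\<^sub>F y in nhds x. X y (\<lambda>z. Y z f) - Y y (\<lambda>z. X z f) = bracket A X Y y f"
  using sm_eventually[OF assms(3)] by eventually_elim (simp add: bracket_def)

lemma vfields_bracket:
  assumes X: "X \<in> vfields A" and Y: "Y \<in> vfields A"
  shows "bracket A X Y \<in> vfields A"
proof (rule vfieldsI)
  note T = vf_tangent[OF X] vf_tangent[OF Y]
  note S = vf_sm[OF X] vf_sm[OF Y]
  show "sm x (\<lambda>y. bracket A X Y y f)" if "sm x f" for x f
    by (rule sm_cong[OF bracket_sm[OF X Y that] sm_diff[OF S(1)[OF S(2)] S(2)[OF S(1)]]]) fact+
  show "bracket A X Y x \<in> tangent_space A x" for x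
  proof (rule tangentI)
    fix f assume "\<not> sm x f" then show "bracket A X Y x f = 0" by (simp add: bracket_def)
  next
    fix f g assume f: "sm x f" and g: "sm x g" and ev: "\<forall>\<^sub>F y in nhds x. f y = g y"
    \<comment> \<open>Agreement of \<open>f\<close> and \<open>g\<close> near \<open>x\<close> is
      agreement near every point close to \<open>x\<close>. Hence their derivatives along a field
      agree as germs at \<open>x\<close>, which the second derivation requires.\<close>
    have germ: "\<forall>\<^sub>F y in nhds x. Z y f = Z y g" if "Z \<in> vfields A" for Z
    proof -
      have "\<forall>\<^sub>F y in nhds x. \<forall>\<^sub>F z in nhds y. f z = g z" using ev by (simp add: eventually_eventually)
      then show ?thesis using sm_eventually[OF f]
      proof eventually_elim
        case (elim y)
        then show ?case using tv_cong[OF vf_tangent[OF that], of y f g] by simp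
      qed
    qed
    have "X x (\<lambda>y. Y y g) = X x (\<lambda>y. Y y f)" "Y x (\<lambda>y. X y g) = Y x (\<lambda>y. X y f)"
      using tv_cong[OF T(1) S(2)[OF f] germ[OF Y]] tv_cong[OF T(2) S(1)[OF f] germ[OF X]] by auto
    then show "bracket A X Y x f = bracket A X Y x g" using f g by (simp add: bracket_def)
  next
    fix f g assume f: "sm x f" and g: "sm x g"
    have ev: "\<forall>\<^sub>F y in nhds x. sm y f \<and> sm y g"
      using sm_eventually[OF f] sm_eventually[OF g] by eventually_elim simp
    have "\<forall>\<^sub>F y in nhds x. Z y f + Z y g = Z y (\<lambda>z. f z + g z)" if "Z \<in> vfields A" for Z
      using ev by eventually_elim (simp add: tv_add[OF vf_tangent[OF that]])
    then have *: "W x (\<lambda>y. Z y (\<lambda>z. f z + g z)) = W x (\<lambda>y. Z y f) + W x (\<lambda>y. Z y g)"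
      if "Z \<in> vfields A" "W \<in> vfields A" for Z W
      using tv_cong[OF vf_tangent[OF that(2)], of x "\<lambda>y. Z y f + Z y g"] that f g
      by (simp add: sm_add vf_sm tv_add[OF vf_tangent[OF that(2)]])
    show "bracket A X Y x (\<lambda>y. f y + g y) = bracket A X Y x f + bracket A X Y x g"
      using *[OF X Y] *[OF Y X] f g by (simp add: bracket_def sm_add)
    have "\<forall>\<^sub>F y in nhds x. f y * Z y g + g y * Z y f = Z y (\<lambda>z. f z * g z)" if "Z \<in> vfields A" for Z
      using ev by eventually_elim (simp add: tv_mult[OF vf_tangent[OF that]])
    \<comment> \<open>The two cross terms are exchanged when \<open>Z\<close> and \<open>W\<close>
      are, so they cancel in the commutator.\<close>
    then have *: "W x (\<lambda>y. Z y (\<lambda>z. f z * g z)) = f x * W x (\<lambda>y. Z y g) + Z x g * W x f +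
        g x * W x (\<lambda>y. Z y f) + Z x f * W x g"
      if "Z \<in> vfields A" "W \<in> vfields A" for Z W
      using tv_cong[OF vf_tangent[OF that(2)], of x "\<lambda>y. f y * Z y g + g y * Z y f"] that f g
      by (simp add: sm_add sm_mult vf_sm tv_add[OF vf_tangent[OF that(2)]]
          tv_mult[OF vf_tangent[OF that(2)]])
    show "bracket A X Y x (\<lambda>y. f y * g y) = f x * bracket A X Y x g + g x * bracket A X Y x f"
      using *[OF X Y] *[OF Y X] f g by (simp add: bracket_def sm_mult algebra_simps)
  next
    fix f c assume f: "sm x f"
    have "\<forall>\<^sub>F y in nhds x. c * Z y f = Z y (\<lambda>z. c * f z)" if "Z \<in> vfields A" for Z
      using sm_eventually[OF f] by eventually_elim (simp add: tv_cmult[OF vf_tangent[OF that]])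
    then have *: "W x (\<lambda>y. Z y (\<lambda>z. c * f z)) = c * W x (\<lambda>y. Z y f)"
      if "Z \<in> vfields A" "W \<in> vfields A" for Z W
      using tv_cong[OF vf_tangent[OF that(2)], of x "\<lambda>y. c * Z y f"] that f
      by (simp add: sm_cmult vf_sm tv_cmult[OF vf_tangent[OF that(2)]])
    show "bracket A X Y x (\<lambda>y. c * f y) = c * bracket A X Y x f"
      using *[OF X Y] *[OF Y X] f by (simp add: bracket_def sm_cmult algebra_simps)
  qed
qed

lemma bracket_antisym: "bracket A Y X = - bracket A X Y"
  by (auto simp: bracket_def fun_eq_iff)

lemma bracket_zero: "X \<in> vfields A \<Longrightarrow> bracket A X 0 = 0"
  by (simp add: bracket_def fun_eq_iff tv_zero[OF vf_tangent[of X]])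

context
  fixes X Y Z
  assumes X: "X \<in> vfields A" and Y: "Y \<in> vfields A" and Z: "Z \<in> vfields A"
begin

lemma bracket_add_right: "bracket A X (Y + Z) = bracket A X Y + bracket A X Z"
  by (simp add: bracket_def fun_eq_iff tv_add[OF vf_tangent[OF X]] vf_sm[OF Y] vf_sm[OF Z])

lemma bracket_add_left: "bracket A (X + Y) Z = bracket A X Z + bracket A Y Z"
  by (simp add: bracket_def fun_eq_iff tv_add[OF vf_tangent[OF Z]] vf_sm[OF X] vf_sm[OF Y])

lemma bracket_diff_right: "bracket A X (Y - Z) = bracket A X Y - bracket A X Z"
  by (simp add: bracket_def fun_eq_iff tv_diff[OF vf_tangent[OF X]] vf_sm[OF Y] vf_sm[OF Z])

end

lemma bracket_smult_right:
  assumes X: "X \<in> vfields A" and Y: "Y \<in> vfields A" and g: "g \<in> smooth_funs A"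
  shows "bracket A X (vf_smult g Y) = vf_smult g (bracket A X Y) + vf_smult (\<lambda>x. X x g) Y"
proof (intro ext)
  fix x f
  show "bracket A X (vf_smult g Y) x f
      = (vf_smult g (bracket A X Y) + vf_smult (\<lambda>x. X x g) Y) x f"
  proof (cases "sm x f")
    case True
    then show ?thesis
      using smooth_funsD[OF g, of x] vf_sm[OF Y True]
      by (simp add: bracket_def vf_smult_def tv_mult[OF vf_tangent[OF X]] algebra_simps)
  qed (simp add: bracket_def vf_smult_def tv_nonsmooth[OF vf_tangent[OF Y]])
qed

lemma bracket_smult_left:
  assumes X: "X \<in> vfields A" and Y: "Y \<in> vfields A" and g: "g \<in> smooth_funs A"
  shows "bracket A (vf_smult g X) Y = vf_smult g (bracket A X Y) - vf_smult (\<lambda>x. Y x g) X"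
  using bracket_smult_right[OF Y X g] bracket_antisym[of "vf_smult g X" Y] bracket_antisym[of X Y]
  by (simp add: vf_smult_def fun_eq_iff)

lemma tv_bracket:
  assumes "u \<in> tangent_space A x" "X \<in> vfields A" "Y \<in> vfields A" "sm x f"
  shows "u (\<lambda>y. bracket A X Y y f) = u (\<lambda>y. X y (\<lambda>z. Y z f)) - u (\<lambda>y. Y y (\<lambda>z. X z f))"
  using tv_cong[OF assms(1) _ bracket_sm[OF assms(2-)]] assms
  by (simp add: tv_diff[OF assms(1)] sm_diff vf_sm)

text \<open>Stated as the derivation property of \<open>bracket A X\<close>, which is the form that
  Lie derivatives use. On functions that are not smooth at the point all terms are 0 by
  convention.\<close>

lemma jacobi:
  assumes "X \<in> vfields A" "Y \<in> vfields A" "Z \<in> vfields A"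
  shows "bracket A X (bracket A Y Z) = bracket A (bracket A X Y) Z + bracket A Y (bracket A X Z)"
proof (intro ext)
  fix x f
  show "bracket A X (bracket A Y Z) x f
      = (bracket A (bracket A X Y) Z + bracket A Y (bracket A X Z)) x f"
  proof (cases "sm x f")
    case True
    then have "bracket A U V x f = U x (\<lambda>y. V y f) - V x (\<lambda>y. U y f)" for U V
      by (simp add: bracket_def)
    moreover have "bracket A U V x (\<lambda>y. W y f)
        = U x (\<lambda>y. V y (\<lambda>z. W z f)) - V x (\<lambda>y. U y (\<lambda>z. W z f))" if "W \<in> vfields A" for U V W
      using vf_sm[OF that True] by (simp add: bracket_def)
    moreover note tv_bracket[OF vf_tangent[OF assms(1)] assms(2,3) True]
      tv_bracket[OF vf_tangent[OF assms(2)] assms(1,3) True]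
      tv_bracket[OF vf_tangent[OF assms(3)] assms(1,2) True]
    ultimately show ?thesis using assms by simp
  qed (simp add: bracket_def)
qed

end

subsection \<open>Smoothness of coefficients\<close>

context smooth_mfd
begin

text \<open>Gaussian elimination, one row at a time.\<close>

lemma sm_coefficients:
  fixes a :: "nat \<Rightarrow> nat \<Rightarrow> 'm \<Rightarrow> real"
  assumes "\<And>i j. i < k \<Longrightarrow> j < k \<Longrightarrow> sm x (a i j)" "\<And>j. j < k \<Longrightarrow> sm x (b j)"
    and "\<And>i j. i < k \<Longrightarrow> j < k \<Longrightarrow> a i j x = (if i = j then 1 else 0)"
    and "\<forall>\<^sub>F y in nhds x. \<forall>j<k. b j y = (\<Sum>i<k. c i y * a i j y)"
    and "i < k"
  shows "sm x (c i)"
  using assms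
proof (induction k arbitrary: a b i)
  case (Suc k)
  \<comment> \<open>\<open>r j\<close> is the multiplier that removes the unknown \<open>c k\<close>
    from equation \<open>j\<close>. The pivot is 1 at \<open>x\<close>, hence nonzero nearby, and
    the entries \<open>a i k\<close> with \<open>i < k\<close> vanish at \<open>x\<close>, so the
    reduced matrix is the identity there again.\<close>
  define r where "r j y = a k j y * inverse (a k k y)" for j y
  have a_kk: "sm x (a k k)" "a k k x \<noteq> 0" using Suc.prems(1,3) by simp_all
  have r: "sm x (r j)" if "j < k" for j
    unfolding r_def using that by (intro sm_mult Suc.prems(1) sm_inverse a_kk) simp_all
  have ev: "\<forall>\<^sub>F y in nhds x. a k k y \<noteq> 0 \<and> (\<forall>j<Suc k. b j y = (\<Sum>i<Suc k. c i y * a i j y))"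
    using sm_eventually_nonzero[OF a_kk] Suc.prems(4) by (rule eventually_conj)
  have IH: "sm x (c i)" if "i < k" for i
  proof (rule Suc.IH[where a = "\<lambda>i j y. a i j y - a i k y * r j y" and b = "\<lambda>j y. b j y - b k y * r j y",
        OF _ _ _ _ that])
    show "sm x (\<lambda>y. a i j y - a i k y * r j y)" if "i < k" "j < k" for i j
      using that by (intro sm_diff sm_mult Suc.prems(1) r) simp_all
    show "sm x (\<lambda>y. b j y - b k y * r j y)" if "j < k" for j
      using that by (intro sm_diff sm_mult Suc.prems(2) r) simp_all
    show "a i j x - a i k x * r j x = (if i = j then 1 else 0)" if "i < k" "j < k" for i j
      using that by (simp add: Suc.prems(3))
    show "\<forall>\<^sub>F y in nhds x. \<forall>j<k. b j y - b k y * r j y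
        = (\<Sum>i<k. c i y * (a i j y - a i k y * r j y))"
      using ev
    proof eventually_elim
      case (elim y)
      show ?case
      proof (intro allI impI)
        fix j assume "j < k"
        have "(\<Sum>i<k. c i y * (a i j y - a i k y * r j y))
            = (\<Sum>i<k. c i y * a i j y) - (\<Sum>i<k. c i y * a i k y) * r j y"
          by (simp add: algebra_simps sum_subtractf sum_distrib_left)
        also have "\<dots> = (b j y - c k y * a k j y) - (b k y - c k y * a k k y) * r j y"
          using elim \<open>j < k\<close> by simp
        also have "\<dots> = b j y - b k y * r j y"
          using elim by (simp add: r_def field_simps)
        finally show "b j y - b k y * r j y = (\<Sum>i<k. c i y * (a i j y - a i k y * r j y))" ..
      qed
    qed
  qed
  show ?case
  proof (cases "i = k")
    case True
    \<comment> \<open>Back substitution: the other coefficients are already smooth, and equation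
      \<open>k\<close> is solved for \<open>c k\<close>.\<close>
    have sm_k: "sm x (\<lambda>y. (b k y - (\<Sum>i<k. c i y * a i k y)) * inverse (a k k y))"
      by (intro sm_mult sm_diff sm_sum sm_inverse a_kk IH Suc.prems(1,2)) simp_all
    have cong: "\<forall>\<^sub>F y in nhds x.
        (b k y - (\<Sum>i<k. c i y * a i k y)) * inverse (a k k y) = c k y"
      using ev by eventually_elim (simp add: field_simps)
    show ?thesis using sm_cong[OF cong sm_k] True by simp
  qed (use IH Suc.prems(5) in simp)
qed simp

text \<open>A Gram-Schmidt procedure on functions: independence yields a function that separates the
  last vector from the others, it is corrected to be annihilated by the earlier vectors, and then
  the earlier functions are corrected by multiples of it.\<close>

lemma dual_functions:
  fixes u :: "nat \<Rightarrow> 'm tvec"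
  assumes "\<And>i. i < k \<Longrightarrow> u i \<in> tangent_space A x"
    and "\<And>c i. (\<And>f. sm x f \<Longrightarrow> (\<Sum>i<k. c i * u i f) = 0) \<Longrightarrow> i < k \<Longrightarrow> c i = (0::real)"
  shows "\<exists>g. (\<forall>j<k. sm x (g j)) \<and> (\<forall>i<k. \<forall>j<k. u i (g j) = (if i = j then 1 else 0))"
  using assms
proof (induction k)
  case (Suc k)
  have "c i = 0" if "\<And>f. sm x f \<Longrightarrow> (\<Sum>i<k. c i * u i f) = 0" "i < k" for c i
    using Suc.prems(2)[of "c(k := 0)" i] that by simp
  with Suc.IH Suc.prems(1) obtain g where
    g: "\<And>j. j < k \<Longrightarrow> sm x (g j)" "\<And>i j. i < k \<Longrightarrow> j < k \<Longrightarrow> u i (g j) = (if i = j then 1 else 0)"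
    by force
  \<comment> \<open>Otherwise \<open>u k\<close> would be the combination of the \<open>u j\<close>
    with coefficients \<open>u k (g j)\<close>.\<close>
  have "\<exists>f. sm x f \<and> u k f - (\<Sum>j<k. u j f * u k (g j)) \<noteq> 0"
  proof (rule ccontr)
    assume "\<not> ?thesis"
    then have "u k f - (\<Sum>j<k. u j f * u k (g j)) = 0" if "sm x f" for f using that by blast
    then have "(\<Sum>i<Suc k. (if i = k then 1 else - u k (g i)) * u i f) = 0" if "sm x f" for f
      using that by (simp add: sum_negf mult.commute)
    from Suc.prems(2)[OF this, of k] show False by simp
  qed
  then obtain f where f: "sm x f" "u k f - (\<Sum>j<k. u j f * u k (g j)) \<noteq> 0" by blast
  \<comment> \<open>Subtracting the combination of the \<open>g j\<close> makes every
    \<open>u i\<close> with \<open>i < k\<close> vanish on \<open>f'\<close>; the factor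
    \<open>w\<close> normalises the value of \<open>u k\<close> on \<open>f'\<close> to 1.\<close>
  define w where "w = inverse (u k f - (\<Sum>j<k. u j f * u k (g j)))"
  define f' where "f' = (\<lambda>y. w * (f y - (\<Sum>j<k. u j f * g j y)))"
  have f': "sm x f'"
    unfolding f'_def by (intro sm_cmult sm_diff sm_sum f g) simp
  have u_f': "v f' = w * (v f - (\<Sum>j<k. u j f * v (g j)))" if "v \<in> tangent_space A x" for v
  proof -
    have s: "sm x (\<lambda>y. u j f * g j y)" if "j < k" for j using g(1)[OF that] by (rule sm_cmult)
    then have S: "sm x (\<lambda>y. \<Sum>j<k. u j f * g j y)" by (intro sm_sum) simp
    have "v (\<lambda>y. \<Sum>j<k. u j f * g j y) = (\<Sum>j<k. u j f * v (g j))"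
      using s tv_sum[OF that, of "{..<k}" "\<lambda>j y. u j f * g j y"] tv_cmult[OF that g(1)] by simp
    then show ?thesis
      unfolding f'_def using tv_cmult[OF that sm_diff[OF f(1) S]] tv_diff[OF that f(1) S] by simp
  qed
  have "u i f' = 0" if "i < k" for i
    using that Suc.prems(1)[of i] g(2) by (simp add: u_f' mult_delta_right)
  moreover have "u k f' = 1"
    using Suc.prems(1)[of k] f(2) by (simp add: u_f' w_def)
  moreover have "u i (\<lambda>y. g j y - u k (g j) * f' y) = u i (g j) - u k (g j) * u i f'"
    if "i < Suc k" "j < k" for i j
    using tv_diff[OF Suc.prems(1)[OF that(1)] g(1)[OF that(2)] sm_cmult[OF f']]
      tv_cmult[OF Suc.prems(1)[OF that(1)] f'] by simp
  moreover have "sm x (\<lambda>y. g j y - u k (g j) * f' y)" if "j < k" for j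
    using that by (intro sm_diff sm_cmult f' g)
  ultimately show ?case
    using f' g(2) by (intro exI[of _ "\<lambda>j. if j = k then f' else (\<lambda>y. g j y - u k (g j) * f' y)"])
      (auto simp: less_Suc_eq)
qed simp

end

subsection \<open>Horizontal lifts\<close>

lemma ex1_eq: "\<exists>!x. P x \<Longrightarrow> P a \<Longrightarrow> P b \<Longrightarrow> a = b"
  by auto

locale ehresmann_fibred =
  total: smooth_mfd A + base: smooth_mfd B
  for A :: "('m::{t2_space, second_countable_topology}, 'e::real_inner) atlas"
    and B :: "('b::{t2_space, second_countable_topology}, 'f::real_inner) atlas" +
  fixes p :: "'m \<Rightarrow> 'b" and Hor :: "'m \<Rightarrow> 'm tvec set"
  assumes subm: "surjective_submersion A B p"
    and conn: "ehresmann_connection A B p Hor"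
begin

abbreviation V :: "'m vfield set" where "V \<equiv> vert_fields A B p"
abbreviation h :: "'b vfield \<Rightarrow> 'm vfield" where "h \<equiv> hlift A B p Hor"

lemma p_smooth: "smooth_map A B p"
  using subm unfolding surjective_submersion_def by blast

lemma p_open_vimage: "open N \<Longrightarrow> open (p -` N)"
  using p_smooth unfolding smooth_map_def continuous_on_open_vimage[OF open_UNIV] by simp

text \<open>The chain rule in charts. Each point gets a base chart of its own, and locality of
  \<open>Ck_on\<close> joins the results.\<close>

lemma pullback_sm:
  assumes "base.sm (p x) g"
  shows "total.sm x (\<lambda>y. g (p y))"
proof -
  obtain N where N: "open N" "p x \<in> N" "smooth_fun_on B N g"
    using assms unfolding smooth_fun_at_def by blast
  obtain S :: "'f set" where "finite S" "span S = UNIV"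
    using base.atlas[unfolded smooth_atlas_def, THEN conjunct1] by blast
  then obtain E :: "'f set" where E: "finite E" "\<And>x. (\<Sum>e\<in>E. (x \<bullet> e) *\<^sub>R e) = x"
    by (rule orthonormal_basis_exists) (rule that; assumption)
  have "smooth_fun_on A (p -` N) (\<lambda>y. g (p y))"
  proof (rule total.smooth_fun_onI, rule Ck_on_local)
    fix U \<phi> k w assume ch: "(U, \<phi>) \<in> A" and "w \<in> \<phi> ` (U \<inter> p -` N)"
    then obtain z where z: "z \<in> U" "p z \<in> N" "w = \<phi> z" by auto
    obtain V \<psi> where ch': "(V, \<psi>) \<in> B" "p z \<in> V" by (rule base.chart_exists)
    define T where "T = \<phi> ` (U \<inter> p -` (V \<inter> N))"
    have opn: "open T"
      unfolding T_def
      by (rule total.chart_image_open[OF ch p_open_vimage])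
        (rule open_Int[OF base.chart_dom_open[OF ch'(1)] N(1)])
    let ?P = "\<psi> \<circ> p \<circ> inv_into U \<phi>" and ?G = "\<lambda>y. g (inv_into V \<psi> y)"
    have "Ck_on k (\<phi> ` (U \<inter> p -` V)) ?P"
      using p_smooth ch ch'(1) unfolding smooth_map_def Cinf_on_def by blast
    then have P: "Ck_on k T ?P"
      by (rule Ck_on_subset) (auto simp: T_def)
    have "?P ` T \<subseteq> \<psi> ` (V \<inter> N)"
      by (auto simp: T_def total.chart_inv[OF ch])
    from Ck_on_compose[OF E opn base.chart_image_open[OF ch'(1) N(1)] this P
        base.smooth_fun_onD[OF N(3) ch'(1)]]
    have "Ck_on k T (?G \<circ> ?P)" .
    then have "Ck_on k T (\<lambda>y. g (p (inv_into U \<phi> y)))"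
      by (rule Ck_on_cong[OF opn, rotated])
        (auto simp: T_def total.chart_inv[OF ch] base.chart_inv[OF ch'(1)])
    moreover have "w \<in> T" using z ch'(2) by (auto simp: T_def)
    ultimately show "\<exists>T. open T \<and> w \<in> T \<and> Ck_on k T (\<lambda>y. g (p (inv_into U \<phi> y)))"
      using opn by blast
  qed
  then show ?thesis
    using N p_open_vimage unfolding smooth_fun_at_def by (intro exI[of _ "p -` N"]) simp
qed

lemma pullback_smooth: "g \<in> smooth_funs B \<Longrightarrow> g \<circ> p \<in> smooth_funs A"
  by (simp add: total.smooth_funs_iff base.smooth_funs_iff o_def pullback_sm)

lemma pullback_eventually: "\<forall>\<^sub>F b in nhds (p x). P b \<Longrightarrow> \<forall>\<^sub>F y in nhds x. P (p y)"
proof -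
  assume "\<forall>\<^sub>F b in nhds (p x). P b"
  then obtain N where "open N" "p x \<in> N" "\<forall>b\<in>N. P b" unfolding eventually_nhds by blast
  then show "\<forall>\<^sub>F y in nhds x. P (p y)"
    unfolding eventually_nhds using p_open_vimage[of N] by (intro exI[of _ "p -` N"]) simp
qed

lemma tangent_map_apply:
  "tangent_map A B p x u g = (if base.sm (p x) g then u (\<lambda>y. g (p y)) else 0)"
  by (simp add: tangent_map_def o_def)

lemmas Hor_pointwise = conn[unfolded ehresmann_connection_def, THEN conjunct1, rule_format]
lemmas Hor_frame = conn[unfolded ehresmann_connection_def, THEN conjunct2, rule_format]

lemma Hor_subspace: "tsubspace (Hor x)"
  and Hor_tangent: "u \<in> Hor x \<Longrightarrow> u \<in> tangent_space A x"
  and Hor_vert: "vert_space A B p x \<inter> Hor x = {0}"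
  using Hor_pointwise[of x] by blast+

lemma Hor_split: "u \<in> tangent_space A x \<Longrightarrow> \<exists>a\<in>vert_space A B p x. \<exists>b\<in>Hor x. u = a + b"
  using Hor_pointwise[of x, THEN conjunct2, THEN conjunct2, THEN conjunct2] by simp

lemma Hor_add: "u \<in> Hor x \<Longrightarrow> v \<in> Hor x \<Longrightarrow> u + v \<in> Hor x"
  and Hor_scale: "u \<in> Hor x \<Longrightarrow> (\<lambda>f. c * u f) \<in> Hor x"
  and Hor_zero: "0 \<in> Hor x"
  using Hor_subspace[of x] unfolding tsubspace_def by blast+

lemma Hor_sum:
  assumes "\<And>i. i \<in> I \<Longrightarrow> u i \<in> Hor x"
  shows "(\<lambda>f. \<Sum>i\<in>I. c i * u i f) \<in> Hor x"
  using assms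
proof (induction I rule: infinite_finite_induct)
  case (insert i I)
  then have "(\<lambda>f. c i * u i f) + (\<lambda>f. \<Sum>i\<in>I. c i * u i f) \<in> Hor x"
    by (intro Hor_add Hor_scale) auto
  then show ?case using insert by (simp add: plus_fun_def)
qed (use Hor_zero in \<open>simp_all add: zero_fun_def\<close>)

text \<open>The difference is horizontal and has image 0, so it is vertical as well.\<close>

lemma Hor_unique:
  assumes "a \<in> Hor x" "b \<in> Hor x" "tangent_map A B p x a = tangent_map A B p x b"
  shows "a = b"
proof -
  let ?d = "a + (\<lambda>f. (-1) * b f)"
  have d: "?d \<in> Hor x" by (intro Hor_add Hor_scale assms)
  have "tangent_map A B p x ?d = 0"
  proof
    fix g show "tangent_map A B p x ?d g = 0 g"
      using fun_cong[OF assms(3), of g] by (simp add: tangent_map_apply split: if_splits)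
  qed
  then have "?d \<in> vert_space A B p x \<inter> Hor x"
    using d Hor_tangent unfolding vert_space_def by blast
  then have "?d = 0" using Hor_vert by blast
  then have "?d f = 0" for f by (simp only: zero_fun_apply)
  then show ?thesis by (simp add: fun_eq_iff)
qed

lemma Hor_exists:
  assumes "w \<in> tangent_space B (p x)"
  shows "\<exists>u\<in>Hor x. tangent_map A B p x u = w"
proof -
  have "w \<in> tangent_map A B p x ` tangent_space A x"
    using assms subm unfolding surjective_submersion_def by blast
  then obtain u where u: "u \<in> tangent_space A x" "w = tangent_map A B p x u" by blast
  obtain a b where ab: "a \<in> vert_space A B p x" "b \<in> Hor x" "u = a + b"
    using Hor_split[OF u(1)] by blast
  have "tangent_map A B p x a g = 0" for g using ab(1) by (simp add: vert_space_def)
  then have "a (\<lambda>y. g (p y)) = 0" if "base.sm (p x) g" for g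
    using that by (metis tangent_map_apply)
  then have "w = tangent_map A B p x b"
    unfolding u(2) ab(3) by (simp add: fun_eq_iff tangent_map_apply)
  then show ?thesis using ab(2) by blast
qed

lemma hlift_eqI:
  assumes "u \<in> Hor x" "tangent_map A B p x u = v (p x)"
  shows "h v x = u"
  unfolding hlift_def
proof (rule the_equality)
  fix u' assume "u' \<in> Hor x \<and> tangent_map A B p x u' = v (p x)"
  then show "u' = u" using assms by (intro Hor_unique) auto
qed (use assms in blast)

lemma
  assumes "v \<in> vfields B"
  shows hlift_Hor: "h v x \<in> Hor x"
    and hlift_tangent_map: "tangent_map A B p x (h v x) = v (p x)"
proof -
  obtain u where u: "u \<in> Hor x" "tangent_map A B p x u = v (p x)"
    using Hor_exists[OF base.vf_tangent[OF assms]] by blast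
  then show "h v x \<in> Hor x" "tangent_map A B p x (h v x) = v (p x)"
    using hlift_eqI[where v = v, OF u] by simp_all
qed

lemma hlift_vfield:
  assumes v: "v \<in> vfields B"
  shows "h v \<in> vfields A"
proof (rule total.vfieldsI)
  show "h v x \<in> tangent_space A x" for x using Hor_tangent[OF hlift_Hor[OF v]] .
  fix x f assume f: "total.sm x f"
  obtain W k X where W: "open W" "x \<in> W"
    and X: "\<And>i. i < k \<Longrightarrow> smooth_vfield_on A W (X i)"
    and X_Hor: "\<And>i y. i < k \<Longrightarrow> y \<in> W \<Longrightarrow> X i y \<in> Hor y"
    and frame: "\<And>y u. y \<in> W \<Longrightarrow> u \<in> Hor y \<Longrightarrow>
      \<exists>!c::nat \<Rightarrow> real. (\<forall>i\<ge>k. c i = 0) \<and> u = (\<lambda>f. \<Sum>i<k. c i * X i y f)"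
    using Hor_frame[of x]
  proof (elim exE conjE)
    fix W k X
    assume "open W" "x \<in> W" and X: "\<forall>i<k. smooth_vfield_on A W (X i)"
      and fr: "\<forall>y\<in>W. (\<forall>i<k. X i y \<in> Hor y) \<and>
        (\<forall>u\<in>Hor y. \<exists>!c::nat \<Rightarrow> real. (\<forall>i\<ge>k. c i = 0) \<and> u = (\<lambda>f. \<Sum>i<k. c i * X i y f))"
    show thesis
      by (rule that[of W k X]) (use \<open>open W\<close> \<open>x \<in> W\<close> X fr in simp_all)
  qed
  \<comment> \<open>The coefficients in the frame are chosen point by point, with no regularity;
    their smoothness at \<open>x\<close> comes from the linear system below.\<close>
  define c where "c i y = (SOME c::nat \<Rightarrow> real. h v y = (\<lambda>f. \<Sum>i<k. c i * X i y f)) i" for i y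
  have c: "h v y = (\<lambda>f. \<Sum>i<k. c i y * X i y f)" if "y \<in> W" for y
  proof -
    have "\<exists>c::nat \<Rightarrow> real. h v y = (\<lambda>f. \<Sum>i<k. c i * X i y f)"
      using ex1_implies_ex[OF frame[OF that hlift_Hor[OF v]]] by (elim exE conjE) (rule exI)
    then show ?thesis unfolding c_def by (rule someI_ex)
  qed
  have X_tangent: "X i y \<in> tangent_space A y" if "i < k" "y \<in> W" for i y
    using Hor_tangent[OF X_Hor[OF that]] .
  define u where "u i = tangent_map A B p x (X i x)" for i
  \<comment> \<open>The projected frame is independent at \<open>p x\<close>: a combination of frame
    vectors that projects to 0 is horizontal, hence 0, and the frame represents 0 in one way
    only.\<close>
  have "\<exists>g. (\<forall>j<k. base.sm (p x) (g j)) \<and> (\<forall>i<k. \<forall>j<k. u i (g j) = (if i = j then 1 else 0))"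
  proof (rule base.dual_functions)
    show "u i \<in> tangent_space B (p x)" if "i < k" for i
      using X_tangent[OF that W(2)] subm unfolding u_def surjective_submersion_def by blast
    fix d i assume d: "\<And>f. base.sm (p x) f \<Longrightarrow> (\<Sum>i<k. d i * u i f) = 0" and i: "i < k"
    \<comment> \<open>The uniqueness in the frame condition concerns sequences that vanish from
      index \<open>k\<close> on, so \<open>d\<close> is truncated.\<close>
    let ?d = "\<lambda>i. if i < k then d i else 0"
    let ?s = "\<lambda>f. \<Sum>i<k. ?d i * X i x f"
    have "?s = 0"
    proof (rule Hor_unique)
      show "?s \<in> Hor x" by (rule Hor_sum) (simp add: X_Hor W(2))
      show "tangent_map A B p x ?s = tangent_map A B p x 0"
      proof
        fix g show "tangent_map A B p x ?s g = tangent_map A B p x 0 g"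
          using d[of g] by (simp add: tangent_map_apply u_def)
      qed
    qed (rule Hor_zero)
    then have "0 = ?s" ..
    moreover have "(0::'m tvec) = (\<lambda>f. \<Sum>i<k. (\<lambda>i. 0) i * X i x f)" by (simp add: zero_fun_def)
    ultimately have "?d = (\<lambda>i. 0)"
      by (intro ex1_eq[OF frame[OF W(2) Hor_zero]]) simp_all
    from fun_cong[OF this, of i] show "d i = 0" using i by simp
  qed
  then obtain g where g: "\<And>j. j < k \<Longrightarrow> base.sm (p x) (g j)"
    and dual: "\<And>i j. i < k \<Longrightarrow> j < k \<Longrightarrow> u i (g j) = (if i = j then 1 else 0)"
    by blast
  \<comment> \<open>The lift is tested on the functions \<open>g j \<circ> p\<close>. The left sides
    of the system are then pullbacks of \<open>v\<close> applied to \<open>g j\<close>, which are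
    known to be smooth, and by duality the matrix is the identity at \<open>x\<close>.\<close>
  have c_sm: "total.sm x (c i)" if "i < k" for i
  proof (rule total.sm_coefficients[where a = "\<lambda>i j y. X i y (\<lambda>z. g j (p z))" and b = "\<lambda>j y. v (p y) (g j)",
        OF _ _ _ _ that])
    show "total.sm x (\<lambda>y. X i y (\<lambda>z. g j (p z)))" if "i < k" "j < k" for i j
      using that W by (intro total.vfield_on_sm[OF X] pullback_sm g)
    show "total.sm x (\<lambda>y. v (p y) (g j))" if "j < k" for j
      by (rule pullback_sm[OF base.vf_sm[OF v g[OF that]]])
    show "X i x (\<lambda>z. g j (p z)) = (if i = j then 1 else 0)" if "i < k" "j < k" for i j
      using dual[OF that] g[OF that(2)] by (simp add: u_def tangent_map_apply)
    have "\<forall>\<^sub>F b in nhds (p x). \<forall>j\<in>{..<k}. base.sm b (g j)"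
      using g base.sm_eventually by (intro eventually_ball_finite) auto
    from eventually_conj[OF eventually_nhds_in_open[OF W] pullback_eventually[OF this]]
    show "\<forall>\<^sub>F y in nhds x. \<forall>j<k. v (p y) (g j) = (\<Sum>i<k. c i y * X i y (\<lambda>z. g j (p z)))"
    proof eventually_elim
      case (elim y)
      show ?case
      proof (intro allI impI)
        fix j assume "j < k"
        then have "v (p y) (g j) = h v y (\<lambda>z. g j (p z))"
          using fun_cong[OF hlift_tangent_map[OF v, of y], of "g j"] elim
          by (simp add: tangent_map_apply)
        also have "\<dots> = (\<Sum>i<k. c i y * X i y (\<lambda>z. g j (p z)))"
          using c elim by simp
        finally show "v (p y) (g j) = (\<Sum>i<k. c i y * X i y (\<lambda>z. g j (p z)))" .
      qed
    qed
  qed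
  have sum_sm: "total.sm x (\<lambda>y. \<Sum>i<k. c i y * X i y f)"
    by (intro total.sm_sum total.sm_mult c_sm total.vfield_on_sm[OF X W f]) simp_all
  have "\<forall>\<^sub>F y in nhds x. (\<Sum>i<k. c i y * X i y f) = h v y f"
    using eventually_nhds_in_open[OF W] by eventually_elim (simp add: c)
  then show "total.sm x (\<lambda>y. h v y f)" using sum_sm by (rule total.sm_cong)
qed


lemma hlift_add:
  assumes "u \<in> vfields B" "v \<in> vfields B"
  shows "h (u + v) = h u + h v"
proof
  fix x
  show "h (u + v) x = (h u + h v) x"
  proof (rule hlift_eqI)
    show "(h u + h v) x \<in> Hor x" using assms by (simp add: Hor_add hlift_Hor)
    show "tangent_map A B p x ((h u + h v) x) = (u + v) (p x)"
    proof
      fix g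
      show "tangent_map A B p x ((h u + h v) x) g = (u + v) (p x) g"
        using fun_cong[OF hlift_tangent_map[OF assms(1), of x], of g]
          fun_cong[OF hlift_tangent_map[OF assms(2), of x], of g]
        by (simp add: tangent_map_apply split: if_splits)
    qed
  qed
qed

lemma hlift_smult:
  assumes "v \<in> vfields B"
  shows "h (vf_smult f v) = vf_smult (f \<circ> p) (h v)"
proof
  fix x
  show "h (vf_smult f v) x = vf_smult (f \<circ> p) (h v) x"
  proof (rule hlift_eqI)
    show "vf_smult (f \<circ> p) (h v) x \<in> Hor x"
      using assms by (simp add: vf_smult_def Hor_scale hlift_Hor)
    show "tangent_map A B p x (vf_smult (f \<circ> p) (h v) x) = vf_smult f v (p x)"
    proof
      fix g
      show "tangent_map A B p x (vf_smult (f \<circ> p) (h v) x) g = vf_smult f v (p x) g"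
        using fun_cong[OF hlift_tangent_map[OF assms, of x], of g]
        by (auto simp: vf_smult_def tangent_map_apply split: if_splits)
    qed
  qed
qed

lemma hlift_uminus:
  assumes "v \<in> vfields B"
  shows "h (- v) = - h v"
proof -
  have "vf_smult (\<lambda>x. - 1) v = - v" "vf_smult ((\<lambda>x. - 1) \<circ> p) (h v) = - h v"
    by (simp_all add: vf_smult_def fun_eq_iff)
  then show ?thesis using hlift_smult[OF assms, of "\<lambda>x. - 1"] by simp
qed


subsection \<open>Related and vertical vector fields\<close>

text \<open>The classical relation of \<open>p\<close>-related vector fields, tested on pulled back
  germs.\<close>

definition related :: "'m vfield \<Rightarrow> 'b vfield \<Rightarrow> bool" where
  "related X v \<longleftrightarrow> (\<forall>x g. base.sm (p x) g \<longrightarrow> X x (\<lambda>y. g (p y)) = v (p x) g)"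

lemma relatedD: "related X v \<Longrightarrow> base.sm (p x) g \<Longrightarrow> X x (\<lambda>y. g (p y)) = v (p x) g"
  unfolding related_def by blast

lemma related_hlift: "v \<in> vfields B \<Longrightarrow> related (h v) v"
  unfolding related_def
proof (intro allI impI)
  fix x g assume "v \<in> vfields B" "base.sm (p x) g"
  then show "h v x (\<lambda>y. g (p y)) = v (p x) g"
    using fun_cong[OF hlift_tangent_map[of v x], of g] by (simp add: tangent_map_apply)
qed

text \<open>With verticality as relatedness to 0, all closure properties under brackets become
  instances of \<open>related_bracket\<close>.\<close>

lemma vert_iff: "X \<in> V \<longleftrightarrow> X \<in> vfields A \<and> related X 0"
proof -
  have "tangent_map A B p x (X x) = 0 \<longleftrightarrow> (\<forall>g. base.sm (p x) g \<longrightarrow> X x (\<lambda>y. g (p y)) = 0)" for x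
    by (auto simp: fun_eq_iff tangent_map_apply)
  then show ?thesis
    unfolding vert_fields_def vert_space_def related_def
    by (auto simp: total.vf_tangent)
qed

text \<open>Relatedness holds at all points near \<open>x\<close>, so \<open>Z'\<close> applied to
  \<open>g \<circ> p\<close> is, as a germ, the pullback of \<open>w'\<close> applied to
  \<open>g\<close>, and relatedness can be applied a second time.\<close>

lemma related_bracket:
  assumes "X \<in> vfields A" "Y \<in> vfields A" "related X u" "related Y v"
    and "u \<in> vfields B" "v \<in> vfields B"
  shows "related (bracket A X Y) (bracket B u v)"
  unfolding related_def
proof (intro allI impI)
  fix x g assume g: "base.sm (p x) g"
  have lift: "Z x (\<lambda>y. Z' y (\<lambda>z. g (p z))) = w (p x) (\<lambda>b. w' b g)"
    if "Z \<in> vfields A" "related Z w" "related Z' w'" "w' \<in> vfields B" for Z Z' w w'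
  proof -
    have "\<forall>\<^sub>F y in nhds x. w' (p y) g = Z' y (\<lambda>z. g (p z))"
      using pullback_eventually[OF base.sm_eventually[OF g]]
      by eventually_elim (simp add: relatedD[OF that(3)])
    then have "Z x (\<lambda>y. Z' y (\<lambda>z. g (p z))) = Z x (\<lambda>y. w' (p y) g)"
      by (rule total.tv_cong[OF total.vf_tangent[OF that(1)] pullback_sm[OF base.vf_sm[OF that(4) g]]])
    then show ?thesis using relatedD[OF that(2) base.vf_sm[OF that(4) g]] by simp
  qed
  show "bracket A X Y x (\<lambda>y. g (p y)) = bracket B u v (p x) g"
    using lift[OF assms(1,3,4,6)] lift[OF assms(2,4,3,5)] g pullback_sm[OF g]
    by (simp add: bracket_def)
qed

lemma related_add: "related X u \<Longrightarrow> related Y v \<Longrightarrow> related (X + Y) (u + v)"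
  and related_diff: "related X u \<Longrightarrow> related Y v \<Longrightarrow> related (X - Y) (u - v)"
  unfolding related_def by simp_all

lemma V_vfield: "X \<in> V \<Longrightarrow> X \<in> vfields A"
  by (simp add: vert_iff)

lemma V_add: "X \<in> V \<Longrightarrow> Y \<in> V \<Longrightarrow> X + Y \<in> V"
  using related_add[of X 0 Y 0] by (simp add: vert_iff total.vfields_add)

lemma V_smult: "f \<in> smooth_funs A \<Longrightarrow> X \<in> V \<Longrightarrow> vf_smult f X \<in> V"
  using total.vfields_smult[of f X] by (simp add: vert_iff related_def vf_smult_def)

lemma V_bracket_related:
  assumes "X \<in> vfields A" "related X u" "u \<in> vfields B" "Y \<in> V"
  shows "bracket A X Y \<in> V"
  using related_bracket[of X Y u 0] assms
  by (simp add: vert_iff total.vfields_bracket base.bracket_zero base.vfields_zero)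

lemma V_bracket: "X \<in> V \<Longrightarrow> Y \<in> V \<Longrightarrow> bracket A X Y \<in> V"
  by (rule V_bracket_related[of X 0]) (simp_all add: vert_iff base.vfields_zero)

lemma V_bracket_hlift: "v \<in> vfields B \<Longrightarrow> X \<in> V \<Longrightarrow> bracket A (h v) X \<in> V"
  by (rule V_bracket_related[OF hlift_vfield related_hlift])

lemma V_pullback:
  assumes "X \<in> V" "f \<in> smooth_funs B"
  shows "X x (f \<circ> p) = 0"
  using assms relatedD[of X 0 x f] by (simp add: vert_iff o_def base.smooth_funsD)

lemma hlift_pullback:
  assumes "v \<in> vfields B" "f \<in> smooth_funs B"
  shows "h v x (f \<circ> p) = v (p x) f"
  using relatedD[OF related_hlift[OF assms(1)], of x f] assms(2) by (simp add: o_def base.smooth_funsD)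

section \<open>The curvature and its linearity over functions on the base\<close>

abbreviation C :: "'b vfield \<Rightarrow> 'b vfield \<Rightarrow> 'm vfield" where "C \<equiv> curvature A B p Hor"

text \<open>Both terms of the curvature are related to \<open>bracket B u v\<close>, so their
  difference is related to 0.\<close>

lemma curvature_vert:
  assumes "u \<in> vfields B" "v \<in> vfields B"
  shows "C u v \<in> V"
proof -
  have uv: "bracket B u v \<in> vfields B" by (rule base.vfields_bracket[OF assms])
  have "related (C u v) (bracket B u v - bracket B u v)"
    unfolding curvature_def using assms uv
    by (intro related_diff related_bracket related_hlift hlift_vfield)
  then show ?thesis
    using assms uv unfolding curvature_def
    by (simp add: vert_iff total.vfields_diff total.vfields_bracket hlift_vfield)
qed

lemma curvature_antisym:
  assumes "u \<in> vfields B" "v \<in> vfields B"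
  shows "C v u = - C u v"
  using hlift_uminus[OF base.vfields_bracket[OF assms]] total.bracket_antisym[of "h v" "h u"]
    base.bracket_antisym[of v u]
  by (simp add: curvature_def)

lemma curvature_add:
  assumes "u \<in> vfields B" "u' \<in> vfields B" "v \<in> vfields B"
  shows "C (u + u') v = C u v + C u' v"
  unfolding curvature_def hlift_add[OF assms(1,2)] base.bracket_add_left[OF assms]
    hlift_add[OF base.vfields_bracket[OF assms(1,3)] base.vfields_bracket[OF assms(2,3)]]
    total.bracket_add_left[OF assms[THEN hlift_vfield]]
  by (rule add_diff_add)

lemma hlift_diff:
  assumes "u \<in> vfields B" "v \<in> vfields B"
  shows "h (u - v) = h u - h v"
  unfolding diff_conv_add_uminus hlift_add[OF assms(1) base.vfields_uminus[OF assms(2)]]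
    hlift_uminus[OF assms(2)] by (rule refl)

text \<open>The brackets upstairs and downstairs each contribute a Leibniz term. Since
  \<open>h v\<close> differentiates \<open>f \<circ> p\<close> to the pullback of \<open>v\<close>
  applied to \<open>f\<close>, both terms are the same multiple of \<open>h u\<close> and
  cancel.\<close>

lemma curvature_smult:
  assumes u: "u \<in> vfields B" and v: "v \<in> vfields B" and f: "f \<in> smooth_funs B"
  shows "C (vf_smult f u) v = vf_smult (f \<circ> p) (C u v)"
proof -
  have vf: "bracket B u v \<in> vfields B" "vf_smult (\<lambda>b. v b f) u \<in> vfields B"
    "vf_smult f (bracket B u v) \<in> vfields B"
    by (intro base.vfields_bracket base.vfields_smult base.vf_smooth[OF v f] u v f)+
  have eq: "(\<lambda>x. h v x (f \<circ> p)) = (\<lambda>b. v b f) \<circ> p"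
    using hlift_pullback[OF v f] by (simp add: fun_eq_iff)
  have "C (vf_smult f u) v
      = vf_smult (f \<circ> p) (bracket A (h u) (h v)) - vf_smult (f \<circ> p) (h (bracket B u v))"
    unfolding curvature_def hlift_smult[OF u] base.bracket_smult_left[OF u v f]
      total.bracket_smult_left[OF hlift_vfield[OF u] hlift_vfield[OF v] pullback_smooth[OF f]]
      hlift_diff[OF vf(3,2)] hlift_smult[OF vf(1)] hlift_smult[OF u] eq
    by (simp add: fun_eq_iff)
  then show ?thesis by (simp add: curvature_def vf_smult_def fun_eq_iff right_diff_distrib)
qed

end

subsection \<open>Alternating forms on modules of vector fields\<close>

lemma length_nths_remove1:
  assumes "i < length vs"
  shows "length (nths vs (- {i})) = length vs - 1"
proof -
  have "{k. k < length vs \<and> k \<in> - {i}} = {..<length vs} - {i}" by auto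
  then show ?thesis using assms by (simp add: length_nths)
qed

lemma length_nths_remove2:
  assumes "i < j" "j < length vs"
  shows "length (nths vs (- {i, j})) = length vs - 2"
proof -
  have "{k. k < length vs \<and> k \<in> - {i, j}} = {..<length vs} - {i, j}" by auto
  then show ?thesis using assms by (simp add: length_nths card_Diff_subset)
qed

lemma set_update_subset: "set vs \<subseteq> V \<Longrightarrow> v \<in> V \<Longrightarrow> set (vs[i := v]) \<subseteq> V"
  by (meson insert_subset order_trans set_update_subset_insert)

lemma antisym_zero:
  fixes \<omega> :: "'x form"
  shows "\<omega> = - \<omega> \<Longrightarrow> \<omega> = 0"
  by (simp add: fun_eq_iff eq_neg_iff_add_eq_0)

lemma length2_cases:
  assumes "length vs = 2" "set vs \<subseteq> S"
  obtains u v where "vs = [u, v]" "u \<in> S" "v \<in> S"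
  using assms by (auto simp: numeral_eq_Suc length_Suc_conv)

lemma length3_cases:
  assumes "length vs = 3" "set vs \<subseteq> S"
  obtains u v w where "vs = [u, v, w]" "u \<in> S" "v \<in> S" "w \<in> S"
  using assms by (auto simp: numeral_eq_Suc length_Suc_conv)

context
  fixes R smV V smW W k \<omega>
  assumes \<omega>: "\<omega> \<in> alt_forms R smV V smW W k"
begin

lemma alt_forms_closed: "length vs = k \<Longrightarrow> set vs \<subseteq> V \<Longrightarrow> \<omega> vs \<in> W"
  using \<omega>[unfolded alt_forms_def, THEN CollectD, THEN conjunct1] by simp

lemma alt_forms_junk: "\<not> (length vs = k \<and> set vs \<subseteq> V) \<Longrightarrow> \<omega> vs = 0"
  using \<omega>[unfolded alt_forms_def, THEN CollectD, THEN conjunct2, THEN conjunct1, rule_format] .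

lemma alt_forms_add:
  "length vs = k \<Longrightarrow> set vs \<subseteq> V \<Longrightarrow> i < k \<Longrightarrow> v \<in> V \<Longrightarrow> v' \<in> V \<Longrightarrow>
    \<omega> (vs[i := v + v']) = \<omega> (vs[i := v]) + \<omega> (vs[i := v'])"
  using \<omega>[unfolded alt_forms_def, THEN CollectD, THEN conjunct2, THEN conjunct2, THEN conjunct1,
      rule_format] by blast

lemma alt_forms_smult:
  "length vs = k \<Longrightarrow> set vs \<subseteq> V \<Longrightarrow> i < k \<Longrightarrow> v \<in> V \<Longrightarrow> r \<in> R \<Longrightarrow>
    \<omega> (vs[i := smV r v]) = smW r (\<omega> (vs[i := v]))"
  using \<omega>[unfolded alt_forms_def, THEN CollectD, THEN conjunct2, THEN conjunct2, THEN conjunct2,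
      THEN conjunct1, rule_format] by blast

lemma alt_forms_alt:
  "length vs = k \<Longrightarrow> set vs \<subseteq> V \<Longrightarrow> i < j \<Longrightarrow> j < k \<Longrightarrow> vs ! i = vs ! j \<Longrightarrow> \<omega> vs = 0"
  using \<omega>[unfolded alt_forms_def, THEN CollectD, THEN conjunct2, THEN conjunct2, THEN conjunct2,
      THEN conjunct2, rule_format] by blast

lemma alt_forms_mem: "0 \<in> W \<Longrightarrow> \<omega> vs \<in> W"
  using alt_forms_closed alt_forms_junk by metis

text \<open>Polarisation: the form vanishes with \<open>v + w\<close> in both slots, and so do the
  diagonal terms of the expansion.\<close>

lemma alt_forms_swap:
  assumes V: "\<And>v w. v \<in> V \<Longrightarrow> w \<in> V \<Longrightarrow> v + w \<in> V"
    and vs: "length vs = k" "set vs \<subseteq> V" "i < j" "j < k" and vw: "v \<in> V" "w \<in> V"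
  shows "\<omega> (vs[i := v, j := w]) = - \<omega> (vs[i := w, j := v])"
proof -
  define f where "f a b = \<omega> (vs[i := a, j := b])" for a b
  have diag: "f a a = 0" if "a \<in> V" for a
    unfolding f_def using vs that by (intro alt_forms_alt[of _ i j] set_update_subset) simp_all
  have add2: "f a (b + c) = f a b + f a c" if "a \<in> V" "b \<in> V" "c \<in> V" for a b c
    unfolding f_def using vs that by (intro alt_forms_add set_update_subset) simp_all
  have add1: "f (a + b) c = f a c + f b c" if "a \<in> V" "b \<in> V" "c \<in> V" for a b c
  proof -
    have "f d c = \<omega> (vs[j := c, i := d])" for d
      unfolding f_def using vs by (simp add: list_update_swap)
    then show ?thesis using vs that by (simp add: alt_forms_add set_update_subset)
  qed
  have "f (v + w) (v + w) = 0" by (rule diag[OF V[OF vw]])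
  then have "f v w + f w v = 0"
    using vw by (simp add: V add1 add2 diag[OF vw(1)] diag[OF vw(2)] add.commute)
  then show ?thesis unfolding f_def by (rule eq_neg_iff_add_eq_0[THEN iffD2])
qed

end

lemma alt_formsI:
  assumes "\<And>vs. length vs = k \<Longrightarrow> set vs \<subseteq> V \<Longrightarrow> \<omega> vs \<in> W"
    and "\<And>vs. \<not> (length vs = k \<and> set vs \<subseteq> V) \<Longrightarrow> \<omega> vs = 0"
    and "\<And>vs i v v'. length vs = k \<Longrightarrow> set vs \<subseteq> V \<Longrightarrow> i < k \<Longrightarrow> v \<in> V \<Longrightarrow> v' \<in> V \<Longrightarrow>
        \<omega> (vs[i := v + v']) = \<omega> (vs[i := v]) + \<omega> (vs[i := v'])"
    and "\<And>vs i v r. length vs = k \<Longrightarrow> set vs \<subseteq> V \<Longrightarrow> i < k \<Longrightarrow> v \<in> V \<Longrightarrow> r \<in> R \<Longrightarrow>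
        \<omega> (vs[i := smV r v]) = smW r (\<omega> (vs[i := v]))"
    and "\<And>vs i j. length vs = k \<Longrightarrow> set vs \<subseteq> V \<Longrightarrow> i < j \<Longrightarrow> j < k \<Longrightarrow> vs ! i = vs ! j \<Longrightarrow> \<omega> vs = 0"
  shows "\<omega> \<in> alt_forms R smV V smW W k"
  unfolding alt_forms_def
proof (intro CollectI conjI allI impI)
  fix vs assume "\<not> (length vs = k \<and> set vs \<subseteq> V)"
  then show "\<omega> vs = 0" by (rule assms(2))
qed ((elim conjE)?, rule assms(1,3,4,5); assumption)+

lemma alt_forms_diff:
  assumes \<omega>: "\<omega> \<in> alt_forms R smV V smW W k" and \<eta>: "\<eta> \<in> alt_forms R smV V smW W k"
    and W: "\<And>a b. a \<in> W \<Longrightarrow> b \<in> W \<Longrightarrow> a - b \<in> W"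
    and smW: "\<And>r a b. smW r (a - b) = smW r a - smW r b"
  shows "\<omega> - \<eta> \<in> alt_forms R smV V smW W k"
proof (rule alt_formsI)
  show "(\<omega> - \<eta>) vs \<in> W" if "length vs = k" "set vs \<subseteq> V" for vs
    using alt_forms_closed[OF \<omega> that] alt_forms_closed[OF \<eta> that] W by simp
  show "(\<omega> - \<eta>) vs = 0" if "\<not> (length vs = k \<and> set vs \<subseteq> V)" for vs
    using alt_forms_junk[OF \<omega> that] alt_forms_junk[OF \<eta> that] by simp
  show "(\<omega> - \<eta>) (vs[i := v + v']) = (\<omega> - \<eta>) (vs[i := v]) + (\<omega> - \<eta>) (vs[i := v'])"
    if "length vs = k" "set vs \<subseteq> V" "i < k" "v \<in> V" "v' \<in> V" for vs i v v'
    using alt_forms_add[OF \<omega> that] alt_forms_add[OF \<eta> that] by (simp add: algebra_simps)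
  show "(\<omega> - \<eta>) (vs[i := smV r v]) = smW r ((\<omega> - \<eta>) (vs[i := v]))"
    if "length vs = k" "set vs \<subseteq> V" "i < k" "v \<in> V" "r \<in> R" for vs i v r
    using alt_forms_smult[OF \<omega> that] alt_forms_smult[OF \<eta> that] smW by simp
  show "(\<omega> - \<eta>) vs = 0"
    if "length vs = k" "set vs \<subseteq> V" "i < j" "j < k" "vs ! i = vs ! j" for vs i j
    using alt_forms_alt[OF \<omega> that] alt_forms_alt[OF \<eta> that] by simp
qed

lemma alt_forms_zero:
  assumes "0 \<in> W" "\<And>r. smW r 0 = 0"
  shows "0 \<in> alt_forms R smV V smW W k"
  by (rule alt_formsI) (simp_all add: assms)

section \<open>Koszul's formula on submodules of vector fields\<close>

context smooth_mfd
begin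

text \<open>Covers all vector fields as well as the vertical ones, so that facts on forms and
  \<open>koszul_d\<close> are proved once for \<open>forms\<close> and
  \<open>vert_forms\<close>.\<close>

definition vf_submodule :: "'m vfield set \<Rightarrow> bool" where
  "vf_submodule S \<longleftrightarrow> S \<subseteq> vfields A \<and> (\<forall>X\<in>S. \<forall>Y\<in>S. X + Y \<in> S) \<and>
     (\<forall>f\<in>smooth_funs A. \<forall>X\<in>S. vf_smult f X \<in> S)"

lemma vf_submodule_vfields: "vf_submodule (vfields A)"
  by (simp add: vf_submodule_def vfields_add vfields_smult)

lemma smooth_zero: "0 \<in> smooth_funs A"
  using const_smooth[of 0] by (simp add: zero_fun_def)

lemma smooth_add: "f \<in> smooth_funs A \<Longrightarrow> g \<in> smooth_funs A \<Longrightarrow> f + g \<in> smooth_funs A"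
  and smooth_diff: "f \<in> smooth_funs A \<Longrightarrow> g \<in> smooth_funs A \<Longrightarrow> f - g \<in> smooth_funs A"
  by (simp_all add: smooth_funs_iff plus_fun_def fun_diff_def sm_add sm_diff)

lemma smooth_uminus: "f \<in> smooth_funs A \<Longrightarrow> - f \<in> smooth_funs A"
  using smooth_diff[OF smooth_zero, of f] by simp

lemma smooth_sum: "(\<And>i. i \<in> I \<Longrightarrow> f i \<in> smooth_funs A) \<Longrightarrow> (\<lambda>x. \<Sum>i\<in>I. f i x) \<in> smooth_funs A"
  by (simp add: smooth_funs_iff sm_sum)

context
  fixes X
  assumes X: "X \<in> vfields A"
begin

lemma vf_zero_fun: "X x 0 = 0"
  using tv_zero[OF vf_tangent[OF X], of x] by (simp add: zero_fun_def)

lemma vf_add: "f \<in> smooth_funs A \<Longrightarrow> g \<in> smooth_funs A \<Longrightarrow> X x (\<lambda>y. f y + g y) = X x f + X x g"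
  and vf_diff: "f \<in> smooth_funs A \<Longrightarrow> g \<in> smooth_funs A \<Longrightarrow> X x (\<lambda>y. f y - g y) = X x f - X x g"
  and vf_mult: "f \<in> smooth_funs A \<Longrightarrow> g \<in> smooth_funs A \<Longrightarrow>
    X x (\<lambda>y. f y * g y) = f x * X x g + g x * X x f"
  using vf_tangent[OF X, of x]
  by (simp_all add: tv_add tv_diff tv_mult smooth_funsD)

lemma vf_plus: "f \<in> smooth_funs A \<Longrightarrow> g \<in> smooth_funs A \<Longrightarrow> X x (f + g) = X x f + X x g"
  using vf_add by (simp add: plus_fun_def)

end

lemma bracket_apply:
  "f \<in> smooth_funs A \<Longrightarrow> bracket A X Y x f = X x (\<lambda>y. Y y f) - Y x (\<lambda>y. X y f)"
  by (simp add: bracket_def smooth_funsD)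

lemma koszul_d_1:
  assumes "a \<in> S" "b \<in> S"
  shows "koszul_d A S \<omega> [a, b] = (\<lambda>x. a x (\<omega> [b]) - b x (\<omega> [a]) - \<omega> [bracket A a b] x)"
  using assms by (simp add: koszul_d_def fun_eq_iff lessThan_Suc nths_Cons)

lemma koszul_d_2:
  assumes "a \<in> S" "b \<in> S" "c \<in> S"
  shows "koszul_d A S \<omega> [a, b, c] x = a x (\<omega> [b, c]) - b x (\<omega> [a, c]) + c x (\<omega> [a, b])
    - \<omega> [bracket A a b, c] x + \<omega> [bracket A a c, b] x - \<omega> [bracket A b c, a] x"
  using assms by (simp add: koszul_d_def lessThan_Suc nths_Cons)

lemma koszul_d_3:
  assumes "a \<in> S" "b \<in> S" "c \<in> S" "d \<in> S"
  shows "koszul_d A S \<omega> [a, b, c, d] x =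
    a x (\<omega> [b, c, d]) - b x (\<omega> [a, c, d]) + c x (\<omega> [a, b, d]) - d x (\<omega> [a, b, c])
    - \<omega> [bracket A a b, c, d] x + \<omega> [bracket A a c, b, d] x - \<omega> [bracket A a d, b, c] x
    - \<omega> [bracket A b c, a, d] x + \<omega> [bracket A b d, a, c] x - \<omega> [bracket A c d, a, b] x"
  using assms by (simp add: koszul_d_def lessThan_Suc nths_Cons)

context
  fixes S
  assumes S: "vf_submodule S"
begin

lemma submodule_vfield: "X \<in> S \<Longrightarrow> X \<in> vfields A"
  and submodule_add: "X \<in> S \<Longrightarrow> Y \<in> S \<Longrightarrow> X + Y \<in> S"
  using S unfolding vf_submodule_def by auto

lemma koszul_d_smooth:
  assumes "\<And>ws. \<omega> ws \<in> smooth_funs A"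
  shows "koszul_d A S \<omega> ws \<in> smooth_funs A"
proof (cases "set ws \<subseteq> S")
  case True
  have nth: "ws ! i \<in> vfields A" if "i < length ws" for i
    using True that nth_mem submodule_vfield by blast
  have "(\<lambda>x. (\<Sum>i<length ws. (-1)^i * (ws ! i) x (\<omega> (nths ws (-{i})))) +
      (\<Sum>j<length ws. \<Sum>i<j. (-1)^(i+j) * \<omega> (bracket A (ws ! i) (ws ! j) # nths ws (-{i, j})) x))
    \<in> smooth_funs A"
    using assms nth unfolding smooth_funs_iff
    by (intro allI sm_add sm_sum sm_cmult) (auto intro: vf_sm)
  then show ?thesis using True by (simp add: koszul_d_def)
next
  case False
  then show ?thesis using smooth_zero by (simp add: koszul_d_def zero_fun_def)
qed

lemma koszul_d_diff:
  assumes "\<And>ws. \<omega> ws \<in> smooth_funs A" "\<And>ws. \<eta> ws \<in> smooth_funs A"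
  shows "koszul_d A S (\<omega> - \<eta>) = koszul_d A S \<omega> - koszul_d A S \<eta>"
proof (intro ext)
  fix ws x
  show "koszul_d A S (\<omega> - \<eta>) ws x = (koszul_d A S \<omega> - koszul_d A S \<eta>) ws x"
  proof (cases "set ws \<subseteq> S")
    case True
    have "(ws ! i) x ((\<omega> - \<eta>) vs) = (ws ! i) x (\<omega> vs) - (ws ! i) x (\<eta> vs)" if "i < length ws" for i vs
    proof -
      have "ws ! i \<in> vfields A" using True that nth_mem submodule_vfield by blast
      from vf_diff[OF this assms] show ?thesis by (simp add: fun_diff_def)
    qed
    then show ?thesis
      using True by (simp add: koszul_d_def right_diff_distrib sum_subtractf)
  qed (simp add: koszul_d_def)
qed

context
  fixes q \<omega>
  assumes \<omega>: "\<omega> \<in> module_forms A S q"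
begin

lemma mform_smooth: "\<omega> ws \<in> smooth_funs A"
  using \<omega> smooth_zero unfolding module_forms_def by (rule alt_forms_mem)

lemmas mform_junk = alt_forms_junk[OF \<omega>[unfolded module_forms_def]]
lemmas mform_add = alt_forms_add[OF \<omega>[unfolded module_forms_def]]
lemmas mform_smult = alt_forms_smult[OF \<omega>[unfolded module_forms_def]]
lemmas mform_alt = alt_forms_alt[OF \<omega>[unfolded module_forms_def]]
lemmas mform_swap = alt_forms_swap[OF \<omega>[unfolded module_forms_def] submodule_add]

text \<open>Omitting an entry, or replacing two entries by their bracket, shortens a list by exactly
  one, so \<open>\<omega>\<close> is evaluated outside its degree. Vector fields send the zero
  function to 0.\<close>

lemma koszul_d_junk:
  assumes "length ws \<noteq> Suc q"
  shows "koszul_d A S \<omega> ws = 0"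
proof (cases "set ws \<subseteq> S")
  case True
  have "(ws ! i) x (\<omega> (nths ws (-{i}))) = 0" if "i < length ws" for i x
  proof -
    have "\<omega> (nths ws (-{i})) = 0"
      using assms length_nths_remove1[OF that] that by (intro mform_junk) auto
    then show ?thesis
      using True that nth_mem submodule_vfield vf_zero_fun by (metis subsetD)
  qed
  moreover have "\<omega> (bracket A (ws ! i) (ws ! j) # nths ws (-{i, j})) = 0"
    if "i < j" "j < length ws" for i j
    using assms length_nths_remove2[OF that] that by (intro mform_junk) auto
  ultimately show ?thesis by (simp add: koszul_d_def fun_eq_iff)
qed (simp add: koszul_d_def fun_eq_iff)

end

lemma mform1_add:
  assumes "\<omega> \<in> module_forms A S 1" "a \<in> S" "b \<in> S"
  shows "\<omega> [a + b] = \<omega> [a] + \<omega> [b]"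
  using mform_add[OF assms(1), of "[a]" 0 a b] assms by simp

context
  fixes \<omega>
  assumes \<omega>: "\<omega> \<in> module_forms A S 3"
begin

lemma mform3_swap:
  assumes "a \<in> S" "b \<in> S" "c \<in> S"
  shows "\<omega> [b, a, c] = - \<omega> [a, b, c]" "\<omega> [a, c, b] = - \<omega> [a, b, c]"
  using mform_swap[OF \<omega>, of "[a, b, c]" 0 1 b a] mform_swap[OF \<omega>, of "[a, b, c]" 1 2 c b] assms
  by (simp_all add: numeral_eq_Suc)

lemma mform3_add:
  assumes "a \<in> S" "b \<in> S" "c \<in> S" "a' \<in> S"
  shows "\<omega> [a + a', b, c] = \<omega> [a, b, c] + \<omega> [a', b, c]"
    "\<omega> [b, a + a', c] = \<omega> [b, a, c] + \<omega> [b, a', c]"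
    "\<omega> [b, c, a + a'] = \<omega> [b, c, a] + \<omega> [b, c, a']"
  using mform_add[OF \<omega>, of "[a, b, c]" 0 a a'] mform_add[OF \<omega>, of "[b, a, c]" 1 a a']
    mform_add[OF \<omega>, of "[b, c, a]" 2 a a'] assms
  by (simp_all add: numeral_eq_Suc)

end

lemma module_forms_diff:
  assumes "\<omega> \<in> module_forms A S q" "\<eta> \<in> module_forms A S q"
  shows "\<omega> - \<eta> \<in> module_forms A S q"
  using assms unfolding module_forms_def
  by (rule alt_forms_diff) (simp_all add: smooth_diff right_diff_distrib)

lemma module_forms_zero: "0 \<in> module_forms A S q"
  unfolding module_forms_def by (rule alt_forms_zero) (simp_all add: smooth_zero)

end

end

subsection \<open>The Lie derivative of vertical forms\<close>

context ehresmann_fibred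
begin

abbreviation lie :: "'m vfield \<Rightarrow> 'm form \<Rightarrow> 'm form" where "lie \<equiv> lie_vert A B p"

lemma V_submodule: "total.vf_submodule V"
  unfolding total.vf_submodule_def using V_vfield V_add V_smult by blast

lemmas vert_form_smooth = total.mform_smooth[OF V_submodule, folded vert_forms_def]
  and vert_form_junk = total.mform_junk[OF V_submodule, folded vert_forms_def]
  and vert_form_add = total.mform_add[OF V_submodule, folded vert_forms_def]
  and vert_form_smult = total.mform_smult[OF V_submodule, folded vert_forms_def]
  and vert_form_alt = total.mform_alt[OF V_submodule, folded vert_forms_def]
  and vert_form_swap = total.mform_swap[OF V_submodule, folded vert_forms_def]
  and vert_form1_add = total.mform1_add[OF V_submodule, folded vert_forms_def]
  and vert_form3_add = total.mform3_add[OF V_submodule, folded vert_forms_def]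
  and vert_form3_swap = total.mform3_swap[OF V_submodule, folded vert_forms_def]
  and vert_forms_diff = total.module_forms_diff[OF V_submodule, folded vert_forms_def]
  and vert_forms_zero = total.module_forms_zero[OF V_submodule, folded vert_forms_def]
  and vert_d_junk = total.koszul_d_junk[OF V_submodule, folded vert_forms_def vert_d_def]
  and vert_d_smooth = total.koszul_d_smooth[OF V_submodule, folded vert_d_def]
  and vert_d_diff = total.koszul_d_diff[OF V_submodule, folded vert_d_def]

lemma vert_formsI:
  assumes "\<And>ws. length ws = q \<Longrightarrow> set ws \<subseteq> V \<Longrightarrow> \<omega> ws \<in> smooth_funs A"
    and "\<And>ws. \<not> (length ws = q \<and> set ws \<subseteq> V) \<Longrightarrow> \<omega> ws = 0"
    and "\<And>ws i a b. length ws = q \<Longrightarrow> set ws \<subseteq> V \<Longrightarrow> i < q \<Longrightarrow> a \<in> V \<Longrightarrow> b \<in> V \<Longrightarrow>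
        \<omega> (ws[i := a + b]) = \<omega> (ws[i := a]) + \<omega> (ws[i := b])"
    and "\<And>ws i a f. length ws = q \<Longrightarrow> set ws \<subseteq> V \<Longrightarrow> i < q \<Longrightarrow> a \<in> V \<Longrightarrow> f \<in> smooth_funs A \<Longrightarrow>
        \<omega> (ws[i := vf_smult f a]) = f * \<omega> (ws[i := a])"
    and "\<And>ws i j. length ws = q \<Longrightarrow> set ws \<subseteq> V \<Longrightarrow> i < j \<Longrightarrow> j < q \<Longrightarrow> ws ! i = ws ! j \<Longrightarrow> \<omega> ws = 0"
  shows "\<omega> \<in> vert_forms A B p q"
  unfolding vert_forms_def module_forms_def using assms by (rule alt_formsI)

text \<open>The vector fields along which the Lie derivative preserves vertical forms.\<close>

definition projectable :: "'m vfield set" where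
  "projectable = {X \<in> vfields A. \<forall>Y\<in>V. bracket A X Y \<in> V}"

lemma projectable_vfield: "X \<in> projectable \<Longrightarrow> X \<in> vfields A"
  and projectable_bracket: "X \<in> projectable \<Longrightarrow> Y \<in> V \<Longrightarrow> bracket A X Y \<in> V"
  by (simp_all add: projectable_def)

lemma hlift_projectable: "v \<in> vfields B \<Longrightarrow> h v \<in> projectable"
  by (simp add: projectable_def hlift_vfield V_bracket_hlift)

lemma V_projectable: "X \<in> V \<Longrightarrow> X \<in> projectable"
  by (simp add: projectable_def V_vfield V_bracket)

lemma lie_nonvert: "\<not> set ws \<subseteq> V \<Longrightarrow> lie X \<omega> ws = 0"
  by (auto simp: lie_vert_def fun_eq_iff)

lemma lie_vert:
  "set ws \<subseteq> V \<Longrightarrow>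
    lie X \<omega> ws = (\<lambda>x. X x (\<omega> ws) - (\<Sum>j<length ws. \<omega> (ws[j := bracket A X (ws ! j)]) x))"
  by (simp add: lie_vert_def)

lemma lie_smooth:
  assumes X: "X \<in> vfields A" and \<omega>: "\<And>ws. \<omega> ws \<in> smooth_funs A"
  shows "lie X \<omega> ws \<in> smooth_funs A"
proof (cases "set ws \<subseteq> V")
  case True
  show ?thesis
    unfolding lie_vert[OF True]
    using total.smooth_diff[OF total.vf_smooth[OF X \<omega>[of ws]]
        total.smooth_sum[of "{..<length ws}" "\<lambda>j. \<omega> (ws[j := bracket A X (ws ! j)])"]] \<omega>
    by (simp add: fun_diff_def)
qed (simp add: lie_nonvert total.smooth_zero)

lemma lie_diff_right:
  assumes X: "X \<in> vfields A" and "\<And>ws. \<omega> ws \<in> smooth_funs A" "\<And>ws. \<eta> ws \<in> smooth_funs A"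
  shows "lie X (\<omega> - \<eta>) = lie X \<omega> - lie X \<eta>"
proof
  fix ws
  show "lie X (\<omega> - \<eta>) ws = (lie X \<omega> - lie X \<eta>) ws"
  proof (cases "set ws \<subseteq> V")
    case True
    then show ?thesis
      using total.vf_diff[OF X assms(2,3)]
      by (simp add: lie_vert fun_eq_iff sum_subtractf fun_diff_def)
  qed (simp add: lie_nonvert)
qed

context
  fixes q \<omega>
  assumes \<omega>: "\<omega> \<in> vert_forms A B p q"
begin

lemma lie_junk:
  assumes "X \<in> vfields A" "\<not> (length ws = q \<and> set ws \<subseteq> V)"
  shows "lie X \<omega> ws = 0"
proof (cases "set ws \<subseteq> V")
  case True
  then have "\<omega> (ws[j := Y]) = 0" "\<omega> ws = 0" for j Y
    using assms(2) by (auto intro!: vert_form_junk[OF \<omega>])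
  then show ?thesis
    using True total.vf_zero_fun[OF assms(1)] by (intro ext) (simp add: lie_vert)
qed (rule lie_nonvert)

text \<open>The derivative of a coefficient \<open>f\<close> along \<open>X\<close> is cancelled by
  the Leibniz term of the bracket with \<open>vf_smult f a\<close>. Projectability of
  \<open>X\<close> keeps the brackets inside the domain of \<open>\<omega>\<close>.\<close>

lemma lie_vert_form:
  assumes X: "X \<in> projectable"
  shows "lie X \<omega> \<in> vert_forms A B p q"
proof (rule vert_formsI)
  note vX = projectable_vfield[OF X]
  fix ws :: "'m vfield list"
  show "lie X \<omega> ws \<in> smooth_funs A" by (rule lie_smooth[OF vX vert_form_smooth[OF \<omega>]])
  show "lie X \<omega> ws = 0" if "\<not> (length ws = q \<and> set ws \<subseteq> V)" using vX that by (rule lie_junk)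
  assume len: "length ws = q" and ws: "set ws \<subseteq> V"
  have br: "bracket A X (ws ! j) \<in> V" if "j < q" for j
    using projectable_bracket[OF X] ws len that nth_mem by blast
  have upd: "set (ws[i := a]) \<subseteq> V" if "a \<in> V" for i a
    using ws that by (rule set_update_subset)
  \<comment> \<open>\<open>T i a j\<close> is summand \<open>j\<close> of the Lie derivative after
    \<open>a\<close> has been put into slot \<open>i\<close>. For \<open>j = i\<close> the bracket
    acts on the new entry; otherwise the two updates commute.\<close>
  define T where "T i a j = \<omega> ((ws[i := a])[j := bracket A X (ws[i := a] ! j)])" for i a j
  have T: "T i a j = (if j = i then \<omega> (ws[i := bracket A X a])
      else \<omega> ((ws[j := bracket A X (ws ! j)])[i := a]))" if "i < q" "j < q" for i a j
    using that len by (simp add: T_def list_update_swap)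
  have lie: "lie X \<omega> (ws[i := a]) = (\<lambda>x. X x (\<omega> (ws[i := a])) - (\<Sum>j<q. T i a j x))"
    if "a \<in> V" for i a
    using lie_vert[OF upd[OF that]] len by (simp add: T_def)
  {
    fix i a b assume i: "i < q" and a: "a \<in> V" and b: "b \<in> V"
    have "T i (a + b) j = T i a j + T i b j" if "j < q" for j
      using i that len ws a b br[OF that] projectable_bracket[OF X] V_vfield
      by (simp add: T vert_form_add[OF \<omega>] set_update_subset total.bracket_add_right[OF vX])
    then show "lie X \<omega> (ws[i := a + b]) = lie X \<omega> (ws[i := a]) + lie X \<omega> (ws[i := b])"
      using total.vf_plus[OF vX vert_form_smooth[OF \<omega>] vert_form_smooth[OF \<omega>]]
      by (intro ext) (simp add: lie a b V_add sum.distrib vert_form_add[OF \<omega> len ws i a b])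
  next
    fix i a f assume i: "i < q" and a: "a \<in> V" and f: "f \<in> smooth_funs A"
    have Tf: "T i (vf_smult f a) j x
        = f x * T i a j x + (if j = i then X x f * \<omega> (ws[i := a]) x else 0)" if "j < q" for j x
    proof (cases "j = i")
      case True
      have "\<omega> (ws[i := bracket A X (vf_smult f a)]) =
          \<omega> (ws[i := vf_smult f (bracket A X a)]) + \<omega> (ws[i := vf_smult (\<lambda>x. X x f) a])"
        unfolding total.bracket_smult_right[OF vX V_vfield[OF a] f]
        by (intro vert_form_add[OF \<omega>] len ws i V_smult projectable_bracket X a f
            total.vf_smooth[OF vX])
      then show ?thesis
        using i True vert_form_smult[OF \<omega> len ws i projectable_bracket[OF X a] f]
          vert_form_smult[OF \<omega> len ws i a total.vf_smooth[OF vX f]]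
        by (simp add: T)
    next
      case False
      then show ?thesis
        using i that vert_form_smult[OF \<omega> _ set_update_subset[OF ws br[OF that]] i a f, of j] len
        by (simp add: T)
    qed
    show "lie X \<omega> (ws[i := vf_smult f a]) = f * lie X \<omega> (ws[i := a])"
    proof
      fix x
      have "X x (\<omega> (ws[i := vf_smult f a])) = f x * X x (\<omega> (ws[i := a])) + \<omega> (ws[i := a]) x * X x f"
        using total.vf_mult[OF vX f vert_form_smooth[OF \<omega>], of x]
        by (simp add: vert_form_smult[OF \<omega> len ws i a f] times_fun_def)
      then show "lie X \<omega> (ws[i := vf_smult f a]) x = (f * lie X \<omega> (ws[i := a])) x"
        using i by (simp add: lie a V_smult[OF f a] Tf sum.distrib flip: sum_distrib_left)
          (simp add: algebra_simps)
    qed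
  next
    fix i j assume ij: "i < j" "j < q" and eq: "ws ! i = ws ! j"
    \<comment> \<open>Of the bracket terms only those in slots \<open>i\<close> and \<open>j\<close>
      can survive, and these two cancel by antisymmetry.\<close>
    have zero: "\<omega> (ws[l := bracket A X (ws ! l)]) = 0" if "l < q" "l \<noteq> i" "l \<noteq> j" for l
      using that ij eq len by (intro vert_form_alt[OF \<omega> _ upd[OF br[OF that(1)]] ij]) simp_all
    have mem: "ws ! j \<in> V" using ws len ij(2) nth_mem by blast
    have "\<omega> (ws[i := bracket A X (ws ! j), j := ws ! j])
        = - \<omega> (ws[i := ws ! j, j := bracket A X (ws ! j)])"
      using vert_form_swap[OF \<omega> _ _ len ws ij br[OF ij(2)] mem] .
    then have pair: "\<omega> (ws[i := bracket A X (ws ! i)]) = - \<omega> (ws[j := bracket A X (ws ! j)])"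
      using ij by (simp add: eq list_update_swap[of i j] flip: eq)
        (metis eq list_update_id)
    have "(\<Sum>l<q. \<omega> (ws[l := bracket A X (ws ! l)]) x)
        = (\<Sum>l\<in>{i, j}. \<omega> (ws[l := bracket A X (ws ! l)]) x)" for x
      using ij zero by (intro sum.mono_neutral_right) auto
    then show "lie X \<omega> ws = 0"
      using ij pair total.vf_zero_fun[OF vX]
      by (simp add: lie_vert[OF ws] fun_eq_iff len vert_form_alt[OF \<omega> len ws ij eq])
  }
qed

lemma lie_add_left:
  assumes X: "X \<in> projectable" and Y: "Y \<in> projectable"
  shows "lie (X + Y) \<omega> = lie X \<omega> + lie Y \<omega>"
proof
  fix ws
  note v = projectable_vfield[OF X] projectable_vfield[OF Y]
  show "lie (X + Y) \<omega> ws = (lie X \<omega> + lie Y \<omega>) ws"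
  proof (cases "length ws = q \<and> set ws \<subseteq> V")
    case True
    then have "ws ! j \<in> V" if "j < q" for j using that nth_mem by blast
    then have "\<omega> (ws[j := bracket A (X + Y) (ws ! j)])
        = \<omega> (ws[j := bracket A X (ws ! j)]) + \<omega> (ws[j := bracket A Y (ws ! j)])" if "j < q" for j
      using True that X Y
      by (simp add: total.bracket_add_left[OF v] V_vfield projectable_bracket vert_form_add[OF \<omega>])
    then show ?thesis using True by (simp add: lie_vert fun_eq_iff sum.distrib)
  next
    case False
    then show ?thesis using v by (simp add: lie_junk total.vfields_add)
  qed
qed

text \<open>The terms that spoil linearity contain derivatives of \<open>f\<close> along vertical
  fields only. The hypothesis \<open>fV\<close> removes them; it holds for functions pulled back
  from the base.\<close>

lemma lie_smult_left:
  assumes X: "X \<in> projectable" and f: "f \<in> smooth_funs A" and fV: "\<And>a x. a \<in> V \<Longrightarrow> a x f = 0"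
  shows "lie (vf_smult f X) \<omega> = (\<lambda>ws. f * lie X \<omega> ws)"
proof
  fix ws
  note v = projectable_vfield[OF X]
  show "lie (vf_smult f X) \<omega> ws = f * lie X \<omega> ws"
  proof (cases "length ws = q \<and> set ws \<subseteq> V")
    case True
    then have "ws ! j \<in> V" if "j < q" for j using that nth_mem by blast
    moreover have "bracket A (vf_smult f X) a = vf_smult f (bracket A X a)" if "a \<in> V" for a
      using total.bracket_smult_left[OF v V_vfield[OF that] f] fV[OF that]
      by (simp add: vf_smult_def fun_eq_iff)
    ultimately have "\<omega> (ws[j := bracket A (vf_smult f X) (ws ! j)])
        = f * \<omega> (ws[j := bracket A X (ws ! j)])" if "j < q" for j
      using True that X f by (simp add: projectable_bracket vert_form_smult[OF \<omega>])
    then show ?thesis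
      using True
      by (simp add: lie_vert fun_eq_iff right_diff_distrib sum_distrib_left vf_smult_def)
  next
    case False
    then show ?thesis using v f by (simp add: lie_junk total.vfields_smult)
  qed
qed

lemma lie_smult_right:
  assumes X: "X \<in> vfields A" and f: "f \<in> smooth_funs A"
  shows "lie X (\<lambda>ws. f * \<omega> ws) = (\<lambda>ws. f * lie X \<omega> ws + (\<lambda>x. X x f) * \<omega> ws)"
proof
  fix ws
  show "lie X (\<lambda>ws. f * \<omega> ws) ws = f * lie X \<omega> ws + (\<lambda>x. X x f) * \<omega> ws"
  proof (cases "set ws \<subseteq> V")
    case True
    then show ?thesis
      using total.vf_mult[OF X f vert_form_smooth[OF \<omega>], of _ ws]
      by (simp add: lie_vert fun_eq_iff times_fun_def right_diff_distrib sum_distrib_left)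
  next
    case False
    then show ?thesis by (simp add: lie_nonvert vert_form_junk[OF \<omega>])
  qed
qed

end

end

subsection \<open>Cartan calculus\<close>

context ehresmann_fibred
begin

lemma lie_1: "a \<in> V \<Longrightarrow> lie X \<omega> [a] = (\<lambda>x. X x (\<omega> [a]) - \<omega> [bracket A X a] x)"
  by (simp add: lie_vert)

lemma lie_2:
  "a \<in> V \<Longrightarrow> b \<in> V \<Longrightarrow> lie X \<omega> [a, b] x
    = X x (\<omega> [a, b]) - \<omega> [bracket A X a, b] x - \<omega> [a, bracket A X b] x"
  by (simp add: lie_vert lessThan_Suc)

lemma lie_3:
  "a \<in> V \<Longrightarrow> b \<in> V \<Longrightarrow> c \<in> V \<Longrightarrow> lie X \<omega> [a, b, c] x
    = X x (\<omega> [a, b, c]) - \<omega> [bracket A X a, b, c] x - \<omega> [a, bracket A X b, c] x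
      - \<omega> [a, b, bracket A X c] x"
  by (simp add: lie_vert lessThan_Suc)

lemma vert_d_nonvert: "\<not> set ws \<subseteq> V \<Longrightarrow> vert_d A B p \<omega> ws = 0"
  unfolding vert_d_def koszul_d_def by (auto simp: fun_eq_iff)

lemmas vert_d_1 = total.koszul_d_1[where S = V, folded vert_d_def]
  and vert_d_2 = total.koszul_d_2[where S = V, folded vert_d_def]
  and vert_d_3 = total.koszul_d_3[where S = V, folded vert_d_def]

text \<open>On pairs the second derivatives combine by the definition of the bracket, and the
  remaining terms by the Jacobi identity. Degree 1 is the one that governs boundaries of vertical
  degree 2.\<close>

lemma vert_d_lie:
  assumes \<omega>: "\<omega> \<in> vert_forms A B p 1" and X: "X \<in> projectable"
  shows "vert_d A B p (lie X \<omega>) = lie X (vert_d A B p \<omega>)"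
proof
  fix ws
  note vX = projectable_vfield[OF X] and s = vert_form_smooth[OF \<omega>]
  consider "\<not> set ws \<subseteq> V" | "set ws \<subseteq> V" "length ws \<noteq> 2"
    | a b where "ws = [a, b]" "a \<in> V" "b \<in> V"
    by (cases ws; cases "tl ws"; cases "tl (tl ws)") auto
  then show "vert_d A B p (lie X \<omega>) ws = lie X (vert_d A B p \<omega>) ws"
  proof cases
    case 1
    then show ?thesis by (simp add: vert_d_nonvert lie_nonvert)
  next
    case 2
    then have "vert_d A B p \<omega> vs = 0" if "length vs = length ws" for vs
      using that by (intro vert_d_junk[OF \<omega>]) simp
    then have "lie X (vert_d A B p \<omega>) ws = 0"
      using 2 total.vf_zero_fun[OF vX] by (intro ext) (simp add: lie_vert)
    then show ?thesis
      using 2 vert_d_junk[OF lie_vert_form[OF \<omega> X]] by simp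
  next
    case (3 a b)
    note a = 3(2) and b = 3(3)
    note va = V_vfield[OF a] and vb = V_vfield[OF b]
    note br = V_bracket[OF a b] projectable_bracket[OF X a] projectable_bracket[OF X b]
    note sv = total.vf_smooth[OF _ s]
    show ?thesis
      unfolding 3(1)
    proof
      fix x
      have jac: "\<omega> [bracket A X (bracket A a b)]
          = \<omega> [bracket A (bracket A X a) b] + \<omega> [bracket A a (bracket A X b)]"
        unfolding total.jacobi[OF vX va vb]
        by (intro vert_form1_add[OF \<omega>] V_bracket a b br)
      have "vert_d A B p (lie X \<omega>) [a, b] x
          = (a x (\<lambda>y. X y (\<omega> [b])) - a x (\<omega> [bracket A X b]))
          - (b x (\<lambda>y. X y (\<omega> [a])) - b x (\<omega> [bracket A X a]))
          - (X x (\<omega> [bracket A a b]) - \<omega> [bracket A X (bracket A a b)] x)"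
        by (simp add: vert_d_1 a b lie_1 br total.vf_diff[OF va sv[OF vX] s]
            total.vf_diff[OF vb sv[OF vX] s])
      moreover have "lie X (vert_d A B p \<omega>) [a, b] x
          = (X x (\<lambda>y. a y (\<omega> [b])) - X x (\<lambda>y. b y (\<omega> [a])) - X x (\<omega> [bracket A a b]))
          - ((X x (\<lambda>y. a y (\<omega> [b])) - a x (\<lambda>y. X y (\<omega> [b]))) - b x (\<omega> [bracket A X a])
            - \<omega> [bracket A (bracket A X a) b] x)
          - (a x (\<omega> [bracket A X b]) - (X x (\<lambda>y. b y (\<omega> [a])) - b x (\<lambda>y. X y (\<omega> [a])))
            - \<omega> [bracket A a (bracket A X b)] x)"
        using total.vf_diff[OF vX total.smooth_diff[OF sv[OF va] sv[OF vb], of "[b]" "[a]"]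
            s[of "[bracket A a b]"], of x]
          total.vf_diff[OF vX sv[OF va, of "[b]"] sv[OF vb, of "[a]"], of x]
        by (simp add: lie_2 vert_d_1 a b br total.bracket_apply[OF s] fun_diff_def)
      ultimately show "vert_d A B p (lie X \<omega>) [a, b] x = lie X (vert_d A B p \<omega>) [a, b] x"
        by (simp add: jac)
    qed
  qed
qed

lemma contraction_vert_form:
  assumes \<omega>: "\<omega> \<in> vert_forms A B p (Suc q)" and X: "X \<in> V"
  shows "contraction X \<omega> \<in> vert_forms A B p q"
  unfolding contraction_def
proof (rule vert_formsI)
  fix ws :: "'m vfield list"
  show "\<omega> (X # ws) \<in> smooth_funs A" by (rule vert_form_smooth[OF \<omega>])
  show "\<omega> (X # ws) = 0" if "\<not> (length ws = q \<and> set ws \<subseteq> V)"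
    using that by (intro vert_form_junk[OF \<omega>]) simp
  assume ws: "length ws = q" "set ws \<subseteq> V"
  then have Xws: "length (X # ws) = Suc q" "set (X # ws) \<subseteq> V" using X by simp_all
  show "\<omega> (X # ws[i := a + b]) = \<omega> (X # ws[i := a]) + \<omega> (X # ws[i := b])"
    if "i < q" "a \<in> V" "b \<in> V" for i a b
    using vert_form_add[OF \<omega> Xws, of "Suc i" a b] that by simp
  show "\<omega> (X # ws[i := vf_smult f a]) = f * \<omega> (X # ws[i := a])"
    if "i < q" "a \<in> V" "f \<in> smooth_funs A" for i a f
    using vert_form_smult[OF \<omega> Xws, of "Suc i" a f] that by simp
  show "\<omega> (X # ws) = 0" if "i < j" "j < q" "ws ! i = ws ! j" for i j
    using vert_form_alt[OF \<omega> Xws, of "Suc i" "Suc j"] that by simp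
qed

text \<open>The Leibniz rule
  \<open>L_X (i_Y \<omega>) = i_[X,Y] \<omega> + i_Y (L_X \<omega>)\<close>, whose last term is 0 by
  invariance.\<close>

lemma lie_contraction:
  assumes \<omega>: "\<omega> \<in> vert_forms A B p (Suc q)" and X: "X \<in> projectable" and Y: "Y \<in> V"
    and L: "lie X \<omega> = 0"
  shows "lie X (contraction Y \<omega>) = contraction (bracket A X Y) \<omega>"
proof
  fix ws
  show "lie X (contraction Y \<omega>) ws = contraction (bracket A X Y) \<omega> ws"
  proof (cases "set ws \<subseteq> V")
    case True
    then have "lie X \<omega> (Y # ws) = (\<lambda>x. X x (\<omega> (Y # ws)) - (\<omega> (bracket A X Y # ws) x
        + (\<Sum>j<length ws. \<omega> (Y # ws[j := bracket A X (ws ! j)]) x)))"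
      using Y by (simp add: lie_vert sum.lessThan_Suc_shift del: sum.lessThan_Suc)
    then show ?thesis
      using True L by (simp add: lie_vert contraction_def fun_eq_iff algebra_simps)
  next
    case False
    then show ?thesis
      by (simp add: lie_nonvert contraction_def vert_form_junk[OF \<omega>])
  qed
qed

context
  fixes \<omega>
  assumes \<omega>: "\<omega> \<in> vert_forms A B p 3"
begin

text \<open>An instance of \<open>L_[X,Y] = [L_X, L_Y]\<close>. Invariance is used twice to replace
  derivatives of \<open>\<omega>\<close> by values on brackets; the mixed terms cancel in the
  commutator and the Jacobi identity settles the double brackets.\<close>

lemma lie_bracket_invariant:
  assumes X: "X \<in> projectable" and Y: "Y \<in> projectable" and XY: "bracket A X Y \<in> projectable"
    and LX: "lie X \<omega> = 0" and LY: "lie Y \<omega> = 0"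
  shows "lie (bracket A X Y) \<omega> = 0"
proof
  fix ws
  note vX = projectable_vfield[OF X] and vY = projectable_vfield[OF Y] and s = vert_form_smooth[OF \<omega>]
  show "lie (bracket A X Y) \<omega> ws = 0 ws"
  proof (cases "length ws = 3 \<and> set ws \<subseteq> V")
    case True
    then obtain a b c where ws: "ws = [a, b, c]" and abc: "a \<in> V" "b \<in> V" "c \<in> V"
      by (auto simp: numeral_eq_Suc length_Suc_conv)
    have inv: "Z x (\<omega> [a, b, c]) = \<omega> [bracket A Z a, b, c] x + \<omega> [a, bracket A Z b, c] x
        + \<omega> [a, b, bracket A Z c] x"
      if "lie Z \<omega> = 0" "a \<in> V" "b \<in> V" "c \<in> V" for Z a b c x
      using lie_3[OF that(2-4), of Z \<omega> x] by (simp add: that(1))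
    have iter: "W x (\<lambda>y. Z y (\<omega> [a, b, c])) = W x (\<omega> [bracket A Z a, b, c])
        + W x (\<omega> [a, bracket A Z b, c]) + W x (\<omega> [a, b, bracket A Z c])"
      if "lie Z \<omega> = 0" "W \<in> vfields A" for W Z x
    proof -
      have "(\<lambda>y. Z y (\<omega> [a, b, c])) = \<omega> [bracket A Z a, b, c] + \<omega> [a, bracket A Z b, c]
          + \<omega> [a, b, bracket A Z c]"
        using inv[OF that(1) abc] by (simp add: fun_eq_iff)
      then show ?thesis
        by (simp add: total.vf_plus[OF that(2)] s total.smooth_add)
    qed
    note brX = projectable_bracket[OF X] and brY = projectable_bracket[OF Y]
      and brXY = projectable_bracket[OF XY]
    have jac: "\<omega> [bracket A X (bracket A Y a), b, c] = \<omega> [bracket A (bracket A X Y) a, b, c]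
          + \<omega> [bracket A Y (bracket A X a), b, c]"
        "\<omega> [a, bracket A X (bracket A Y b), c] = \<omega> [a, bracket A (bracket A X Y) b, c]
          + \<omega> [a, bracket A Y (bracket A X b), c]"
        "\<omega> [a, b, bracket A X (bracket A Y c)] = \<omega> [a, b, bracket A (bracket A X Y) c]
          + \<omega> [a, b, bracket A Y (bracket A X c)]"
      by (simp_all only: total.jacobi[OF vX vY V_vfield] vert_form3_add[OF \<omega>] abc brX brY brXY)
    show ?thesis
      unfolding ws
    proof
      fix x
      show "lie (bracket A X Y) \<omega> [a, b, c] x = 0 [a, b, c] x"
        by (simp add: lie_3 abc total.bracket_apply[OF s] iter[OF LX vY] iter[OF LY vX])
          (simp add: inv[OF LX] inv[OF LY] abc brX brY jac)
    qed
  next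
    case False
    then show ?thesis using lie_junk[OF \<omega> projectable_vfield[OF XY]] by simp
  qed
qed

text \<open>Once the arguments of the bracket terms are sorted, Koszul's formula for
  \<open>\<omega>\<close> on \<open>[X, a, b, c]\<close> is the Lie derivative along
  \<open>X\<close> on \<open>[a, b, c]\<close> minus Koszul's formula for the contraction.\<close>

lemma vert_d_contraction:
  assumes X: "X \<in> V" and d: "vert_d A B p \<omega> = 0" and L: "lie X \<omega> = 0"
  shows "vert_d A B p (contraction X \<omega>) = 0"
proof
  fix ws
  have \<eta>: "contraction X \<omega> \<in> vert_forms A B p 2"
    using contraction_vert_form[of \<omega> 2 X] \<omega> X by simp
  show "vert_d A B p (contraction X \<omega>) ws = 0 ws"
  proof (cases "length ws = 3 \<and> set ws \<subseteq> V")
    case True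
    then obtain a b c where ws: "ws = [a, b, c]" and abc: "a \<in> V" "b \<in> V" "c \<in> V"
      by (auto simp: numeral_eq_Suc length_Suc_conv)
    note br = V_bracket[OF X] V_bracket abc X
    note swap = vert_form3_swap[OF \<omega>]
    show ?thesis
      unfolding ws
    proof
      fix x
      have "\<omega> [bracket A X b, a, c] = - \<omega> [a, bracket A X b, c]"
        "\<omega> [bracket A X c, a, b] = \<omega> [a, b, bracket A X c]"
        "\<omega> [bracket A a b, X, c] = - \<omega> [X, bracket A a b, c]"
        "\<omega> [bracket A a c, X, b] = - \<omega> [X, bracket A a c, b]"
        "\<omega> [bracket A b c, X, a] = - \<omega> [X, bracket A b c, a]"
        using swap(1)[of a "bracket A X b" c] swap(1)[of a "bracket A X c" b]
          swap(2)[of a "bracket A X c" b] swap(1)[of X "bracket A a b" c]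
          swap(1)[of X "bracket A a c" b] swap(1)[of X "bracket A b c" a] br
        by simp_all
      with fun_cong[OF fun_cong[OF d], of "[X, a, b, c]" x]
        fun_cong[OF fun_cong[OF L], of "[a, b, c]" x]
      show "vert_d A B p (contraction X \<omega>) [a, b, c] x = 0 [a, b, c] x"
        by (simp add: vert_d_2 vert_d_3 lie_3 contraction_def abc X)
    qed
  next
    case False
    then show ?thesis
      using vert_d_junk[OF \<eta>, of ws] vert_d_nonvert[of ws "contraction X \<omega>"] by fastforce
  qed
qed

end

end

subsection \<open>Bigraded forms\<close>

context ehresmann_fibred
begin

abbreviation D_V :: "('b, 'm) biform \<Rightarrow> ('b, 'm) biform" where "D_V \<equiv> dV A B p"
abbreviation D_H :: "('b, 'm) biform \<Rightarrow> ('b, 'm) biform" where "D_H \<equiv> dH A B p Hor"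

lemma lie_zero:
  assumes "X \<in> vfields A"
  shows "lie X 0 = 0"
  using lie_diff_right[OF assms, of 0 0] total.smooth_zero by simp

lemma lie_uminus_right:
  assumes "X \<in> vfields A" "\<And>ws. \<omega> ws \<in> smooth_funs A"
  shows "lie X (- \<omega>) = - lie X \<omega>"
  using lie_diff_right[OF assms(1), of 0 \<omega>] lie_zero[OF assms(1)] assms(2) total.smooth_zero by simp

lemma vert_d_zero: "vert_d A B p 0 = 0"
  using vert_d_diff[of 0 0] total.smooth_zero by simp

lemma vert_d_uminus:
  assumes "\<And>ws. \<omega> ws \<in> smooth_funs A"
  shows "vert_d A B p (- \<omega>) = - vert_d A B p \<omega>"
  using vert_d_diff[of 0 \<omega>] assms total.smooth_zero vert_d_zero by simp

context
  fixes k q \<Theta>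
  assumes \<Theta>: "\<Theta> \<in> biforms A B p k q"
begin

lemma biform_form: "\<Theta> vs \<in> vert_forms A B p q"
  using \<Theta> vert_forms_zero unfolding biforms_def by (rule alt_forms_mem)

lemma biform_smooth: "\<Theta> vs ws \<in> smooth_funs A"
  by (rule vert_form_smooth[OF biform_form])

lemmas biform_junk = alt_forms_junk[OF \<Theta>[unfolded biforms_def]]
lemmas biform_add = alt_forms_add[OF \<Theta>[unfolded biforms_def]]
lemmas biform_smult = alt_forms_smult[OF \<Theta>[unfolded biforms_def]]
lemmas biform_swap = alt_forms_swap[OF \<Theta>[unfolded biforms_def] base.vfields_add]

lemma biform_uminus:
  assumes "length vs = k" "set vs \<subseteq> vfields B" "i < k" "v \<in> vfields B"
  shows "\<Theta> (vs[i := - v]) = - \<Theta> (vs[i := v])"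
proof -
  have "vf_smult (\<lambda>x. - 1) v = - v" by (simp add: vf_smult_def fun_eq_iff)
  then have "\<Theta> (vs[i := - v]) = (\<lambda>ws. ((\<lambda>x. - 1) \<circ> p) * \<Theta> (vs[i := v]) ws)"
    using biform_smult[OF assms base.const_smooth[of "-1"]] by simp
  then show ?thesis by (simp add: fun_eq_iff)
qed

end

lemma biforms_diff:
  assumes "\<Theta> \<in> biforms A B p k q" "\<Xi> \<in> biforms A B p k q"
  shows "\<Theta> - \<Xi> \<in> biforms A B p k q"
  using assms unfolding biforms_def
  by (rule alt_forms_diff) (simp_all add: vert_forms_diff fun_eq_iff right_diff_distrib)

lemma biforms_zero: "0 \<in> biforms A B p k q"
  unfolding biforms_def by (rule alt_forms_zero) (simp_all add: vert_forms_zero fun_eq_iff)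

lemma
  assumes \<Theta>: "\<Theta> \<in> biforms A B p 1 q" and u: "u \<in> vfields B"
  shows biform1_add: "v \<in> vfields B \<Longrightarrow> \<Theta> [u + v] = \<Theta> [u] + \<Theta> [v]"
    and biform1_smult: "f \<in> smooth_funs B \<Longrightarrow> \<Theta> [vf_smult f u] = (\<lambda>ws. (f \<circ> p) * \<Theta> [u] ws)"
    and biform1_uminus: "\<Theta> [- u] = - \<Theta> [u]"
  using biform_add[OF \<Theta>, of "[u]" 0 u v] biform_smult[OF \<Theta>, of "[u]" 0 u f]
    biform_uminus[OF \<Theta>, of "[u]" 0 u] u
  by simp_all

lemma
  assumes \<Theta>: "\<Theta> \<in> biforms A B p 2 q" and u: "u \<in> vfields B" and w: "w \<in> vfields B"
  shows biform2_add: "v \<in> vfields B \<Longrightarrow> \<Theta> [u + v, w] = \<Theta> [u, w] + \<Theta> [v, w]"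
    and biform2_smult: "f \<in> smooth_funs B \<Longrightarrow>
      \<Theta> [vf_smult f u, w] = (\<lambda>ws. (f \<circ> p) * \<Theta> [u, w] ws)"
    and biform2_uminus: "\<Theta> [- u, w] = - \<Theta> [u, w]"
    and biform2_swap: "\<Theta> [w, u] = - \<Theta> [u, w]"
  using biform_add[OF \<Theta>, of "[u, w]" 0 u v] biform_smult[OF \<Theta>, of "[u, w]" 0 u f]
    biform_uminus[OF \<Theta>, of "[u, w]" 0 u] biform_swap[OF \<Theta>, of "[u, w]" 0 1 w u] u w
  by simp_all

text \<open>Antisymmetric tuples need linearity only in the first argument.\<close>

lemma biforms2I:
  assumes form: "\<And>u v. u \<in> vfields B \<Longrightarrow> v \<in> vfields B \<Longrightarrow> \<Theta> [u, v] \<in> vert_forms A B p q"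
    and junk: "\<And>vs. \<not> (length vs = 2 \<and> set vs \<subseteq> vfields B) \<Longrightarrow> \<Theta> vs = 0"
    and add: "\<And>u u' v. u \<in> vfields B \<Longrightarrow> u' \<in> vfields B \<Longrightarrow> v \<in> vfields B \<Longrightarrow>
      \<Theta> [u + u', v] = \<Theta> [u, v] + \<Theta> [u', v]"
    and smult: "\<And>u v f. u \<in> vfields B \<Longrightarrow> v \<in> vfields B \<Longrightarrow> f \<in> smooth_funs B \<Longrightarrow>
      \<Theta> [vf_smult f u, v] = (\<lambda>ws. (f \<circ> p) * \<Theta> [u, v] ws)"
    and swap: "\<And>u v. u \<in> vfields B \<Longrightarrow> v \<in> vfields B \<Longrightarrow> \<Theta> [v, u] = - \<Theta> [u, v]"
  shows "\<Theta> \<in> biforms A B p 2 q"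
  unfolding biforms_def
proof (rule alt_formsI)
  fix vs :: "'b vfield list"
  show "\<Theta> vs = 0" if "\<not> (length vs = 2 \<and> set vs \<subseteq> vfields B)" using that by (rule junk)
  assume "length vs = 2" "set vs \<subseteq> vfields B"
  then obtain u v where vs: "vs = [u, v]" and uv: "u \<in> vfields B" "v \<in> vfields B"
    by (rule length2_cases)
  show "\<Theta> vs \<in> vert_forms A B p q" using form uv vs by simp
  show "\<Theta> (vs[i := a + b]) = \<Theta> (vs[i := a]) + \<Theta> (vs[i := b])"
    if "i < 2" "a \<in> vfields B" "b \<in> vfields B" for i a b
    using that uv add[OF that(2,3)] swap[of _ u]
    by (auto simp: vs less_2_cases_iff base.vfields_add)
  show "\<Theta> (vs[i := vf_smult f a]) = (\<lambda>ws. (f \<circ> p) * \<Theta> (vs[i := a]) ws)"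
    if "i < 2" "a \<in> vfields B" "f \<in> smooth_funs B" for i a f
    using that uv smult[OF that(2) _ that(3)] swap[of _ u]
    by (auto simp: vs less_2_cases_iff base.vfields_smult fun_eq_iff)
  show "\<Theta> vs = 0" if "i < j" "j < 2" "vs ! i = vs ! j" for i j
    using that swap[OF uv] antisym_zero[of "\<Theta> [u, v]"] by (auto simp: vs less_2_cases_iff)
qed

lemma biforms3I:
  assumes form: "\<And>u v w. u \<in> vfields B \<Longrightarrow> v \<in> vfields B \<Longrightarrow> w \<in> vfields B \<Longrightarrow>
      \<Theta> [u, v, w] \<in> vert_forms A B p q"
    and junk: "\<And>vs. \<not> (length vs = 3 \<and> set vs \<subseteq> vfields B) \<Longrightarrow> \<Theta> vs = 0"
    and add: "\<And>u u' v w. u \<in> vfields B \<Longrightarrow> u' \<in> vfields B \<Longrightarrow> v \<in> vfields B \<Longrightarrow> w \<in> vfields B \<Longrightarrow>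
      \<Theta> [u + u', v, w] = \<Theta> [u, v, w] + \<Theta> [u', v, w]"
    and smult: "\<And>u v w f. u \<in> vfields B \<Longrightarrow> v \<in> vfields B \<Longrightarrow> w \<in> vfields B \<Longrightarrow> f \<in> smooth_funs B \<Longrightarrow>
      \<Theta> [vf_smult f u, v, w] = (\<lambda>ws. (f \<circ> p) * \<Theta> [u, v, w] ws)"
    and swap1: "\<And>u v w. u \<in> vfields B \<Longrightarrow> v \<in> vfields B \<Longrightarrow> w \<in> vfields B \<Longrightarrow>
      \<Theta> [v, u, w] = - \<Theta> [u, v, w]"
    and swap2: "\<And>u v w. u \<in> vfields B \<Longrightarrow> v \<in> vfields B \<Longrightarrow> w \<in> vfields B \<Longrightarrow>
      \<Theta> [u, w, v] = - \<Theta> [u, v, w]"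
  shows "\<Theta> \<in> biforms A B p 3 q"
  unfolding biforms_def
proof (rule alt_formsI)
  \<comment> \<open>Cyclic invariance brings the last slot to the front, where linearity is
    assumed.\<close>
  have cyc: "\<Theta> [u, v, w] = \<Theta> [w, u, v]" if "u \<in> vfields B" "v \<in> vfields B" "w \<in> vfields B" for u v w
    using swap1[of u w v] swap2[of u w v] that by simp
  fix vs :: "'b vfield list"
  show "\<Theta> vs = 0" if "\<not> (length vs = 3 \<and> set vs \<subseteq> vfields B)" using that by (rule junk)
  assume "length vs = 3" "set vs \<subseteq> vfields B"
  then obtain u v w where vs: "vs = [u, v, w]"
    and uvw: "u \<in> vfields B" "v \<in> vfields B" "w \<in> vfields B"
    by (rule length3_cases)
  have less3: "i < 3 \<longleftrightarrow> i = 0 \<or> i = 1 \<or> i = 2" for i :: nat by auto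
  have slot: "\<Theta> [u, a, w] = - \<Theta> [a, u, w]" "\<Theta> [u, v, a] = \<Theta> [a, u, v]" if "a \<in> vfields B" for a
    using that uvw swap1[of a u w] cyc[of u v a] by simp_all
  show "\<Theta> vs \<in> vert_forms A B p q" using form uvw vs by simp
  show "\<Theta> (vs[i := a + b]) = \<Theta> (vs[i := a]) + \<Theta> (vs[i := b])"
    if i: "i < 3" and a: "a \<in> vfields B" and b: "b \<in> vfields B" for i a b
    using i add[OF a b] uvw
    unfolding less3 by (elim disjE) (simp_all add: vs slot a b base.vfields_add)
  show "\<Theta> (vs[i := vf_smult f a]) = (\<lambda>ws. (f \<circ> p) * \<Theta> (vs[i := a]) ws)"
    if i: "i < 3" and a: "a \<in> vfields B" and f: "f \<in> smooth_funs B" for i a f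
    using i smult[OF a _ _ f] uvw
    unfolding less3 by (elim disjE) (simp_all add: vs slot a f base.vfields_smult fun_eq_iff)
  show "\<Theta> vs = 0" if ij: "i < j" "j < 3" and eq: "vs ! i = vs ! j" for i j
  proof -
    have "i = 0 \<and> j = 1 \<or> i = 0 \<and> j = 2 \<or> i = 1 \<and> j = 2" using ij by linarith
    then consider "u = v" | "v = w" | "u = w" using eq vs by auto
    then show ?thesis
    proof cases
      case 1
      then show ?thesis using swap1[of u u w] uvw antisym_zero[of "\<Theta> [u, u, w]"] by (simp add: vs)
    next
      case 2
      then show ?thesis using swap2[of u v v] uvw antisym_zero[of "\<Theta> [u, v, v]"] by (simp add: vs)
    next
      case 3
      then show ?thesis
        using swap1[of u u v] cyc[of u v u] uvw antisym_zero[of "\<Theta> [u, u, v]"] by (simp add: vs)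
    qed
  qed
qed


subsection \<open>The horizontal differential\<close>

lemma dH_0: "u \<in> vfields B \<Longrightarrow> D_H \<Theta> [u] = lie (h u) (\<Theta> [])"
  by (simp add: dH_def nths_Cons fun_eq_iff)

lemma dH_1:
  "u \<in> vfields B \<Longrightarrow> v \<in> vfields B \<Longrightarrow>
    D_H \<Theta> [u, v] = lie (h u) (\<Theta> [v]) - lie (h v) (\<Theta> [u]) - \<Theta> [bracket B u v]"
  by (simp add: dH_def nths_Cons lessThan_Suc fun_eq_iff)

lemma dH_2:
  "u \<in> vfields B \<Longrightarrow> v \<in> vfields B \<Longrightarrow> w \<in> vfields B \<Longrightarrow>
    D_H \<Theta> [u, v, w] = lie (h u) (\<Theta> [v, w]) - lie (h v) (\<Theta> [u, w]) + lie (h w) (\<Theta> [u, v])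
      - \<Theta> [bracket B u v, w] + \<Theta> [bracket B u w, v] - \<Theta> [bracket B v w, u]"
  by (simp add: dH_def nths_Cons lessThan_Suc fun_eq_iff)

text \<open>Only vanishing on wrong lengths is asked of \<open>\<Theta>\<close>, so that the lemma
  applies to \<open>D_V \<Theta>\<close> as well as to biforms.\<close>

lemma dH_junk:
  assumes "\<And>vs. length vs \<noteq> k \<Longrightarrow> \<Theta> vs = 0" "\<not> (length vs = Suc k \<and> set vs \<subseteq> vfields B)"
  shows "D_H \<Theta> vs = 0"
proof (cases "set vs \<subseteq> vfields B")
  case True
  have "lie (h (vs ! i)) (\<Theta> (nths vs (-{i}))) = 0" if "i < length vs" for i
  proof -
    have "vs ! i \<in> vfields B" using True that nth_mem by blast
    moreover have "\<Theta> (nths vs (-{i})) = 0"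
      using True assms(2) length_nths_remove1[OF that] that by (intro assms(1)) auto
    ultimately show ?thesis by (simp add: lie_zero hlift_vfield)
  qed
  moreover have "\<Theta> (bracket B (vs ! i) (vs ! j) # nths vs (-{i, j})) = 0"
    if "i < j" "j < length vs" for i j
    using True assms(2) length_nths_remove2[OF that] that by (intro assms(1)) auto
  ultimately show ?thesis by (simp add: dH_def fun_eq_iff)
next
  case False
  then show ?thesis unfolding dH_def by (simp add: fun_eq_iff)
qed

lemma dH_diff:
  assumes "\<And>vs ws. \<Theta> vs ws \<in> smooth_funs A" "\<And>vs ws. \<Xi> vs ws \<in> smooth_funs A"
  shows "D_H (\<Theta> - \<Xi>) = D_H \<Theta> - D_H \<Xi>"
proof (intro ext)
  fix vs ws x
  show "D_H (\<Theta> - \<Xi>) vs ws x = (D_H \<Theta> - D_H \<Xi>) vs ws x"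
  proof (cases "set vs \<subseteq> vfields B")
    case True
    have "lie (h (vs ! i)) ((\<Theta> - \<Xi>) us) ws x
        = lie (h (vs ! i)) (\<Theta> us) ws x - lie (h (vs ! i)) (\<Xi> us) ws x" if "i < length vs" for i us
    proof -
      have "vs ! i \<in> vfields B" using True that nth_mem by blast
      from lie_diff_right[OF hlift_vfield[OF this] assms] show ?thesis by simp
    qed
    then show ?thesis using True by (simp add: dH_def right_diff_distrib sum_subtractf)
  qed (simp add: dH_def)
qed

lemma lie_hlift_smult_left:
  assumes "u \<in> vfields B" "f \<in> smooth_funs B" "\<omega> \<in> vert_forms A B p q"
  shows "lie (h (vf_smult f u)) \<omega> = (\<lambda>ws. (f \<circ> p) * lie (h u) \<omega> ws)"
  unfolding hlift_smult[OF assms(1)]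
  by (rule lie_smult_left[OF assms(3) hlift_projectable[OF assms(1)] pullback_smooth[OF assms(2)]])
    (rule V_pullback[OF _ assms(2)])

lemma lie_hlift_smult_right:
  assumes v: "v \<in> vfields B" and f: "f \<in> smooth_funs B" and \<omega>: "\<omega> \<in> vert_forms A B p q"
  shows "lie (h v) (\<lambda>ws. (f \<circ> p) * \<omega> ws)
    = (\<lambda>ws. (f \<circ> p) * lie (h v) \<omega> ws + ((\<lambda>b. v b f) \<circ> p) * \<omega> ws)"
  using lie_smult_right[OF \<omega> hlift_vfield[OF v] pullback_smooth[OF f]] hlift_pullback[OF v f]
  by (simp add: fun_eq_iff)

lemma lie_hlift_add:
  assumes "u \<in> vfields B" "v \<in> vfields B" "\<omega> \<in> vert_forms A B p q"
  shows "lie (h (u + v)) \<omega> = lie (h u) \<omega> + lie (h v) \<omega>"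
  unfolding hlift_add[OF assms(1,2)]
  by (rule lie_add_left[OF assms(3)]) (intro hlift_projectable assms)+

lemma lie_hlift_form:
  "v \<in> vfields B \<Longrightarrow> \<omega> \<in> vert_forms A B p q \<Longrightarrow> lie (h v) \<omega> \<in> vert_forms A B p q"
  by (rule lie_vert_form[OF _ hlift_projectable])

lemma lie_hlift_add_right:
  assumes "v \<in> vfields B" "\<omega> \<in> vert_forms A B p q" "\<eta> \<in> vert_forms A B p q"
  shows "lie (h v) (\<omega> + \<eta>) = lie (h v) \<omega> + lie (h v) \<eta>"
proof -
  have "- \<eta> \<in> vert_forms A B p q" using vert_forms_diff[OF vert_forms_zero assms(3)] by simp
  note s = vert_form_smooth[OF assms(2)] vert_form_smooth[OF this] vert_form_smooth[OF assms(3)]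
  show ?thesis
    using lie_diff_right[where \<omega> = \<omega> and \<eta> = "- \<eta>", OF hlift_vfield[OF assms(1)] s(1,2)]
      lie_uminus_right[where \<omega> = \<eta>, OF hlift_vfield[OF assms(1)] s(3)]
    by simp
qed

lemma vert_forms_add:
  assumes "\<omega> \<in> vert_forms A B p q" "\<eta> \<in> vert_forms A B p q"
  shows "\<omega> + \<eta> \<in> vert_forms A B p q"
  using vert_forms_diff[OF assms(1) vert_forms_diff[OF vert_forms_zero assms(2)]] by simp

text \<open>The difference is written as a sum with a negative, to match the rules for sums and
  negatives in a slot of a biform.\<close>

lemma base_bracket_smult_left:
  assumes "u \<in> vfields B" "v \<in> vfields B" "f \<in> smooth_funs B"
  shows "bracket B (vf_smult f u) v = vf_smult f (bracket B u v) + (- vf_smult (\<lambda>b. v b f) u)"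
  using base.bracket_smult_left[OF assms] by simp

text \<open>For linearity over the base, the derivative of \<open>f\<close> produced by
  \<open>lie (h v)\<close> on \<open>\<Theta> [vf_smult f u]\<close> cancels against the Leibniz
  term of the bracket of \<open>vf_smult f u\<close> with \<open>v\<close>.\<close>

lemma dH_biform1:
  assumes \<Theta>: "\<Theta> \<in> biforms A B p 1 q"
  shows "D_H \<Theta> \<in> biforms A B p 2 q"
proof (rule biforms2I)
  note form = biform_form[OF \<Theta>]
  show "D_H \<Theta> vs = 0" if "\<not> (length vs = 2 \<and> set vs \<subseteq> vfields B)" for vs
    using that by (intro dH_junk[of 1] biform_junk[OF \<Theta>]) auto
  fix u v assume u: "u \<in> vfields B" and v: "v \<in> vfields B"
  note uv = base.vfields_bracket[OF u v]
  show "D_H \<Theta> [u, v] \<in> vert_forms A B p q"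
    unfolding dH_1[OF u v] by (intro vert_forms_diff lie_hlift_form u v form)
  show "D_H \<Theta> [v, u] = - D_H \<Theta> [u, v]"
    by (simp add: dH_1 u v base.bracket_antisym[of v u] biform1_uminus[OF \<Theta> uv])
  show "D_H \<Theta> [u + u', v] = D_H \<Theta> [u, v] + D_H \<Theta> [u', v]" if u': "u' \<in> vfields B" for u'
    by (simp add: dH_1 u u' v base.vfields_add lie_hlift_add[OF _ _ form] biform1_add[OF \<Theta>]
        lie_hlift_add_right[OF _ form form] base.bracket_add_left base.vfields_bracket algebra_simps)
  show "D_H \<Theta> [vf_smult f u, v] = (\<lambda>ws. (f \<circ> p) * D_H \<Theta> [u, v] ws)" if f: "f \<in> smooth_funs B" for f
  proof -
    have m: "vf_smult (\<lambda>b. v b f) u \<in> vfields B" "vf_smult f (bracket B u v) \<in> vfields B"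
      by (intro base.vfields_smult base.vf_smooth[OF v f] f uv u)+
    have "\<Theta> [bracket B (vf_smult f u) v]
        = (\<lambda>ws. (f \<circ> p) * \<Theta> [bracket B u v] ws) - (\<lambda>ws. ((\<lambda>b. v b f) \<circ> p) * \<Theta> [u] ws)"
      unfolding base_bracket_smult_left[OF u v f]
        biform1_add[OF \<Theta> m(2) base.vfields_uminus[OF m(1)]] biform1_uminus[OF \<Theta> m(1)]
        biform1_smult[OF \<Theta> uv f] biform1_smult[OF \<Theta> u base.vf_smooth[OF v f]]
      by simp
    then show ?thesis
      unfolding dH_1[OF base.vfields_smult[OF f u] v] dH_1[OF u v]
        lie_hlift_smult_left[OF u f form] biform1_smult[OF \<Theta> u f]
        lie_hlift_smult_right[OF v f form]
      by (simp add: fun_eq_iff algebra_simps)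
  qed
qed

lemma dH_biform2:
  assumes \<Theta>: "\<Theta> \<in> biforms A B p 2 q"
  shows "D_H \<Theta> \<in> biforms A B p 3 q"
proof (rule biforms3I)
  note form = biform_form[OF \<Theta>]
  show "D_H \<Theta> vs = 0" if "\<not> (length vs = 3 \<and> set vs \<subseteq> vfields B)" for vs
    using that by (intro dH_junk[of 2] biform_junk[OF \<Theta>]) auto
  fix u v w assume u: "u \<in> vfields B" and v: "v \<in> vfields B" and w: "w \<in> vfields B"
  note br = base.vfields_bracket[OF u v] base.vfields_bracket[OF u w] base.vfields_bracket[OF v w]
  note bra = base.bracket_antisym[of v u] base.bracket_antisym[of w v]
  note swap = biform2_swap[OF \<Theta> u v] biform2_swap[OF \<Theta> v w]
  have lie_neg: "lie (h z) (- \<Theta> vs) = - lie (h z) (\<Theta> vs)" if "z \<in> vfields B" for z vs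
    by (rule lie_uminus_right[OF hlift_vfield[OF that] vert_form_smooth[OF form]])
  show "D_H \<Theta> [u, v, w] \<in> vert_forms A B p q"
    unfolding dH_2[OF u v w] by (intro vert_forms_diff vert_forms_add lie_hlift_form u v w form)
  show "D_H \<Theta> [v, u, w] = - D_H \<Theta> [u, v, w]"
    unfolding dH_2[OF u v w] dH_2[OF v u w] bra swap lie_neg[OF w] biform2_uminus[OF \<Theta> br(1) w]
    by (simp add: fun_eq_iff)
  show "D_H \<Theta> [u, w, v] = - D_H \<Theta> [u, v, w]"
    unfolding dH_2[OF u v w] dH_2[OF u w v] bra swap lie_neg[OF u] biform2_uminus[OF \<Theta> br(3) u]
    by (simp add: fun_eq_iff)
  show "D_H \<Theta> [u + u', v, w] = D_H \<Theta> [u, v, w] + D_H \<Theta> [u', v, w]" if u': "u' \<in> vfields B" for u'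
  proof -
    have "\<Theta> [z, u + u'] = \<Theta> [z, u] + \<Theta> [z, u']" if "z \<in> vfields B" for z
      using that u u' biform2_swap[OF \<Theta> _ that] by (simp add: base.vfields_add biform2_add[OF \<Theta>])
    then show ?thesis
      using base.vfields_bracket[OF u' v] base.vfields_bracket[OF u' w] br
      by (simp add: dH_2 u u' v w base.vfields_add lie_hlift_add[OF _ _ form]
          biform2_add[OF \<Theta>] lie_hlift_add_right[OF _ form form] base.bracket_add_left algebra_simps)
  qed
  show "D_H \<Theta> [vf_smult f u, v, w] = (\<lambda>ws. (f \<circ> p) * D_H \<Theta> [u, v, w] ws)"
    if f: "f \<in> smooth_funs B" for f
  proof -
    \<comment> \<open>The bracket with each field \<open>z\<close> leaves one derivative of
      \<open>f\<close> along \<open>z\<close>, which cancels the one coming from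
      \<open>lie (h z)\<close>.\<close>
    have br_u: "\<Theta> [bracket B (vf_smult f u) z, z']
        = (\<lambda>ws. (f \<circ> p) * \<Theta> [bracket B u z, z'] ws) - (\<lambda>ws. ((\<lambda>b. z b f) \<circ> p) * \<Theta> [u, z'] ws)"
      if z: "z \<in> vfields B" and z': "z' \<in> vfields B" for z z'
    proof -
      note uz = base.vfields_bracket[OF u z]
      have m: "vf_smult (\<lambda>b. z b f) u \<in> vfields B" "vf_smult f (bracket B u z) \<in> vfields B"
        by (intro base.vfields_smult base.vf_smooth[OF z f] f uz u)+
      show ?thesis
        unfolding base_bracket_smult_left[OF u z f]
          biform2_add[OF \<Theta> m(2) z' base.vfields_uminus[OF m(1)]] biform2_uminus[OF \<Theta> m(1) z']
          biform2_smult[OF \<Theta> uz z' f] biform2_smult[OF \<Theta> u z' base.vf_smooth[OF z f]]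
        by simp
    qed
    have "\<Theta> [bracket B v w, vf_smult f u] = (\<lambda>ws. (f \<circ> p) * \<Theta> [bracket B v w, u] ws)"
      unfolding biform2_swap[OF \<Theta> base.vfields_smult[OF f u] br(3)] biform2_swap[OF \<Theta> u br(3)]
        biform2_smult[OF \<Theta> u br(3) f]
      by (simp add: fun_eq_iff)
    then show ?thesis
      unfolding dH_2[OF base.vfields_smult[OF f u] v w] dH_2[OF u v w] br_u[OF v w] br_u[OF w v]
        lie_hlift_smult_left[OF u f form] biform2_smult[OF \<Theta> u v f] biform2_smult[OF \<Theta> u w f]
        lie_hlift_smult_right[OF v f form] lie_hlift_smult_right[OF w f form]
      by (simp add: fun_eq_iff algebra_simps)
  qed
qed


subsection \<open>Anticommutation of the vertical and the horizontal differential\<close>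

lemma dV_apply: "D_V \<Theta> vs = (if even (length vs) then vert_d A B p (\<Theta> vs) else - vert_d A B p (\<Theta> vs))"
  by (simp add: dV_def fun_eq_iff)

lemma dV_smooth:
  assumes "\<And>vs ws. \<Theta> vs ws \<in> smooth_funs A"
  shows "D_V \<Theta> vs ws \<in> smooth_funs A"
  using assms by (simp add: dV_apply vert_d_smooth total.smooth_uminus)

lemma dV_diff:
  assumes "\<And>vs ws. \<Theta> vs ws \<in> smooth_funs A" "\<And>vs ws. \<Xi> vs ws \<in> smooth_funs A"
  shows "D_V (\<Theta> - \<Xi>) = D_V \<Theta> - D_V \<Xi>"
  by (rule ext) (simp add: dV_apply vert_d_diff assms)

lemma dV_junk: "\<Theta> vs = 0 \<Longrightarrow> D_V \<Theta> vs = 0"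
  by (simp add: dV_apply vert_d_zero)

lemma vert_d_add:
  assumes "\<And>ws. \<omega> ws \<in> smooth_funs A" "\<And>ws. \<eta> ws \<in> smooth_funs A"
  shows "vert_d A B p (\<omega> + \<eta>) = vert_d A B p \<omega> + vert_d A B p \<eta>"
  using vert_d_diff[where \<omega> = \<omega> and \<eta> = "- \<eta>"] vert_d_uminus[where \<omega> = \<eta>] assms
  by (simp add: total.smooth_uminus)

lemma vert_d_lie_hlift:
  "u \<in> vfields B \<Longrightarrow> \<omega> \<in> vert_forms A B p 1 \<Longrightarrow>
    vert_d A B p (lie (h u) \<omega>) = lie (h u) (vert_d A B p \<omega>)"
  by (rule vert_d_lie[OF _ hlift_projectable])

text \<open>\<open>vert_d\<close> commutes with every term of \<open>D_H\<close>. The sign arises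
  because \<open>D_V\<close> carries the parity of the base degree, which \<open>D_H\<close> raises
  by one.\<close>

lemma dH_dV_1:
  assumes \<Theta>: "\<Theta> \<in> biforms A B p 1 1"
  shows "D_H (D_V \<Theta>) = - D_V (D_H \<Theta>)"
proof
  fix vs
  show "D_H (D_V \<Theta>) vs = (- D_V (D_H \<Theta>)) vs"
  proof (cases "length vs = 2 \<and> set vs \<subseteq> vfields B")
    case True
    then obtain u v where vs: "vs = [u, v]" and u: "u \<in> vfields B" and v: "v \<in> vfields B"
      using length2_cases by metis
    note s = biform_smooth[OF \<Theta>] and form = biform_form[OF \<Theta>]
    note L = lie_uminus_right[OF hlift_vfield[OF u] vert_d_smooth[where \<omega> = "\<Theta> [v]", OF s]]
      lie_uminus_right[OF hlift_vfield[OF v] vert_d_smooth[where \<omega> = "\<Theta> [u]", OF s]]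
    have "vert_d A B p (D_H \<Theta> [u, v]) = lie (h u) (vert_d A B p (\<Theta> [v]))
        - lie (h v) (vert_d A B p (\<Theta> [u])) - vert_d A B p (\<Theta> [bracket B u v])"
      using u v
      by (simp add: dH_1 vert_d_diff lie_smooth hlift_vfield s total.smooth_diff
          vert_d_lie_hlift[OF _ form])
    then show ?thesis
      unfolding vs using u v L by (simp add: dH_1 dV_apply)
  next
    case False
    have "D_V \<Theta> vs = 0" if "length vs \<noteq> 1" for vs
      using that by (intro dV_junk biform_junk[OF \<Theta>]) simp
    then have "D_H (D_V \<Theta>) vs = 0" using False by (intro dH_junk[of 1]) simp_all
    moreover have "D_H \<Theta> vs = 0"
      using False by (intro biform_junk[OF dH_biform1[OF \<Theta>]])
    ultimately show ?thesis by (simp add: dV_junk)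
  qed
qed

lemma dH_dV_2:
  assumes \<Theta>: "\<Theta> \<in> biforms A B p 2 1"
  shows "D_H (D_V \<Theta>) = - D_V (D_H \<Theta>)"
proof
  fix vs
  show "D_H (D_V \<Theta>) vs = (- D_V (D_H \<Theta>)) vs"
  proof (cases "length vs = 3 \<and> set vs \<subseteq> vfields B")
    case True
    then obtain u v w where vs: "vs = [u, v, w]"
      and uvw: "u \<in> vfields B" "v \<in> vfields B" "w \<in> vfields B"
      using length3_cases by metis
    note s = biform_smooth[OF \<Theta>] and form = biform_form[OF \<Theta>]
    have "vert_d A B p (D_H \<Theta> [u, v, w]) = lie (h u) (vert_d A B p (\<Theta> [v, w]))
        - lie (h v) (vert_d A B p (\<Theta> [u, w])) + lie (h w) (vert_d A B p (\<Theta> [u, v]))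
        - vert_d A B p (\<Theta> [bracket B u v, w]) + vert_d A B p (\<Theta> [bracket B u w, v])
        - vert_d A B p (\<Theta> [bracket B v w, u])"
      using uvw
      by (simp add: dH_2 vert_d_diff vert_d_add lie_smooth hlift_vfield s total.smooth_diff
          total.smooth_add vert_d_lie_hlift[OF _ form])
    then show ?thesis
      unfolding vs using uvw by (simp add: dH_2 dV_apply)
  next
    case False
    have "D_V \<Theta> vs = 0" if "length vs \<noteq> 2" for vs
      using that by (intro dV_junk biform_junk[OF \<Theta>]) simp
    then have "D_H (D_V \<Theta>) vs = 0" using False by (intro dH_junk[of 2]) simp_all
    moreover have "D_H \<Theta> vs = 0"
      using False by (intro biform_junk[OF dH_biform2[OF \<Theta>]])
    ultimately show ?thesis by (simp add: dV_junk)
  qed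
qed


subsection \<open>The curvature form\<close>

lemma contraction_add:
  assumes \<omega>: "\<omega> \<in> vert_forms A B p (Suc q)" and X: "X \<in> V" and Y: "Y \<in> V"
  shows "contraction (X + Y) \<omega> = contraction X \<omega> + contraction Y \<omega>"
proof
  fix ws
  show "contraction (X + Y) \<omega> ws = (contraction X \<omega> + contraction Y \<omega>) ws"
  proof (cases "length ws = q \<and> set ws \<subseteq> V")
    case True
    then show ?thesis
      using vert_form_add[OF \<omega>, of "X # ws" 0 X Y] X Y by (simp add: contraction_def)
  next
    case False
    then have "\<omega> (Z # ws) = 0" for Z by (intro vert_form_junk[OF \<omega>]) auto
    then show ?thesis by (simp add: contraction_def)
  qed
qed

lemma contraction_smult:
  assumes \<omega>: "\<omega> \<in> vert_forms A B p (Suc q)" and X: "X \<in> V" and f: "f \<in> smooth_funs A"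
  shows "contraction (vf_smult f X) \<omega> = (\<lambda>ws. f * contraction X \<omega> ws)"
proof
  fix ws
  show "contraction (vf_smult f X) \<omega> ws = f * contraction X \<omega> ws"
  proof (cases "length ws = q \<and> set ws \<subseteq> V")
    case True
    then show ?thesis
      using vert_form_smult[OF \<omega>, of "X # ws" 0 X f] X f by (simp add: contraction_def)
  next
    case False
    then have "\<omega> (Z # ws) = 0" for Z by (intro vert_form_junk[OF \<omega>]) auto
    then show ?thesis by (simp add: contraction_def)
  qed
qed

lemma contraction_uminus:
  assumes \<omega>: "\<omega> \<in> vert_forms A B p (Suc q)" and X: "X \<in> V"
  shows "contraction (- X) \<omega> = - contraction X \<omega>"
proof -
  have "vf_smult (\<lambda>x. - 1) X = - X" by (simp add: vf_smult_def fun_eq_iff)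
  then have "contraction (- X) \<omega> = (\<lambda>ws. (\<lambda>x. - 1) * contraction X \<omega> ws)"
    using contraction_smult[OF \<omega> X total.const_smooth[of "- 1"]] by simp
  then show ?thesis by (simp add: fun_eq_iff)
qed

text \<open>The negative terms of the alternating sum are moved to the right.\<close>

lemma bianchi:
  assumes u: "u \<in> vfields B" and v: "v \<in> vfields B" and w: "w \<in> vfields B"
  shows "bracket A (h u) (C v w) + bracket A (h w) (C u v) + C (bracket B u w) v
    = bracket A (h v) (C u w) + C (bracket B u v) w + C (bracket B v w) u"
proof -
  note hv = hlift_vfield[OF u] hlift_vfield[OF v] hlift_vfield[OF w]
  have brB: "bracket B a b \<in> vfields B" if "a \<in> vfields B" "b \<in> vfields B" for a b
    using that by (rule base.vfields_bracket)
  have exp: "bracket A (h a) (C b c) = bracket A (h a) (bracket A (h b) (h c))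
      - bracket A (h a) (h (bracket B b c))"
    if "a \<in> vfields B" "b \<in> vfields B" "c \<in> vfields B" for a b c
    unfolding curvature_def
    using that by (intro total.bracket_diff_right hlift_vfield total.vfields_bracket brB)
  have jacA: "bracket A (h u) (bracket A (h v) (h w)) + bracket A (h w) (bracket A (h u) (h v))
      = bracket A (h v) (bracket A (h u) (h w))"
    unfolding total.jacobi[OF hv]
      total.bracket_antisym[of "h w" "bracket A (h u) (h v)"] by simp
  have "bracket B (bracket B u w) v = bracket B (bracket B u v) w + bracket B (bracket B v w) u"
    unfolding base.bracket_antisym[of "bracket B u w" v]
      base.bracket_antisym[of "bracket B v w" u] base.jacobi[OF u v w] by simp
  then have jacB: "h (bracket B (bracket B u w) v)
      = h (bracket B (bracket B u v) w) + h (bracket B (bracket B v w) u)"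
    using hlift_add[OF brB[OF brB[OF u v] w] brB[OF brB[OF v w] u]] by simp
  have curv: "C (bracket B a b) c
      = - bracket A (h c) (h (bracket B a b)) - h (bracket B (bracket B a b) c)" for a b c
    unfolding curvature_def total.bracket_antisym[of "h (bracket B a b)"] by (rule refl)
  \<comment> \<open>The terms that bracket a lift with the lift of a bracket occur identically on
    both sides; \<open>jacA\<close> matches the double brackets of lifts and \<open>jacB\<close> the
    lifts of double brackets.\<close>
  show ?thesis
    unfolding exp[OF u v w] exp[OF w u v] exp[OF v u w] curv jacB jacA[symmetric]
    by (simp add: fun_eq_iff)
qed

context
  fixes \<Phi>
  assumes \<Phi>: "\<Phi> \<in> vert_forms A B p 3"
begin

abbreviation \<Psi> :: "('b, 'm) biform" where "\<Psi> \<equiv> dC A B p Hor (biform0 \<Phi>)"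

text \<open>The minus sign is \<open>(-1)^(0+1)\<close> from the only pair of indices; the prefactor
  is 1 in base degree 0.\<close>

lemma dC_biform0: "u \<in> vfields B \<Longrightarrow> v \<in> vfields B \<Longrightarrow> \<Psi> [u, v] = - contraction (C u v) \<Phi>"
  by (simp add: dC_def biform0_def nths_Cons lessThan_Suc contraction_def fun_eq_iff)

lemma dC_biform0_junk:
  assumes "\<not> (length vs = 2 \<and> set vs \<subseteq> vfields B)"
  shows "\<Psi> vs = 0"
proof (cases "set vs \<subseteq> vfields B")
  case True
  have "biform0 \<Phi> (nths vs (-{i, j})) = 0" if "i < j" "j < length vs" for i j
  proof -
    have "length (nths vs (-{i, j})) \<noteq> 0"
      using True assms that length_nths_remove2[OF that] by simp
    then show ?thesis by (simp add: biform0_def)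
  qed
  then show ?thesis by (simp add: dC_def contraction_def fun_eq_iff)
next
  case False
  then show ?thesis unfolding dC_def by (simp add: fun_eq_iff)
qed

lemma \<Phi>_Suc: "\<Phi> \<in> vert_forms A B p (Suc 2)"
  using \<Phi> by simp

lemma dC_biform: "\<Psi> \<in> biforms A B p 2 2"
proof (rule biforms2I)
  show "\<Psi> vs = 0" if "\<not> (length vs = 2 \<and> set vs \<subseteq> vfields B)" for vs
    using that by (rule dC_biform0_junk)
  fix u v assume u: "u \<in> vfields B" and v: "v \<in> vfields B"
  note C = curvature_vert[OF u v]
  show "\<Psi> [u, v] \<in> vert_forms A B p 2"
    using vert_forms_diff[OF vert_forms_zero contraction_vert_form[OF \<Phi>_Suc C]]
    by (simp add: dC_biform0 u v)
  show "\<Psi> [v, u] = - \<Psi> [u, v]"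
    by (simp add: dC_biform0 u v curvature_antisym[OF u v] contraction_uminus[OF \<Phi>_Suc C])
  show "\<Psi> [u + u', v] = \<Psi> [u, v] + \<Psi> [u', v]" if u': "u' \<in> vfields B" for u'
    by (simp add: dC_biform0 u v u' base.vfields_add curvature_add
        contraction_add[OF \<Phi>_Suc C curvature_vert[OF u' v]])
  show "\<Psi> [vf_smult f u, v] = (\<lambda>ws. (f \<circ> p) * \<Psi> [u, v] ws)" if f: "f \<in> smooth_funs B" for f
    by (simp add: dC_biform0 u v f base.vfields_smult curvature_smult
        contraction_smult[OF \<Phi>_Suc C pullback_smooth[OF f]] fun_eq_iff)
qed

context
  assumes invariant: "\<And>u. u \<in> vfields B \<Longrightarrow> lie (h u) \<Phi> = 0"
begin

lemma lie_curvature: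
  assumes u: "u \<in> vfields B" and v: "v \<in> vfields B"
  shows "lie (C u v) \<Phi> = 0"
proof -
  note uv = base.vfields_bracket[OF u v]
  \<comment> \<open>The bracket of two lifts is related to a field on the base, hence preserves
    vertical fields.\<close>
  have "bracket A (h u) (h v) \<in> projectable"
    unfolding projectable_def
    using V_bracket_related[OF _ related_bracket[OF _ _ related_hlift related_hlift] uv]
    by (simp add: u v hlift_vfield total.vfields_bracket)
  then have "lie (bracket A (h u) (h v)) \<Phi> = 0"
    by (intro lie_bracket_invariant[OF \<Phi>] hlift_projectable u v invariant)
  moreover have "bracket A (h u) (h v) = C u v + h (bracket B u v)"
    by (simp add: curvature_def)
  ultimately show ?thesis
    using lie_add_left[OF \<Phi> V_projectable[OF curvature_vert[OF u v]] hlift_projectable[OF uv]]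
      invariant[OF uv] by simp
qed

lemma dV_dC:
  assumes "vert_d A B p \<Phi> = 0"
  shows "D_V \<Psi> = 0"
proof
  fix vs
  show "D_V \<Psi> vs = 0 vs"
  proof (cases "length vs = 2 \<and> set vs \<subseteq> vfields B")
    case True
    then obtain u v where vs: "vs = [u, v]" and u: "u \<in> vfields B" and v: "v \<in> vfields B"
      using length2_cases by metis
    note C = curvature_vert[OF u v]
    show ?thesis
      using vert_d_contraction[OF \<Phi> C assms lie_curvature[OF u v]]
        vert_d_uminus[OF vert_form_smooth[OF contraction_vert_form[OF \<Phi>_Suc C]]]
      by (simp add: vs dV_apply dC_biform0 u v)
  next
    case False
    then show ?thesis by (simp add: dV_junk dC_biform0_junk)
  qed
qed

text \<open>By \<open>lie_contraction\<close> the Lie derivatives turn into contractions with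
  brackets, and contraction is additive in the field. The six terms are then those of the Bianchi
  identity.\<close>

lemma dH_dC: "D_H \<Psi> = 0"
proof
  fix vs
  show "D_H \<Psi> vs = 0 vs"
  proof (cases "length vs = 3 \<and> set vs \<subseteq> vfields B")
    case True
    then obtain u v w where vs: "vs = [u, v, w]"
      and u: "u \<in> vfields B" and v: "v \<in> vfields B" and w: "w \<in> vfields B"
      using length3_cases by metis
    note br = base.vfields_bracket[OF u v] base.vfields_bracket[OF u w] base.vfields_bracket[OF v w]
    have L: "lie (h a) (- contraction (C b c) \<Phi>) = - contraction (bracket A (h a) (C b c)) \<Phi>"
      if "a \<in> vfields B" "b \<in> vfields B" "c \<in> vfields B" for a b c
      using lie_uminus_right[OF hlift_vfield[OF that(1)]
          vert_form_smooth[OF contraction_vert_form[OF \<Phi>_Suc curvature_vert[OF that(2,3)]]]]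
        lie_contraction[OF \<Phi>_Suc hlift_projectable[OF that(1)] curvature_vert[OF that(2,3)]
          invariant[OF that(1)]] by simp
    have mem: "bracket A (h a) (C b c) \<in> V" if "a \<in> vfields B" "b \<in> vfields B" "c \<in> vfields B" for a b c
      by (rule V_bracket_hlift[OF that(1) curvature_vert[OF that(2,3)]])
    note add = contraction_add[OF \<Phi>_Suc]
    have eq: "contraction (bracket A (h u) (C v w)) \<Phi> + contraction (bracket A (h w) (C u v)) \<Phi>
        + contraction (C (bracket B u w) v) \<Phi>
        = contraction (bracket A (h v) (C u w)) \<Phi> + contraction (C (bracket B u v) w) \<Phi>
        + contraction (C (bracket B v w) u) \<Phi>"
      using arg_cong[OF bianchi[OF u v w], of "\<lambda>X. contraction X \<Phi>"] u v w br
      by (simp add: add mem curvature_vert V_add)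
    have "D_H \<Psi> [u, v, w] ws x = 0" for ws x
      using fun_cong[OF fun_cong[OF eq, of ws], of x]
      by (simp add: dH_2 u v w dC_biform0 br L)
    then show ?thesis by (intro ext) (simp add: vs)
  next
    case False
    then show ?thesis by (simp add: dH_junk[of 2] dC_biform0_junk)
  qed
qed

end

end


subsection \<open>Components of a form on the total space\<close>

text \<open>The component of bidegree \<open>(k, q)\<close> of a form of degree \<open>k + q\<close>.\<close>

definition component :: "nat \<Rightarrow> 'm form \<Rightarrow> ('b, 'm) biform" where
  "component k \<omega> = (\<lambda>vs ws. if length vs = k \<and> set vs \<subseteq> vfields B \<and> set ws \<subseteq> V
     then \<omega> (map h vs @ ws) else 0)"

text \<open>Base slot \<open>i\<close> is slot \<open>i\<close> of \<open>\<omega>\<close>, and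
  vertical slot \<open>i\<close> is slot \<open>k + i\<close>. The lift turns a coefficient
  \<open>f\<close> into \<open>f \<circ> p\<close>, which is the module structure of
  biforms.\<close>

lemma component_biform:
  assumes "\<omega> \<in> forms A (k + q)"
  shows "component k \<omega> \<in> biforms A B p k q"
proof -
  note \<omega> = assms[unfolded forms_def] and S = total.vf_submodule_vfields
  note junk = total.mform_junk[OF S \<omega>] and add = total.mform_add[OF S \<omega>]
    and smult = total.mform_smult[OF S \<omega>] and alt = total.mform_alt[OF S \<omega>]
  have args: "set (map h vs @ ws) \<subseteq> vfields A" if "set vs \<subseteq> vfields B" "set ws \<subseteq> V" for vs ws
    using that hlift_vfield V_vfield by auto
  have comp: "component k \<omega> vs ws = \<omega> (map h vs @ ws)"
    if "length vs = k" "set vs \<subseteq> vfields B" "set ws \<subseteq> V" for vs ws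
    using that by (simp add: component_def)
  show ?thesis
    unfolding biforms_def
  proof (rule alt_formsI)
    fix vs :: "'b vfield list"
    show "component k \<omega> vs = 0" if "\<not> (length vs = k \<and> set vs \<subseteq> vfields B)"
      using that by (auto simp: component_def fun_eq_iff)
    assume k: "length vs = k" and vs: "set vs \<subseteq> vfields B"
    have upd: "set (vs[i := a]) \<subseteq> vfields B" if "a \<in> vfields B" for i a
      using vs that by (rule set_update_subset)
    have nonvert: "component k \<omega> us ws = 0" if "\<not> set ws \<subseteq> V" for us ws
      using that by (auto simp: component_def)
    show "component k \<omega> vs \<in> vert_forms A B p q"
    proof (rule vert_formsI)
      fix ws :: "'m vfield list"
      show "component k \<omega> vs ws \<in> smooth_funs A"
        using total.mform_smooth[OF S \<omega>] total.smooth_zero by (simp add: component_def)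
      show "component k \<omega> vs ws = 0" if "\<not> (length ws = q \<and> set ws \<subseteq> V)"
        using that k junk[of "map h vs @ ws"] by (auto simp: component_def)
      assume q: "length ws = q" and ws: "set ws \<subseteq> V"
      note len = k q args[OF vs ws]
      show "component k \<omega> vs (ws[i := a + b])
          = component k \<omega> vs (ws[i := a]) + component k \<omega> vs (ws[i := b])"
        if "i < q" "a \<in> V" "b \<in> V" for i a b
        using add[of "map h vs @ ws" "k + i" a b] that len
        by (simp add: comp k vs set_update_subset ws V_add list_update_append V_vfield)
      show "component k \<omega> vs (ws[i := vf_smult f a]) = f * component k \<omega> vs (ws[i := a])"
        if "i < q" "a \<in> V" "f \<in> smooth_funs A" for i a f
        using smult[of "map h vs @ ws" "k + i" a f] that len
        by (simp add: comp k vs set_update_subset ws V_smult list_update_append V_vfield)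
      show "component k \<omega> vs ws = 0" if "i < j" "j < q" "ws ! i = ws ! j" for i j
        using alt[of "map h vs @ ws" "k + i" "k + j"] that len
        by (simp add: comp k vs ws nth_append)
    qed
    show "component k \<omega> (vs[i := a + b]) = component k \<omega> (vs[i := a]) + component k \<omega> (vs[i := b])"
      if i: "i < k" and a: "a \<in> vfields B" and b: "b \<in> vfields B" for i a b
    proof
      fix ws
      show "component k \<omega> (vs[i := a + b]) ws
          = (component k \<omega> (vs[i := a]) + component k \<omega> (vs[i := b])) ws"
      proof (cases "length ws = q \<and> set ws \<subseteq> V")
        case True
        then show ?thesis
          using add[of "map h vs @ ws" i "h a" "h b"] args[OF vs, of ws] i k a b
          by (simp add: comp upd base.vfields_add map_update hlift_add list_update_append
              hlift_vfield)
      next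
        case False
        \<comment> \<open>Either the joined list has the wrong length for \<open>\<omega>\<close>,
          or the guard on vertical arguments in \<open>component\<close> fails.\<close>
        then have "\<omega> (map h us @ ws) = 0 \<or> \<not> set ws \<subseteq> V" if "length us = k" for us
          using junk[of "map h us @ ws"] that by auto
        then show ?thesis using k by (auto simp: component_def)
      qed
    qed
    show "component k \<omega> (vs[i := vf_smult f a]) = (\<lambda>ws. (f \<circ> p) * component k \<omega> (vs[i := a]) ws)"
      if i: "i < k" and a: "a \<in> vfields B" and f: "f \<in> smooth_funs B" for i a f
    proof
      fix ws
      show "component k \<omega> (vs[i := vf_smult f a]) ws = (f \<circ> p) * component k \<omega> (vs[i := a]) ws"
      proof (cases "length ws = q \<and> set ws \<subseteq> V")
        case True
        then show ?thesis
          using smult[of "map h vs @ ws" i "h a" "f \<circ> p"] args[OF vs, of ws] i k a f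
          by (simp add: comp upd base.vfields_smult map_update hlift_smult list_update_append
              hlift_vfield pullback_smooth)
      next
        case False
        then have "\<omega> (map h us @ ws) = 0 \<or> \<not> set ws \<subseteq> V" if "length us = k" for us
          using junk[of "map h us @ ws"] that by auto
        then show ?thesis using k by (auto simp: component_def)
      qed
    qed
    show "component k \<omega> vs = 0" if ij: "i < j" "j < k" and eq: "vs ! i = vs ! j" for i j
    proof
      fix ws
      show "component k \<omega> vs ws = 0 ws"
      proof (cases "length ws = q \<and> set ws \<subseteq> V")
        case True
        then show ?thesis
          using alt[of "map h vs @ ws" i j] args[OF vs, of ws] ij eq k
          by (simp add: comp vs nth_append)
      next
        case False
        then show ?thesis using junk[of "map h vs @ ws"] k by (auto simp: component_def)
      qed
    qed
  qed
qed

lemma component_1: "u \<in> vfields B \<Longrightarrow> set ws \<subseteq> V \<Longrightarrow> component 1 \<omega> [u] ws = \<omega> (h u # ws)"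
  and component_2: "u \<in> vfields B \<Longrightarrow> v \<in> vfields B \<Longrightarrow> set ws \<subseteq> V \<Longrightarrow>
    component 2 \<omega> [u, v] ws = \<omega> (h u # h v # ws)"
  by (simp_all add: component_def)

context
  fixes \<Phi>V \<Phi>
  assumes \<Phi>V: "\<Phi>V \<in> vert_forms A B p 3"
    and invariant: "\<And>u. u \<in> vfields B \<Longrightarrow> lie (h u) \<Phi>V = 0"
    and \<Phi>: "\<Phi> \<in> forms A 3" and closed: "ext_d A \<Phi> = 0"
    and ext: "\<And>ws. set ws \<subseteq> V \<Longrightarrow> \<Phi> ws = \<Phi>V ws"
begin

lemma \<Phi>_module: "\<Phi> \<in> module_forms A (vfields A) 3"
  using \<Phi> by (simp add: forms_def)

lemmas \<Phi>_swap = total.mform3_swap[OF total.vf_submodule_vfields \<Phi>_module]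

lemma \<Phi>_closed:
  "a \<in> vfields A \<Longrightarrow> b \<in> vfields A \<Longrightarrow> c \<in> vfields A \<Longrightarrow> d \<in> vfields A \<Longrightarrow>
    a x (\<Phi> [b, c, d]) - b x (\<Phi> [a, c, d]) + c x (\<Phi> [a, b, d]) - d x (\<Phi> [a, b, c])
    - \<Phi> [bracket A a b, c, d] x + \<Phi> [bracket A a c, b, d] x - \<Phi> [bracket A a d, b, c] x
    - \<Phi> [bracket A b c, a, d] x + \<Phi> [bracket A b d, a, c] x - \<Phi> [bracket A c d, a, b] x = 0"
  using fun_cong[OF fun_cong[OF closed], of "[a, b, c, d]" x]
    total.koszul_d_3[of a "vfields A" b c d \<Phi> x]
  by (simp add: ext_d_def)

lemma component_1_biform: "component 1 \<Phi> \<in> biforms A B p 1 2"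
  and component_2_biform: "component 2 \<Phi> \<in> biforms A B p 2 1"
  using component_biform[of \<Phi> 1 2] component_biform[of \<Phi> 2 1] \<Phi>
  by (simp_all del: One_nat_def)

text \<open>Closedness is evaluated on \<open>[h u, a, b, c]\<close>. The terms with three vertical
  arguments form \<open>lie (h u) \<Phi>V\<close>, which is 0 by invariance, and the others form
  minus the vertical differential of the component.\<close>

lemma dV_component_1: "D_V (component 1 \<Phi>) = 0"
proof
  fix vs
  show "D_V (component 1 \<Phi>) vs = 0 vs"
  proof (cases "length vs = 1 \<and> set vs \<subseteq> vfields B")
    case True
    then obtain u where vs: "vs = [u]" and u: "u \<in> vfields B"
      by (auto simp: length_Suc_conv)
    have "vert_d A B p (component 1 \<Phi> [u]) = 0"
    proof
      fix ws
      show "vert_d A B p (component 1 \<Phi> [u]) ws = 0 ws"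
      proof (cases "length ws = 3 \<and> set ws \<subseteq> V")
        case True
        then obtain a b c where ws: "ws = [a, b, c]" and abc: "a \<in> V" "b \<in> V" "c \<in> V"
          using length3_cases by metis
        note vf = hlift_vfield[OF u] abc[THEN V_vfield]
        note br = V_bracket_hlift[OF u] V_bracket
        note brv = br[THEN V_vfield]
        show ?thesis
          unfolding ws
        proof
          fix x
          have "\<Phi> [bracket A (h u) b, a, c] = - \<Phi> [a, bracket A (h u) b, c]"
            "\<Phi> [bracket A (h u) c, a, b] = \<Phi> [a, b, bracket A (h u) c]"
            "\<Phi> [bracket A a b, h u, c] = - \<Phi> [h u, bracket A a b, c]"
            "\<Phi> [bracket A a c, h u, b] = - \<Phi> [h u, bracket A a c, b]"
            "\<Phi> [bracket A b c, h u, a] = - \<Phi> [h u, bracket A b c, a]"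
            using \<Phi>_swap(1)[of a "bracket A (h u) b" c] \<Phi>_swap(1)[of a "bracket A (h u) c" b]
              \<Phi>_swap(2)[of a "bracket A (h u) c" b] \<Phi>_swap(1)[of "h u" "bracket A a b" c]
              \<Phi>_swap(1)[of "h u" "bracket A a c" b] \<Phi>_swap(1)[of "h u" "bracket A b c" a]
              vf abc brv
            by simp_all
          moreover have "h u x (\<Phi> [a, b, c]) = \<Phi> [bracket A (h u) a, b, c] x
              + \<Phi> [a, bracket A (h u) b, c] x + \<Phi> [a, b, bracket A (h u) c] x"
            using lie_3[OF abc, of "h u" \<Phi>V x] invariant[OF u] abc br
            by (simp add: ext)
          ultimately show "vert_d A B p (component 1 \<Phi> [u]) [a, b, c] x = 0 [a, b, c] x"
            using \<Phi>_closed[OF vf, of x] abc br u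
            by (simp add: vert_d_2 component_1 del: One_nat_def)
        qed
      next
        case False
        then show ?thesis
          using vert_d_junk[OF biform_form[OF component_1_biform], of ws]
            vert_d_nonvert[of ws "component 1 \<Phi> [u]"] by fastforce
      qed
    qed
    then show ?thesis by (simp add: vs dV_apply)
  next
    case False
    then show ?thesis using dV_junk[where \<Theta> = "component 1 \<Phi>", OF biform_junk[OF component_1_biform False]]
      by simp
  qed
qed

text \<open>Closedness is evaluated on \<open>[h u, h v, a, b]\<close>, and its ten terms are
  distributed over the three operators.\<close>

lemma dH_component_1:
  "D_H (component 1 \<Phi>) + D_V (component 2 \<Phi>) + dC A B p Hor (biform0 \<Phi>V) = 0"
proof
  fix vs
  show "(D_H (component 1 \<Phi>) + D_V (component 2 \<Phi>) + dC A B p Hor (biform0 \<Phi>V)) vs = 0 vs"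
  proof (cases "length vs = 2 \<and> set vs \<subseteq> vfields B")
    case True
    then obtain u v where vs: "vs = [u, v]" and u: "u \<in> vfields B" and v: "v \<in> vfields B"
      using length2_cases by metis
    note uv = base.vfields_bracket[OF u v]
    \<comment> \<open>The left side on \<open>[u, v]\<close>: on pairs \<open>D_V\<close> carries no
      sign, and the curvature form is minus a contraction.\<close>
    define \<eta> where "\<eta> = lie (h u) (component 1 \<Phi> [v]) - lie (h v) (component 1 \<Phi> [u])
        - component 1 \<Phi> [bracket B u v] + vert_d A B p (component 2 \<Phi> [u, v])
        - contraction (C u v) \<Phi>V"
    have "\<eta> = 0"
    proof
      fix ws
      show "\<eta> ws = 0 ws"
      proof (cases "length ws = 2 \<and> set ws \<subseteq> V")
        case True
        then obtain a b where ws: "ws = [a, b]" and ab: "a \<in> V" "b \<in> V"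
          using length2_cases by metis
        note vf = hlift_vfield[OF u] hlift_vfield[OF v] ab[THEN V_vfield]
        note br = V_bracket_hlift[OF u] V_bracket_hlift[OF v] V_bracket
        note brv = br[THEN V_vfield]
        show ?thesis
          unfolding ws
        proof
          fix x
          have "\<Phi> [bracket A (h u) a, h v, b] = - \<Phi> [h v, bracket A (h u) a, b]"
            "\<Phi> [bracket A (h u) b, h v, a] = \<Phi> [h v, a, bracket A (h u) b]"
            "\<Phi> [bracket A (h v) a, h u, b] = - \<Phi> [h u, bracket A (h v) a, b]"
            "\<Phi> [bracket A (h v) b, h u, a] = \<Phi> [h u, a, bracket A (h v) b]"
            "\<Phi> [bracket A a b, h u, h v] = \<Phi> [h u, h v, bracket A a b]"
            using \<Phi>_swap(1)[of "h v" "bracket A (h u) a" b]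
              \<Phi>_swap(1)[of "h v" "bracket A (h u) b" a] \<Phi>_swap(2)[of "h v" "bracket A (h u) b" a]
              \<Phi>_swap(1)[of "h u" "bracket A (h v) a" b]
              \<Phi>_swap(1)[of "h u" "bracket A (h v) b" a] \<Phi>_swap(2)[of "h u" "bracket A (h v) b" a]
              \<Phi>_swap(1)[of "h u" "bracket A a b" "h v"] \<Phi>_swap(2)[of "h u" "bracket A a b" "h v"]
              vf ab brv
            by simp_all
          \<comment> \<open>The curvature part of the bracket of lifts gives the curvature term, and
            the lift of \<open>bracket B u v\<close> gives the bracket term of
            \<open>D_H\<close>.\<close>
          moreover have "\<Phi> [bracket A (h u) (h v), a, b] = \<Phi> [C u v, a, b] + \<Phi> [h (bracket B u v), a, b]"
            using total.mform3_add(1)[OF total.vf_submodule_vfields \<Phi>_module,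
                of "C u v" a b "h (bracket B u v)"]
              curvature_vert[OF u v] hlift_vfield[OF uv] vf
            by (simp add: curvature_def V_vfield)
          ultimately show "\<eta> [a, b] x = 0 [a, b] x"
            using \<Phi>_closed[OF vf, of x] ab br u v uv curvature_vert[OF u v]
            by (simp add: \<eta>_def lie_2 vert_d_1 component_1 component_2 contraction_def flip: ext
                del: One_nat_def)
        qed
      next
        case False
        then show ?thesis
          using lie_junk[OF biform_form[OF component_1_biform] hlift_vfield[OF u] False]
            lie_junk[OF biform_form[OF component_1_biform] hlift_vfield[OF v] False]
            vert_form_junk[OF biform_form[OF component_1_biform] False]
            vert_form_junk[OF contraction_vert_form[OF _ curvature_vert[OF u v]] False, of \<Phi>V]
            vert_d_junk[OF biform_form[OF component_2_biform], of ws]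
            vert_d_nonvert[of ws "component 2 \<Phi> [u, v]"] \<Phi>V
          by (cases "set ws \<subseteq> V") (simp_all add: \<eta>_def)
      qed
    qed
    then show ?thesis
      by (simp add: vs dH_1 u v dV_apply dC_biform0[OF \<Phi>V] \<eta>_def)
  next
    case False
    have "component 1 \<Phi> us = 0" if "length us \<noteq> 1" for us
      using that by (intro biform_junk[OF component_1_biform]) simp
    then show ?thesis
      using False
      by (simp add: dH_junk[of 1] dV_junk biform_junk[OF component_2_biform]
          dC_biform0_junk[OF \<Phi>V])
  qed
qed

end


subsection \<open>Classes in the spectral sequence\<close>

lemma biforms_add:
  assumes "\<Theta> \<in> biforms A B p k q" "\<Xi> \<in> biforms A B p k q"
  shows "\<Theta> + \<Xi> \<in> biforms A B p k q"
  using biforms_diff[OF assms(1) biforms_diff[OF biforms_zero assms(2)]] by simp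

lemma B1_Suc: "B1 A B p k (Suc q) = D_V ` biforms A B p k q"
  by (simp add: B1_def)

lemma B1_diff:
  assumes "b \<in> B1 A B p k (Suc q)" "b' \<in> B1 A B p k (Suc q)"
  shows "b - b' \<in> B1 A B p k (Suc q)"
proof -
  obtain \<beta> \<beta>' where \<beta>: "\<beta> \<in> biforms A B p k q" "\<beta>' \<in> biforms A B p k q"
    and b: "b = D_V \<beta>" "b' = D_V \<beta>'"
    using assms unfolding B1_Suc by blast
  have "b - b' = D_V (\<beta> - \<beta>')"
    unfolding b by (rule dV_diff[symmetric]) (rule biform_smooth[OF \<beta>(1)], rule biform_smooth[OF \<beta>(2)])
  then show ?thesis using biforms_diff[OF \<beta>] by (simp add: B1_Suc)
qed

lemma B1_zero: "0 \<in> B1 A B p k (Suc q)"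
proof -
  have "D_V 0 = 0" by (rule ext) (simp add: dV_junk)
  then show ?thesis unfolding B1_Suc using biforms_zero by (metis imageI)
qed

lemma B1_add:
  assumes "b \<in> B1 A B p k (Suc q)" "b' \<in> B1 A B p k (Suc q)"
  shows "b + b' \<in> B1 A B p k (Suc q)"
  using B1_diff[OF assms(1) B1_diff[OF B1_zero assms(2)]] by simp

lemma B1_smooth:
  assumes "b \<in> B1 A B p k (Suc q)"
  shows "b vs ws \<in> smooth_funs A"
proof -
  obtain \<beta> where \<beta>: "\<beta> \<in> biforms A B p k q" "b = D_V \<beta>" using assms unfolding B1_Suc by blast
  show ?thesis unfolding \<beta>(2) by (rule dV_smooth) (rule biform_smooth[OF \<beta>(1)])
qed

lemma class1_eq: "class1 A B p k q \<Theta> = (\<lambda>b. b + \<Theta>) ` B1 A B p k q"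
  unfolding class1_def r_coset_def Z1_def additive_group_def by auto

lemma class1_cong:
  assumes "\<Theta> - \<Xi> \<in> B1 A B p k (Suc q)"
  shows "class1 A B p k (Suc q) \<Theta> = class1 A B p k (Suc q) \<Xi>"
  unfolding class1_eq
proof (intro equalityI image_subsetI)
  fix b assume b: "b \<in> B1 A B p k (Suc q)"
  have "b + \<Theta> = (b + (\<Theta> - \<Xi>)) + \<Xi>" "b + \<Xi> = (b - (\<Theta> - \<Xi>)) + \<Theta>" by simp_all
  then show "b + \<Theta> \<in> (\<lambda>b. b + \<Xi>) ` B1 A B p k (Suc q)"
    "b + \<Xi> \<in> (\<lambda>b. b + \<Theta>) ` B1 A B p k (Suc q)"
    using B1_add[OF b assms] B1_diff[OF b assms] by blast+
qed

lemma class1_zero: "class1 A B p k q 0 = B1 A B p k q"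
  by (simp add: class1_eq)

text \<open>The group law of the quotient is the elementwise sum of cosets; it is computed here on
  representatives.\<close>

lemma class1_add:
  "class1 A B p k (Suc q) \<Theta> <#>\<^bsub>Z1 A B p k (Suc q)\<^esub> class1 A B p k (Suc q) \<Xi>
    = class1 A B p k (Suc q) (\<Theta> + \<Xi>)"
proof -
  have "(\<Union>b\<in>B1 A B p k (Suc q). \<Union>b'\<in>B1 A B p k (Suc q). {(b + \<Theta>) + (b' + \<Xi>)})
      = (\<lambda>b. b + (\<Theta> + \<Xi>)) ` B1 A B p k (Suc q)" (is "?l = ?r")
  proof
    show "?l \<subseteq> ?r"
    proof clarify
      fix b b' assume "b \<in> B1 A B p k (Suc q)" "b' \<in> B1 A B p k (Suc q)"
      then have "b + b' \<in> B1 A B p k (Suc q)" by (rule B1_add)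
      moreover have "(b + \<Theta>) + (b' + \<Xi>) = (b + b') + (\<Theta> + \<Xi>)" by (simp add: algebra_simps)
      ultimately show "(b + \<Theta>) + (b' + \<Xi>) \<in> ?r" by blast
    qed
    show "?r \<subseteq> ?l"
    proof (rule image_subsetI)
      fix b assume "b \<in> B1 A B p k (Suc q)"
      moreover have "b + (\<Theta> + \<Xi>) = (b + \<Theta>) + (0 + \<Xi>)" by (simp add: algebra_simps)
      ultimately show "b + (\<Theta> + \<Xi>) \<in> ?l" using B1_zero[of k q] by blast
    qed
  qed
  then show ?thesis
    by (simp add: class1_eq set_mult_def Z1_def additive_group_def)
qed

lemma one_E1: "\<one>\<^bsub>E1 A B p k q\<^esub> = B1 A B p k q"
  by (simp add: E1_def FactGroup_def)

lemma carrier_E1: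
  "carrier (E1 A B p k q) = class1 A B p k q ` {\<Theta> \<in> biforms A B p k q. D_V \<Theta> = 0}"
  by (auto simp: E1_def FactGroup_def RCOSETS_def class1_def Z1_def additive_group_def)

lemma dH_add:
  assumes "\<And>vs ws. \<Theta> vs ws \<in> smooth_funs A" "\<And>vs ws. \<Xi> vs ws \<in> smooth_funs A"
  shows "D_H (\<Theta> + \<Xi>) = D_H \<Theta> + D_H \<Xi>"
  using dH_diff[where \<Theta> = "\<Theta> + \<Xi>" and \<Xi> = \<Xi>] assms by (simp add: total.smooth_add)

text \<open>Well-definedness of the induced map: \<open>the_elem\<close> returns the intended class
  because representatives differ by boundaries and \<open>D_H\<close> preserves boundaries, so that
  the image is a singleton.\<close>

lemma dH_induced_class1:
  assumes B1: "\<And>b. b \<in> B1 A B p k (Suc q) \<Longrightarrow> D_H b \<in> B1 A B p (Suc k) (Suc q)"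
    and \<Theta>: "\<Theta> \<in> biforms A B p k (Suc q)"
  shows "dH_induced A B p Hor k (Suc q) (class1 A B p k (Suc q) \<Theta>)
    = class1 A B p (Suc k) (Suc q) (D_H \<Theta>)"
proof -
  have "class1 A B p (Suc k) (Suc q) (D_H (b + \<Theta>)) = class1 A B p (Suc k) (Suc q) (D_H \<Theta>)"
    if "b \<in> B1 A B p k (Suc q)" for b
    using B1[OF that] dH_add[where \<Theta> = b and \<Xi> = \<Theta>] B1_smooth[OF that] biform_smooth[OF \<Theta>]
    by (intro class1_cong) simp
  then have "(\<lambda>\<Xi>. class1 A B p (Suc k) (Suc q) (D_H \<Xi>)) ` class1 A B p k (Suc q) \<Theta>
      = {class1 A B p (Suc k) (Suc q) (D_H \<Theta>)}"
    using B1_zero[of k q] unfolding class1_eq[of k] by (auto simp: image_image)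
  then show ?thesis by (simp add: dH_induced_def)
qed

text \<open>By anticommutation \<open>D_H\<close> of a boundary is minus a boundary, and boundaries
  are closed under differences.\<close>

lemma dH_B1_1:
  assumes "b \<in> B1 A B p 1 2"
  shows "D_H b \<in> B1 A B p 2 2"
proof -
  obtain \<beta> where \<beta>: "\<beta> \<in> biforms A B p 1 1" "b = D_V \<beta>"
    using assms B1_Suc[of 1 1] by (auto simp: numeral_2_eq_2)
  have "D_H b = 0 - D_V (D_H \<beta>)" using dH_dV_1[OF \<beta>(1)] \<beta>(2) by simp
  moreover have "D_V (D_H \<beta>) \<in> B1 A B p 2 (Suc 1)"
    unfolding B1_Suc using dH_biform1[OF \<beta>(1)] by blast
  ultimately show ?thesis
    using B1_diff[OF B1_zero, of "D_V (D_H \<beta>)" 2 1] by (simp add: numeral_2_eq_2)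
qed

lemma dH_B1_2:
  assumes "b \<in> B1 A B p 2 2"
  shows "D_H b \<in> B1 A B p 3 2"
proof -
  obtain \<beta> where \<beta>: "\<beta> \<in> biforms A B p 2 1" "b = D_V \<beta>"
    using assms B1_Suc[of 2 1] by (auto simp: numeral_2_eq_2)
  have "D_H b = 0 - D_V (D_H \<beta>)" using dH_dV_2[OF \<beta>(1)] \<beta>(2) by simp
  moreover have "D_V (D_H \<beta>) \<in> B1 A B p 3 (Suc 1)"
    unfolding B1_Suc using dH_biform2[OF \<beta>(1)] by blast
  ultimately show ?thesis
    using B1_diff[OF B1_zero, of "D_V (D_H \<beta>)" 3 1] by (simp add: numeral_2_eq_2)
qed

lemma dH_induced_1:
  "\<Theta> \<in> biforms A B p 1 2 \<Longrightarrow>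
    dH_induced A B p Hor 1 2 (class1 A B p 1 2 \<Theta>) = class1 A B p 2 2 (D_H \<Theta>)"
  using dH_induced_class1[of 1 1 \<Theta>] dH_B1_1 by (simp add: numeral_2_eq_2)

lemma dH_induced_2:
  "\<Theta> \<in> biforms A B p 2 2 \<Longrightarrow>
    dH_induced A B p Hor 2 2 (class1 A B p 2 2 \<Theta>) = class1 A B p 3 2 (D_H \<Theta>)"
  using dH_induced_class1[of 2 1 \<Theta>] dH_B1_2 by (simp add: numeral_2_eq_2 numeral_3_eq_3)

lemma B2_2:
  "B2 A B p Hor 2 2 = (\<lambda>\<beta>. class1 A B p 2 2 (D_H \<beta>)) ` {\<beta> \<in> biforms A B p 1 2. D_V \<beta> = 0}"
proof -
  have "B2 A B p Hor 2 2 = dH_induced A B p Hor 1 2 ` carrier (E1 A B p 1 2)"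
    by (simp add: B2_def numeral_2_eq_2)
  also have "\<dots> = (\<lambda>\<beta>. dH_induced A B p Hor 1 2 (class1 A B p 1 2 \<beta>))
      ` {\<beta> \<in> biforms A B p 1 2. D_V \<beta> = 0}"
    unfolding carrier_E1 image_image ..
  also have "\<dots> = (\<lambda>\<beta>. class1 A B p 2 2 (D_H \<beta>)) ` {\<beta> \<in> biforms A B p 1 2. D_V \<beta> = 0}"
    by (rule image_cong) (simp_all add: dH_induced_1 del: One_nat_def)
  finally show ?thesis .
qed

lemma one_E2: "\<one>\<^bsub>E2 A B p Hor k q\<^esub> = B2 A B p Hor k q"
  by (simp add: E2_def FactGroup_def)

lemma class2_carrier:
  assumes "class1 A B p k q \<Theta> \<in> carrier (E1 A B p k q)"
    and "dH_induced A B p Hor k q (class1 A B p k q \<Theta>) = \<one>\<^bsub>E1 A B p (Suc k) q\<^esub>"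
  shows "class2 A B p Hor k q \<Theta> \<in> carrier (E2 A B p Hor k q)"
proof -
  have "class1 A B p k q \<Theta> \<in> carrier (Z2 A B p Hor k q)"
    using assms by (simp add: Z2_def kernel_def)
  then show ?thesis
    unfolding E2_def FactGroup_def RCOSETS_def class2_def by auto
qed

text \<open>The coset in question is \<open>B2\<close> translated by the class of
  \<open>D_H \<beta>\<close>, an element of \<open>B2\<close>. Replacing \<open>\<beta>'\<close> by
  \<open>\<beta>' + \<beta>\<close> permutes the cocycles that parametrise \<open>B2\<close>, so the
  translate is \<open>B2\<close> again.\<close>

lemma class2_trivial:
  assumes \<beta>: "\<beta> \<in> biforms A B p 1 2" "D_V \<beta> = 0" and "\<Theta> - D_H \<beta> \<in> B1 A B p 2 2"
  shows "class2 A B p Hor 2 2 \<Theta> = \<one>\<^bsub>E2 A B p Hor 2 2\<^esub>"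
proof -
  let ?Z = "{\<beta> \<in> biforms A B p 1 2. D_V \<beta> = 0}"
  have sum: "class1 A B p 2 2 \<Theta>' <#>\<^bsub>Z1 A B p 2 2\<^esub> class1 A B p 2 2 \<Theta>''
      = class1 A B p 2 2 (\<Theta>' + \<Theta>'')" for \<Theta>' \<Theta>''
    using class1_add[of 2 1 \<Theta>' \<Theta>''] by (simp add: numeral_2_eq_2)
  have \<Theta>: "class1 A B p 2 2 \<Theta> = class1 A B p 2 2 (D_H \<beta>)"
    using class1_cong[of \<Theta> "D_H \<beta>" 2 1] assms(3) by (simp add: numeral_2_eq_2)
  have shift: "class1 A B p 2 2 (D_H \<beta>') <#>\<^bsub>Z1 A B p 2 2\<^esub> class1 A B p 2 2 \<Theta>
      = class1 A B p 2 2 (D_H (\<beta>' + \<beta>))" if "\<beta>' \<in> biforms A B p 1 2" for \<beta>'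
    unfolding \<Theta> sum
    using dH_add[where \<Theta> = \<beta>' and \<Xi> = \<beta>] biform_smooth[OF that] biform_smooth[OF \<beta>(1)] by simp
  have closed: "\<beta>' + \<beta> \<in> ?Z" "\<beta>' - \<beta> \<in> ?Z" if "\<beta>' \<in> ?Z" for \<beta>'
  proof -
    have \<beta>': "\<beta>' \<in> biforms A B p 1 2" using that by blast
    have "D_V (\<beta>' - \<beta>) = D_V \<beta>' - D_V \<beta>"
      by (rule dV_diff) (rule biform_smooth[OF \<beta>'], rule biform_smooth[OF \<beta>(1)])
    \<comment> \<open>Closedness of the sum is derived from the rule for differences, applied to
      \<open>\<beta>' + \<beta>\<close> and \<open>\<beta>\<close>.\<close>
    moreover have "D_V ((\<beta>' + \<beta>) - \<beta>) = D_V (\<beta>' + \<beta>) - D_V \<beta>"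
      by (rule dV_diff)
        (rule biform_smooth[OF biforms_add[OF \<beta>' \<beta>(1)]], rule biform_smooth[OF \<beta>(1)])
    ultimately show "\<beta>' + \<beta> \<in> ?Z" "\<beta>' - \<beta> \<in> ?Z"
      using that \<beta> biforms_add[of \<beta>' 1 2 \<beta>] biforms_diff[of \<beta>' 1 2 \<beta>] by simp_all
  qed
  have "class2 A B p Hor 2 2 \<Theta>
      = (\<lambda>\<beta>'. class1 A B p 2 2 (D_H \<beta>') <#>\<^bsub>Z1 A B p 2 2\<^esub> class1 A B p 2 2 \<Theta>) ` ?Z"
    unfolding class2_def r_coset_def B2_2 Z2_def E1_def FactGroup_def by auto
  also have "\<dots> = (\<lambda>\<beta>'. class1 A B p 2 2 (D_H (\<beta>' + \<beta>))) ` ?Z"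
    by (rule image_cong) (simp_all add: shift del: One_nat_def)
  also have "\<dots> = (\<lambda>\<beta>'. class1 A B p 2 2 (D_H \<beta>')) ` ((\<lambda>\<beta>'. \<beta>' + \<beta>) ` ?Z)"
    by (simp only: image_image)
  also have "(\<lambda>\<beta>'. \<beta>' + \<beta>) ` ?Z = ?Z"
  proof
    show "(\<lambda>\<beta>'. \<beta>' + \<beta>) ` ?Z \<subseteq> ?Z" using closed(1) by blast
    show "?Z \<subseteq> (\<lambda>\<beta>'. \<beta>' + \<beta>) ` ?Z"
    proof
      fix \<beta>' assume "\<beta>' \<in> ?Z"
      then show "\<beta>' \<in> (\<lambda>\<beta>'. \<beta>' + \<beta>) ` ?Z"
        by (intro image_eqI[of _ _ "\<beta>' - \<beta>"] closed(2)) simp_all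
    qed
  qed
  finally show ?thesis unfolding one_E2 B2_2 .
qed

end

theorem proposition11:
  fixes A :: "('m::{t2_space, second_countable_topology}, 'e::real_inner) atlas"
    and B :: "('b::{t2_space, second_countable_topology}, 'f::real_inner) atlas"
    and p :: "'m \<Rightarrow> 'b"
    and \<Phi>V :: "'m form"
    and Hor :: "'m \<Rightarrow> 'm tvec set"
  assumes "two_plectic_fibration A B p \<Phi>V"
    and "two_plectic_connection A B p \<Phi>V Hor"
  defines "\<Theta> \<equiv> dC A B p Hor (biform0 \<Phi>V)"
  shows "\<Theta> \<in> biforms A B p 2 2 \<and>
    dV A B p \<Theta> = 0 \<and>
    class1 A B p 2 2 \<Theta> \<in> carrier (E1 A B p 2 2) \<and>
    dH_induced A B p Hor 2 2 (class1 A B p 2 2 \<Theta>) = \<one>\<^bsub>E1 A B p 3 2\<^esub> \<and>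
    class2 A B p Hor 2 2 \<Theta> \<in> carrier (E2 A B p Hor 2 2) \<and>
    ((\<exists>\<Phi>\<in>forms A 3. ext_d A \<Phi> = 0 \<and>
        (\<forall>ws. set ws \<subseteq> vert_fields A B p \<longrightarrow> \<Phi> ws = \<Phi>V ws)) \<longrightarrow>
      class2 A B p Hor 2 2 \<Theta> = \<one>\<^bsub>E2 A B p Hor 2 2\<^esub>)"
proof -
  have fib: "fibration A B p" and \<Phi>V: "\<Phi>V \<in> vert_forms A B p 3" and d\<Phi>V: "vert_d A B p \<Phi>V = 0"
    using assms(1) unfolding two_plectic_fibration_def by auto
  have conn: "ehresmann_connection A B p Hor" and dH\<Phi>V: "dH A B p Hor (biform0 \<Phi>V) = 0"
    using assms(2) unfolding two_plectic_connection_def by auto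
  interpret ehresmann_fibred A B p Hor
    using fib conn unfolding fibration_def by unfold_locales auto
  \<comment> \<open>In base degree 0 the horizontal differential is the Lie derivative along the
    lift, so a 2-plectic connection is one whose lifts preserve \<open>\<Phi>V\<close>.\<close>
  have invariant: "lie (h u) \<Phi>V = 0" if "u \<in> vfields B" for u
    using dH_0[OF that, of "biform0 \<Phi>V"] dH\<Phi>V by (simp add: biform0_def)
  have \<Theta>: "\<Theta> \<in> biforms A B p 2 2" unfolding \<Theta>_def by (rule dC_biform[OF \<Phi>V])
  have dV\<Theta>: "dV A B p \<Theta> = 0" unfolding \<Theta>_def by (rule dV_dC[OF \<Phi>V invariant d\<Phi>V])
  have dH\<Theta>: "dH A B p Hor \<Theta> = 0" unfolding \<Theta>_def by (rule dH_dC[OF \<Phi>V invariant])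
  have E1: "class1 A B p 2 2 \<Theta> \<in> carrier (E1 A B p 2 2)"
    unfolding carrier_E1 using \<Theta> dV\<Theta> by blast
  have ker: "dH_induced A B p Hor 2 2 (class1 A B p 2 2 \<Theta>) = \<one>\<^bsub>E1 A B p 3 2\<^esub>"
    unfolding dH_induced_2[OF \<Theta>] dH\<Theta> one_E1 by (rule class1_zero)
  have E2: "class2 A B p Hor 2 2 \<Theta> \<in> carrier (E2 A B p Hor 2 2)"
    using E1 ker by (intro class2_carrier) simp_all
  have "class2 A B p Hor 2 2 \<Theta> = \<one>\<^bsub>E2 A B p Hor 2 2\<^esub>"
    if \<Phi>: "\<Phi> \<in> forms A 3" "ext_d A \<Phi> = 0" "\<And>ws. set ws \<subseteq> V \<Longrightarrow> \<Phi> ws = \<Phi>V ws" for \<Phi>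
  proof -
    note D1 = component_1_biform[OF \<Phi>V invariant \<Phi>]
      and D2 = component_2_biform[OF \<Phi>V invariant \<Phi>]
    note smooth1 = biform_smooth[OF D1] and smooth2 = biform_smooth[OF D2]
    have zero: "(0 :: ('b, 'm) biform) vs ws \<in> smooth_funs A" for vs ws
      by (simp add: total.smooth_zero)
    have dV0: "D_V 0 = 0" and dH0: "D_H 0 = 0"
      using dV_diff[of 0 0] dH_diff[of 0 0] zero by simp_all
    have sum: "D_H (component 1 \<Phi>) + D_V (component 2 \<Phi>) + \<Theta> = 0"
      unfolding \<Theta>_def by (rule dH_component_1[OF \<Phi>V invariant \<Phi>])
    \<comment> \<open>Solving \<open>sum\<close> for \<open>\<Theta>\<close> shows that it is
      \<open>D_H\<close> of minus the first component, up to the boundary \<open>D_V\<close> of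
      minus the second. The negatives are written as differences from 0 to match the rules for
      differences.\<close>
    show ?thesis
    proof (rule class2_trivial)
      show "0 - component 1 \<Phi> \<in> biforms A B p 1 2" by (rule biforms_diff[OF biforms_zero D1])
      show "D_V (0 - component 1 \<Phi>) = 0"
        using dV_diff[where \<Theta> = 0 and \<Xi> = "component 1 \<Phi>", OF zero smooth1] dV0
          dV_component_1[OF \<Phi>V invariant \<Phi>] by simp
      have D_H_neg: "D_H (0 - component 1 \<Phi>) = - D_H (component 1 \<Phi>)"
        using dH_diff[where \<Theta> = 0 and \<Xi> = "component 1 \<Phi>", OF zero smooth1] dH0 by simp
      have D_V_neg: "D_V (0 - component 2 \<Phi>) = - D_V (component 2 \<Phi>)"
        using dV_diff[where \<Theta> = 0 and \<Xi> = "component 2 \<Phi>", OF zero smooth2] dV0 by simp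
      have "\<Theta> - D_H (0 - component 1 \<Phi>) = D_V (0 - component 2 \<Phi>)"
        unfolding D_H_neg D_V_neg minus_unique[OF sum, symmetric] by simp
      moreover have "D_V (0 - component 2 \<Phi>) \<in> B1 A B p 2 (Suc 1)"
        unfolding B1_Suc by (rule imageI) (rule biforms_diff[OF biforms_zero D2])
      ultimately show "\<Theta> - D_H (0 - component 1 \<Phi>) \<in> B1 A B p 2 2"
        by (simp add: numeral_2_eq_2)
    qed
  qed
  then show ?thesis using \<Theta> dV\<Theta> E1 ker E2 by blast
qed

end
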